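(* Let $0<\alpha<1$. Then $$\operatorname{Alg}\big(\mathcal H_{\Phi_{\alpha/(1-\alpha)}}\big)=\bigcup_{d>0}\mathcal H_{\varphi^d_{\alpha/(1-\alpha)}\circ\log}\subset\operatorname{Mult}(\mathcal H_{\Phi_\alpha})\subset\bigcap_{0<\beta<\alpha/(1-\alpha)}\mathcal H_{\Phi_\beta}.$$
   Context: $\mathbb D$ is the open unit disk, $\mathbb T=\partial\mathbb D$ with normalized Lebesgue measure $m$, $\operatorname{Hol}(\mathbb D)$ is the space of holomorphic functions on $\mathbb D$, and $N^+$ is the Smirnov class on $\mathbb D$; functions in $N^+$ have non-tangential boundary values a.e. on $\mathbb T$, denoted by the same letter. A function $\varphi:\mathbb R\to[0,\infty)$ is strongly convex if it is convex, nondecreasing and $\lim_{t\to\infty}\varphi(t)/t=\infty$; one sets $\varphi(-\infty)=0$. With $\Phi=\varphi\circ\log$, the Hardy-Orlicz class is $\mathcal H_\Phi=\{f\in N^+:\int_{\mathbb T}\Phi(|f|)\,dm<\infty\}$. For $X\subset\operatorname{Hol}(\mathbb D)$, $\operatorname{Mult}(X)=\{g\in\operatorname{Hol}(\mathbb D): gf\in X \text{ for all } f\in X\}$, and $\operatorname{Alg}(X)$ is the algebra of functions generated by $X$. For $\beta>0$ and $d>0$, $\varphi_\beta(t)=e^{t^\beta}$ and $\varphi_\beta^d(t)=e^{d\,t^\beta}$ for all sufficiently large $t$, extended to strongly convex functions on $\mathbb R$; $\Phi_\beta=\varphi_\beta\circ\log$. (The Hardy-Orlicz class depends only on the values of the defining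 function for large $t$, so the choice of extension is immaterial.) *)

theory Defs
  imports "HOL-Analysis.Analysis"
begin

text \<open>A function on the open unit disk is represented by its extension by zero to all of
  \<open>complex\<close>, so that equality of functions on the disk is equality in HOL; pointwise sums,
  products and scalar multiples respect this.\<close>

definition Hol_disk :: "(complex \<Rightarrow> complex) set" where
  "Hol_disk = {f. f holomorphic_on ball 0 1 \<and> (\<forall>z. z \<notin> ball 0 1 \<longrightarrow> f z = 0)}"

text \<open>Normalized Lebesgue measure on the unit circle, as a Borel measure on \<open>complex\<close>
  concentrated on the circle.\<close>

definition circle_measure :: "complex measure" where
  "circle_measure = distr (uniform_measure lborel {0..2*pi}) borel cis"

definition stolz_region :: "real \<Rightarrow> complex \<Rightarrow> complex set" where
  "stolz_region M \<zeta> = {z \<in> ball 0 1. cmod (z - \<zeta>) < M * (1 - cmod z)}"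

definition has_nontangential_limit ::
  "(complex \<Rightarrow> complex) \<Rightarrow> complex \<Rightarrow> complex \<Rightarrow> bool" where
  "has_nontangential_limit f \<zeta> l \<longleftrightarrow>
     (\<forall>M>1. (f \<longlongrightarrow> l) (at \<zeta> within stolz_region M \<zeta>))"

text \<open>Unspecified where the non-tangential limit does not exist; for functions in the
  Smirnov class this is a null set of the circle.\<close>

definition boundary_value :: "(complex \<Rightarrow> complex) \<Rightarrow> complex \<Rightarrow> complex" where
  "boundary_value f \<zeta> = (THE l. has_nontangential_limit f \<zeta> l)"

definition H_infinity :: "(complex \<Rightarrow> complex) set" where
  "H_infinity = {f \<in> Hol_disk. bounded (f ` ball 0 1)}"

text \<open>The function \<open>k\<close> below is \<open>log \<psi>\<close> in the usual representation of an outer function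
  with boundary modulus \<open>\<psi>\<close>.\<close>

definition outer_function :: "(complex \<Rightarrow> complex) \<Rightarrow> bool" where
  "outer_function h \<longleftrightarrow>
     (\<exists>(c::complex) (k::complex \<Rightarrow> real). cmod c = 1 \<and> integrable circle_measure k \<and>
       (\<forall>z\<in>ball 0 1.
          h z = c * exp (LINT \<zeta>|circle_measure. (\<zeta> + z) / (\<zeta> - z) * of_real (k \<zeta>))))"

definition Smirnov :: "(complex \<Rightarrow> complex) set" where
  "Smirnov = {f \<in> Hol_disk. \<exists>g\<in>H_infinity. \<exists>h\<in>H_infinity.
      outer_function h \<and> (\<forall>z\<in>ball 0 1. f z = g z / h z)}"

definition strongly_convex :: "(real \<Rightarrow> real) \<Rightarrow> bool" where
  "strongly_convex \<phi> \<longleftrightarrow> (\<forall>t. 0 \<le> \<phi> t) \<and> convex_on UNIV \<phi> \<and> mono \<phi> \<and>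
     filterlim (\<lambda>t. \<phi> t / t) at_top at_top"

text \<open>The composition of \<open>\<phi>\<close> with the logarithm on \<open>[0, \<infinity>)\<close>, with the conventions
  \<open>log 0 = -\<infinity>\<close> and \<open>\<phi> (-\<infinity>) = 0\<close> (whereas \<open>ln 0 = 0\<close> in HOL).\<close>

definition comp_log :: "(real \<Rightarrow> real) \<Rightarrow> real \<Rightarrow> real" where
  "comp_log \<phi> x = (if x > 0 then \<phi> (ln x) else 0)"

definition Hardy_Orlicz :: "(real \<Rightarrow> real) \<Rightarrow> (complex \<Rightarrow> complex) set" where
  "Hardy_Orlicz \<Phi> = {f \<in> Smirnov.
     (\<integral>\<^sup>+ \<zeta>. ennreal (\<Phi> (cmod (boundary_value f \<zeta>))) \<partial>circle_measure) < \<infinity>}"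

definition Mult :: "(complex \<Rightarrow> complex) set \<Rightarrow> (complex \<Rightarrow> complex) set" where
  "Mult X = {g \<in> Hol_disk. \<forall>f\<in>X. (\<lambda>z. g z * f z) \<in> X}"

text \<open>The complex algebra generated by \<open>X\<close>. No unit is adjoined; this makes no difference
  when \<open>X\<close> contains the constants, as every Hardy-Orlicz class of a strongly convex function
  does.\<close>

inductive_set Alg :: "(complex \<Rightarrow> complex) set \<Rightarrow> (complex \<Rightarrow> complex) set"
  for X :: "(complex \<Rightarrow> complex) set" where
  gen: "f \<in> X \<Longrightarrow> f \<in> Alg X"
| zero: "(\<lambda>z. 0) \<in> Alg X"
| add: "f \<in> Alg X \<Longrightarrow> g \<in> Alg X \<Longrightarrow> (\<lambda>z. f z + g z) \<in> Alg X"
| scale: "f \<in> Alg X \<Longrightarrow> (\<lambda>z. c * f z) \<in> Alg X"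
| mult: "f \<in> Alg X \<Longrightarrow> g \<in> Alg X \<Longrightarrow> (\<lambda>z. f z * g z) \<in> Alg X"

text \<open>\<open>\<phi>\<close> is a strongly convex extension of \<open>t \<mapsto> exp (d t\<^sup>\<beta>)\<close>, given for large \<open>t\<close>.\<close>

definition exp_power_extension :: "real \<Rightarrow> real \<Rightarrow> (real \<Rightarrow> real) \<Rightarrow> bool" where
  "exp_power_extension d \<beta> \<phi> \<longleftrightarrow> strongly_convex \<phi> \<and>
     (\<forall>\<^sub>F t in at_top. \<phi> t = exp (d * t powr \<beta>))"

end

theory Submission
  imports Defs "HOL-Complex_Analysis.Complex_Analysis" "HOL-Real_Asymp.Real_Asymp"
begin

text \<open>Fatou's theorem makes membership in a Hardy-Orlicz class a statement about the boundary
  modulus: with \<open>u = log\<^sup>+ \<bar>f\<bar>\<close> on the circle, the classes in question are given by integrability of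
  \<open>exp (d u\<^sup>\<beta>)\<close>. Write \<open>\<gamma> = \<alpha> / (1 - \<alpha>)\<close>.

  Sums and products only change the constant \<open>d\<close>. Conversely, if \<open>O\<close> is the outer function of
  modulus \<open>max 1 \<bar>f\<bar>\<close>, then \<open>f = (f / O) (O\<^bsup>1/n\<^esup>)\<^sup>n\<close>, where \<open>f / O\<close> has boundary modulus at most 1 and
  \<open>O\<^bsup>1/n\<^esup>\<close> has \<open>exp (u\<^sup>\<gamma> / n\<^sup>\<gamma>)\<close> integrable for large \<open>n\<close>.

  For the multipliers, \<open>(a + b)\<^sup>\<alpha> \<le> a\<^sup>\<alpha> + C\<close> when \<open>b \<le> C a\<^bsup>1-\<alpha>\<^esup>\<close>, and otherwise \<open>a\<^sup>\<alpha>\<close> is at most a small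
  multiple of \<open>b\<^sup>\<gamma>\<close>. In the other direction a multiplier is tested against an outer function whose
  modulus is a function of the multiplier's own boundary modulus.\<close>

section \<open>Normalized Lebesgue measure on the circle\<close>

text \<open>The exponent \<alpha> / (1 - \<alpha>) comes from the slope of t^\<alpha>: raising a by
  b raises a^\<alpha> by at most \<alpha> b a^(\<alpha>-1), which stays bounded as long as b is at
  most a multiple of a^(1-\<alpha>); at the crossover a^\<alpha> is comparable to
  b^(\<alpha>/(1-\<alpha>)). The converse must work without knowing the measures s_n of the level
  sets of the multiplier. Summability allows a test modulus exp A_n with A_n^\<alpha> as large as
  log (1 / s_n), up to a logarithm of n, but a large A_n flattens t^\<alpha> and hides the
  multiplier. So A_n^\<alpha> is capped at n^\<beta>'. The multiplier property then shows that the
  cap is the smaller of the two for all large n with s_n > 0, and this is a decay estimate for s_n.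
  The cap needs strict room, \<beta> < \<beta>' < \<alpha> / (1 - \<alpha>). A formal obstacle is
  that \<open>boundary_value\<close> is a description, known to be measurable only after a change on
  a null set; all estimates therefore run through Borel representatives.\<close>

lemma circle_measure_alt:
  "circle_measure = distr (density lborel (\<lambda>t. ennreal (indicator {0..2*pi} t / (2*pi)))) borel cis"
proof -
  have "uniform_measure lborel {0..2*pi} =
      density lborel (\<lambda>t. ennreal (indicator {0..2*pi} t / (2*pi)))"
    unfolding uniform_measure_def
    by (rule density_cong) (use divide_ennreal[of 1 "2*pi"] in \<open>auto simp: indicator_def\<close>)
  then show ?thesis by (simp add: circle_measure_def)
qed

lemma measurable_cis [measurable]: "cis \<in> borel_measurable borel"
  by (intro borel_measurable_continuous_onI continuous_on_cis continuous_on_id)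

lemma sets_circle_measure [simp, measurable_cong]: "sets circle_measure = sets borel"
  by (simp add: circle_measure_def)

lemma space_circle_measure [simp]: "space circle_measure = UNIV"
  by (simp add: circle_measure_def)

lemma emeasure_circle_measure_UNIV: "emeasure circle_measure UNIV = 1"
proof -
  have "emeasure circle_measure UNIV = emeasure (uniform_measure lborel {0..2*pi}) UNIV"
    by (simp add: circle_measure_def emeasure_distr)
  also have "\<dots> = 1"
    by (simp add: divide_ennreal)
  finally show ?thesis .
qed

lemma finite_measure_circle_measure: "finite_measure circle_measure"
  by (rule finite_measureI) (simp add: emeasure_circle_measure_UNIV)

interpretation circle: finite_measure circle_measure
  by (rule finite_measure_circle_measure)

lemma measure_circle_measure_UNIV [simp]: "measure circle_measure UNIV = 1"
  by (simp add: measure_def emeasure_circle_measure_UNIV)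

lemma integrable_circle_measure_iff:
  fixes f :: "complex \<Rightarrow> 'a :: {banach, second_countable_topology}"
  assumes [measurable]: "f \<in> borel_measurable borel"
  shows "integrable circle_measure f \<longleftrightarrow> set_integrable lborel {0..2*pi} (\<lambda>t. f (cis t))"
proof -
  have "integrable circle_measure f \<longleftrightarrow>
      integrable lborel (\<lambda>t. (1 / (2*pi)) *\<^sub>R (indicator {0..2*pi} t *\<^sub>R f (cis t)))"
    unfolding circle_measure_alt
    by (subst integrable_distr_eq; simp add: integrable_density)
  also have "\<dots> \<longleftrightarrow> set_integrable lborel {0..2*pi} (\<lambda>t. f (cis t))"
    unfolding set_integrable_def using integrable_scaleR_right[of "1/(2*pi)"] integrable_scaleR_right[of "2*pi" lborel "\<lambda>t. (1 / (2*pi)) *\<^sub>R (indicator {0..2*pi} t *\<^sub>R f (cis t))"] by fastforce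
  finally show ?thesis .
qed

lemma integral_circle_measure:
  fixes f :: "complex \<Rightarrow> 'a :: {banach, second_countable_topology}"
  assumes [measurable]: "f \<in> borel_measurable borel"
  shows "(LINT \<zeta>|circle_measure. f \<zeta>) = (1 / (2*pi)) *\<^sub>R (LINT t:{0..2*pi}|lborel. f (cis t))"
proof -
  have "(LINT \<zeta>|circle_measure. f \<zeta>) =
      (LINT t|lborel. (1 / (2*pi)) *\<^sub>R (indicator {0..2*pi} t *\<^sub>R f (cis t)))"
    unfolding circle_measure_alt
    by (subst integral_distr; simp add: integral_density)
  also have "\<dots> = (1 / (2*pi)) *\<^sub>R (LINT t:{0..2*pi}|lborel. f (cis t))"
    unfolding set_lebesgue_integral_def by (rule integral_scaleR_right)
  finally show ?thesis .
qed

text \<open>The set where \<open>P\<close> holds may fail to be Borel, so the pushforward rule is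
  applied to a Borel event instead: a Borel inverse of \<open>cis\<close> avoids a Borel null set
  that contains \<open>N\<close>.\<close>

lemma AE_circle_measureI:
  assumes "negligible N" and P: "\<And>t. 0 < t \<Longrightarrow> t < 2*pi \<Longrightarrow> t \<notin> N \<Longrightarrow> P (cis t)"
  shows "AE \<zeta> in circle_measure. P \<zeta>"
proof -
  have "negligible (N \<union> {0, 2*pi})"
    using assms(1) by auto
  then have "N \<union> {0, 2*pi} \<in> null_sets lebesgue"
    by (simp add: negligible_iff_null_sets)
  then obtain N' where N': "N' \<in> null_sets lborel" "N \<union> {0, 2*pi} \<subseteq> N'"
    using null_sets_completion_iff2 by (metis)
  then have [measurable]: "N' \<in> sets borel" by auto
  \<comment> \<open>A Borel branch of the argument on the cut plane. The default 0 on the cut is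
    caught by \<open>N'\<close>, which contains 0, so avoiding \<open>N'\<close> also means being
    off the cut.\<close>
  define \<theta> where "\<theta> = (\<lambda>z. if z \<in> - \<real>\<^sub>\<ge>\<^sub>0 then Arg2pi z else 0)"
  have [measurable]: "\<theta> \<in> borel_measurable borel"
    unfolding \<theta>_def
    by (rule borel_measurable_continuous_on_if)
       (auto intro!: continuous_at_imp_continuous_on continuous_at_Arg2pi simp: open_Compl)
  have \<theta>cis: "\<theta> (cis t) = t" if "0 < t" "t < 2*pi" for t
  proof -
    have A: "Arg2pi (cis t) = t"
      using that by (intro Arg2pi_unique[of 1]) (auto simp: cis_conv_exp)
    then have "cis t \<notin> \<real>\<^sub>\<ge>\<^sub>0"
      using that Arg2pi_eq_0[of "cis t"] by (metis less_irrefl complex_nonneg_Reals_iff complex_is_Real_iff)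
    with A show ?thesis by (simp add: \<theta>_def)
  qed
  have pr: "Measurable.pred borel (\<lambda>\<zeta>. \<theta> \<zeta> \<notin> N' \<and> cmod \<zeta> = 1)" by measurable
  have "AE \<zeta> in circle_measure. \<theta> \<zeta> \<notin> N' \<and> cmod \<zeta> = 1"
    unfolding circle_measure_alt
  proof (subst AE_distr_iff)
    show "AE t in density lborel (\<lambda>t. ennreal (indicator {0..2*pi} t / (2*pi))). \<theta> (cis t) \<notin> N' \<and> cmod (cis t) = 1"
    proof (subst AE_density)
      have "AE t in lborel. t \<notin> N'" using N' by (rule_tac AE_not_in) auto
      then show "AE t in lborel. 0 < ennreal (indicator {0..2*pi} t / (2*pi)) \<longrightarrow> \<theta> (cis t) \<notin> N' \<and> cmod (cis t) = 1"
      proof eventually_elim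
        case (elim t)
        then have "t \<noteq> 0" "t \<noteq> 2*pi" using N' by auto
        with elim \<theta>cis[of t] show ?case by (auto simp: indicator_def)
      qed
    qed simp
  qed (use pr in \<open>simp_all add: pred_def\<close>)
  then show ?thesis
  proof eventually_elim
    case (elim \<zeta>)
    then have "\<theta> \<zeta> \<noteq> 0" using N' by auto
    then have eq: "\<theta> \<zeta> = Arg2pi \<zeta>" by (auto simp: \<theta>_def split: if_splits)
    have "\<zeta> = cis (Arg2pi \<zeta>)"
      using elim Arg2pi_eq[of \<zeta>] by (simp add: cis_conv_exp)
    moreover have "0 < Arg2pi \<zeta>" "Arg2pi \<zeta> < 2*pi"
      using \<open>\<theta> \<zeta> \<noteq> 0\<close> eq Arg2pi_ge_0[of \<zeta>] Arg2pi_lt_2pi[of \<zeta>] by auto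
    moreover have "Arg2pi \<zeta> \<notin> N" using elim N' eq by auto
    ultimately show ?case using P by metis
  qed
qed

lemma AE_circle_measure_norm: "AE \<zeta> in circle_measure. cmod \<zeta> = 1"
  by (rule AE_circle_measureI[of "{}"]) auto

section \<open>Lebesgue points\<close>

lemma set_integrable_cmod_diff:
  fixes \<kappa> :: "real \<Rightarrow> complex"
  assumes int: "integrable lborel \<kappa>"
  shows "set_integrable lborel {a..b} (\<lambda>t. cmod (\<kappa> t - q))"
proof -
  have "set_integrable lborel {a..b} \<kappa>"
    unfolding set_integrable_def using int by (intro integrable_mult_indicator) auto
  moreover have "set_integrable lborel {a..b} (\<lambda>t. q)"
    unfolding set_integrable_def by (intro integrable_scaleR_left integrable_real_indicator) (auto simp: emeasure_lborel_Icc_eq)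
  ultimately have "set_integrable lborel {a..b} (\<lambda>t. \<kappa> t - q)"
    by (intro set_integral_diff)
  then show ?thesis
    unfolding set_integrable_def using integrable_norm by fastforce
qed

text \<open>For fixed q the averages of |\<kappa> - q| converge to |\<kappa>(\<theta>) - q| off a
  null set. Using only countably many dense q keeps the exceptional set null, and a q close to
  \<kappa>(\<theta>) then stands in for the moving centre.\<close>

lemma right_Lebesgue_points:
  fixes \<kappa> :: "real \<Rightarrow> complex"
  assumes int: "integrable lborel \<kappa>"
  obtains N where "negligible N"
    "\<And>\<theta> \<epsilon>. \<theta> \<notin> N \<Longrightarrow> 0 < \<epsilon> \<Longrightarrow>
       \<exists>d>0. \<forall>h. 0 < h \<and> h < d \<longrightarrow> (LINT t:{\<theta>..\<theta>+h}|lborel. cmod (\<kappa> t - \<kappa> \<theta>)) \<le> \<epsilon> * h"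
proof -
  obtain Q :: "complex set" where Q: "countable Q" "\<And>X. open X \<Longrightarrow> X \<noteq> {} \<Longrightarrow> \<exists>q\<in>Q. q \<in> X"
    by (rule countable_dense_setE) blast
  note sint = set_integrable_cmod_diff[OF int]
  have "\<exists>N. negligible N \<and> (\<forall>x e. x \<notin> N \<and> 0 < e \<longrightarrow>
      (\<exists>d>0. \<forall>h. 0 < h \<and> h < d \<longrightarrow>
        \<bar>integral {x..x+h} (\<lambda>t. cmod (\<kappa> t - q)) / h - cmod (\<kappa> x - q)\<bar> < e))" for q
  proof -
    have "(\<lambda>t. cmod (\<kappa> t - q)) integrable_on cbox a b" for a b
      using set_borel_integral_eq_integral(1)[OF sint] by simp
    then obtain N where "negligible N" "\<And>x e. \<lbrakk>x \<notin> N; 0 < e\<rbrakk> \<Longrightarrow>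
        \<exists>d>0. \<forall>h. 0 < h \<and> h < d \<longrightarrow>
          norm (integral (cbox x (x + h *\<^sub>R One)) (\<lambda>t. cmod (\<kappa> t - q)) /\<^sub>R h ^ DIM(real) - cmod (\<kappa> x - q)) < e"
      by (rule integrable_ccontinuous_explicit[where f="\<lambda>t. cmod (\<kappa> t - q)"]) blast
    then show ?thesis by (intro exI[of _ N]) (auto simp: divide_inverse_commute)
  qed
  then obtain N where N: "\<And>q. negligible (N q)" "\<And>q x e. x \<notin> N q \<Longrightarrow> 0 < e \<Longrightarrow>
      (\<exists>d>0. \<forall>h. 0 < h \<and> h < d \<longrightarrow>
        \<bar>integral {x..x+h} (\<lambda>t. cmod (\<kappa> t - q)) / h - cmod (\<kappa> x - q)\<bar> < e)"
    by metis
  show ?thesis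
  proof
    show "negligible (\<Union>q\<in>Q. N q)"
      using N(1) Q(1) negligible_countable_Union[of "N ` Q"] by auto
    fix \<theta> \<epsilon> :: real assume \<theta>: "\<theta> \<notin> (\<Union>q\<in>Q. N q)" and \<epsilon>: "0 < \<epsilon>"
    \<comment> \<open>Budget: the average of |\<kappa> - q| is at most \<epsilon>/4 + \<epsilon>/2,
      and passing from q to \<kappa>(\<theta>) costs another \<epsilon>/4.\<close>
    obtain q where q: "q \<in> Q" "q \<in> ball (\<kappa> \<theta>) (\<epsilon>/4)"
      using Q(2)[of "ball (\<kappa> \<theta>) (\<epsilon>/4)"] \<epsilon> by auto
    then have qd: "cmod (\<kappa> \<theta> - q) < \<epsilon>/4" by (simp add: dist_norm)
    obtain d where "d > 0" and d: "\<And>h. 0 < h \<Longrightarrow> h < d \<Longrightarrow>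
        \<bar>integral {\<theta>..\<theta>+h} (\<lambda>t. cmod (\<kappa> t - q)) / h - cmod (\<kappa> \<theta> - q)\<bar> < \<epsilon>/2"
      using N(2)[of \<theta> q "\<epsilon>/2"] \<theta> q(1) \<epsilon> by auto
    have "(LINT t:{\<theta>..\<theta>+h}|lborel. cmod (\<kappa> t - \<kappa> \<theta>)) \<le> \<epsilon> * h" if h: "0 < h" "h < d" for h
    proof -
      have ci: "set_integrable lborel {\<theta>..\<theta>+h} (\<lambda>t. \<epsilon>/4)"
        unfolding set_integrable_def by (intro integrable_scaleR_left integrable_real_indicator) (auto simp: emeasure_lborel_Icc_eq)
      have "(LINT t:{\<theta>..\<theta>+h}|lborel. cmod (\<kappa> t - \<kappa> \<theta>))
          \<le> (LINT t:{\<theta>..\<theta>+h}|lborel. cmod (\<kappa> t - q) + \<epsilon>/4)"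
      proof (rule set_integral_mono)
        fix t
        have "cmod (\<kappa> t - \<kappa> \<theta>) \<le> cmod (\<kappa> t - q) + cmod (\<kappa> \<theta> - q)"
          using norm_triangle_ineq4[of "\<kappa> t - q" "\<kappa> \<theta> - q"] by simp
        then show "cmod (\<kappa> t - \<kappa> \<theta>) \<le> cmod (\<kappa> t - q) + \<epsilon>/4" using qd by simp
      qed (intro sint set_integral_add ci)+
      also have "\<dots> = (LINT t:{\<theta>..\<theta>+h}|lborel. cmod (\<kappa> t - q)) + (LINT t:{\<theta>..\<theta>+h}|lborel. \<epsilon>/4)"
        by (rule set_integral_add(2)[OF sint ci])
      also have "(LINT t:{\<theta>..\<theta>+h}|lborel. cmod (\<kappa> t - q)) = integral {\<theta>..\<theta>+h} (\<lambda>t. cmod (\<kappa> t - q))"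
        by (rule set_borel_integral_eq_integral(2)[OF sint])
      also have "(LINT t:{\<theta>..\<theta>+h}|lborel. \<epsilon>/4) = \<epsilon>/4 * h"
        unfolding set_lebesgue_integral_def using h
        by (subst integral_scaleR_left) (simp_all add: integrable_real_indicator emeasure_lborel_Icc_eq)
      also have "integral {\<theta>..\<theta>+h} (\<lambda>t. cmod (\<kappa> t - q)) \<le> (3/4*\<epsilon>) * h"
      proof -
        have "integral {\<theta>..\<theta>+h} (\<lambda>t. cmod (\<kappa> t - q)) / h \<le> 3/4*\<epsilon>"
          using d[OF h] qd unfolding abs_less_iff by linarith
        then show ?thesis using h by (simp add: divide_le_eq)
      qed
      finally show ?thesis by (simp add: field_simps)
    qed
    with \<open>d > 0\<close> show "\<exists>d>0. \<forall>h. 0 < h \<and> h < d \<longrightarrow>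
        (LINT t:{\<theta>..\<theta>+h}|lborel. cmod (\<kappa> t - \<kappa> \<theta>)) \<le> \<epsilon> * h" by blast
  qed
qed

text \<open>The left half-interval is the right one for the reflected function, and reflection keeps
  the exceptional set negligible.\<close>

lemma two_sided_Lebesgue_points:
  fixes \<kappa> :: "real \<Rightarrow> complex"
  assumes int: "integrable lborel \<kappa>"
  obtains N where "negligible N"
    "\<And>\<theta> \<epsilon>. \<theta> \<notin> N \<Longrightarrow> 0 < \<epsilon> \<Longrightarrow>
       \<exists>d>0. \<forall>h. 0 < h \<and> h < d \<longrightarrow> (LINT t:{\<theta>-h..\<theta>+h}|lborel. cmod (\<kappa> t - \<kappa> \<theta>)) \<le> \<epsilon> * h"
proof -
  obtain N where N: "negligible N"
    "\<And>\<theta> \<epsilon>. \<theta> \<notin> N \<Longrightarrow> 0 < \<epsilon> \<Longrightarrow>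
       \<exists>d>0. \<forall>h. 0 < h \<and> h < d \<longrightarrow> (LINT t:{\<theta>..\<theta>+h}|lborel. cmod (\<kappa> t - \<kappa> \<theta>)) \<le> \<epsilon> * h"
    using right_Lebesgue_points[OF int] by blast
  have "integrable lborel (\<lambda>t. \<kappa> (- t))"
    using lborel_integrable_real_affine[OF int, of "-1" 0] by simp
  then obtain N' where N': "negligible N'"
    "\<And>\<theta> \<epsilon>. \<theta> \<notin> N' \<Longrightarrow> 0 < \<epsilon> \<Longrightarrow>
       \<exists>d>0. \<forall>h. 0 < h \<and> h < d \<longrightarrow> (LINT t:{\<theta>..\<theta>+h}|lborel. cmod (\<kappa> (- t) - \<kappa> (- \<theta>))) \<le> \<epsilon> * h"
    using right_Lebesgue_points by blast
  show ?thesis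
  proof
    show "negligible (N \<union> uminus ` N')"
      using N(1) N'(1) by (auto intro!: negligible_differentiable_image_negligible derivative_intros)
    fix \<theta> \<epsilon> :: real assume \<theta>: "\<theta> \<notin> N \<union> uminus ` N'" and \<epsilon>: "0 < \<epsilon>"
    then have "\<theta> \<notin> N" "- \<theta> \<notin> N'" by (auto simp: image_iff)
    then obtain d d' where d: "d > 0" "\<And>h. 0 < h \<Longrightarrow> h < d \<Longrightarrow> (LINT t:{\<theta>..\<theta>+h}|lborel. cmod (\<kappa> t - \<kappa> \<theta>)) \<le> \<epsilon>/2 * h"
      and d': "d' > 0" "\<And>h. 0 < h \<Longrightarrow> h < d' \<Longrightarrow> (LINT t:{-\<theta>..-\<theta>+h}|lborel. cmod (\<kappa> (-t) - \<kappa> \<theta>)) \<le> \<epsilon>/2 * h"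
      using N(2)[of \<theta> "\<epsilon>/2"] N'(2)[of "-\<theta>" "\<epsilon>/2"] \<epsilon> by auto
    have "(LINT t:{\<theta>-h..\<theta>+h}|lborel. cmod (\<kappa> t - \<kappa> \<theta>)) \<le> \<epsilon> * h" if h: "0 < h" "h < min d d'" for h
    proof -
      let ?w = "\<lambda>t. cmod (\<kappa> t - \<kappa> \<theta>)"
      note wint = set_integrable_cmod_diff[OF int]
      have refl: "(LINT t:{\<theta>-h..\<theta>}|lborel. ?w t) = (LINT t:{-\<theta>..-\<theta>+h}|lborel. ?w (- t))"
      proof -
        have "{x. - x \<in> {\<theta>-h..\<theta>}} = {-\<theta>..-\<theta>+h}" by auto
        then show ?thesis by (subst set_integral_reflect) (simp only:)
      qed
      have "(LINT t:{\<theta>-h..\<theta>+h}|lborel. ?w t) \<le> (LINT t:{\<theta>-h..\<theta>}|lborel. ?w t) + (LINT t:{\<theta>..\<theta>+h}|lborel. ?w t)"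
        unfolding set_lebesgue_integral_def
        apply (subst Bochner_Integration.integral_add[symmetric])
        subgoal using wint by (simp add: set_integrable_def)
        subgoal using wint by (simp add: set_integrable_def)
        apply (rule integral_mono)
        subgoal using wint by (simp add: set_integrable_def)
        subgoal using wint by (intro Bochner_Integration.integrable_add) (simp_all add: set_integrable_def)
        by (auto simp: indicator_def)
      also have "\<dots> \<le> \<epsilon>/2*h + \<epsilon>/2*h"
        using d(2)[of h] d'(2)[of h] h unfolding refl by (intro add_mono) auto
      finally show ?thesis by simp
    qed
    then show "\<exists>d>0. \<forall>h. 0 < h \<and> h < d \<longrightarrow>
        (LINT t:{\<theta>-h..\<theta>+h}|lborel. cmod (\<kappa> t - \<kappa> \<theta>)) \<le> \<epsilon> * h" 
      using d(1) d'(1) by (intro exI[of _ "min d d'"]) auto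
  qed
qed

text \<open>The chord quotient, completed by its limit 1 at \<theta>, is continuous and zero-free on
  the compact interval, hence has a positive minimum. The endpoints are excluded for \<theta>
  because \<open>cis 0 = cis (2*pi)\<close> would produce a zero.\<close>

lemma cis_chord_lower_bound:
  assumes \<theta>: "0 < \<theta>" "\<theta> < 2*pi"
  obtains c where "c > 0" "\<And>t. 0 \<le> t \<Longrightarrow> t \<le> 2*pi \<Longrightarrow> c * \<bar>t - \<theta>\<bar> \<le> cmod (cis t - cis \<theta>)"
proof -
  define q where "q t = (if t = \<theta> then 1 else cmod ((cis t - cis \<theta>) /\<^sub>R (t - \<theta>)))" for t
  have "((\<lambda>t. cmod (cis t - cis \<theta> - (t - \<theta>) *\<^sub>R (\<i> * cis \<theta>)) / \<bar>t - \<theta>\<bar>) \<longlongrightarrow> 0) (at \<theta>)"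
    using has_derivative_cis[OF has_derivative_ident, of \<theta> UNIV] unfolding has_derivative_iff_norm real_norm_def by blast
  then have "((\<lambda>t. cmod ((cis t - cis \<theta>) /\<^sub>R (t - \<theta>) - \<i> * cis \<theta>)) \<longlongrightarrow> 0) (at \<theta>)"
  proof (rule Lim_transform_eventually)
    show "\<forall>\<^sub>F t in at \<theta>. cmod (cis t - cis \<theta> - (t - \<theta>) *\<^sub>R (\<i> * cis \<theta>)) / \<bar>t - \<theta>\<bar> =
        cmod ((cis t - cis \<theta>) /\<^sub>R (t - \<theta>) - \<i> * cis \<theta>)"
    proof (rule eventually_at_topological[THEN iffD2, OF exI[of _ UNIV]], intro conjI ballI impI open_UNIV UNIV_I)
      fix t assume "t \<noteq> \<theta>"
      then have eq: "cis t - cis \<theta> - (t - \<theta>) *\<^sub>R (\<i> * cis \<theta>) =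
          (t - \<theta>) *\<^sub>R ((cis t - cis \<theta>) /\<^sub>R (t - \<theta>) - \<i> * cis \<theta>)"
        by (simp add: scaleR_diff_right)
      show "cmod (cis t - cis \<theta> - (t - \<theta>) *\<^sub>R (\<i> * cis \<theta>)) / \<bar>t - \<theta>\<bar> =
          cmod ((cis t - cis \<theta>) /\<^sub>R (t - \<theta>) - \<i> * cis \<theta>)"
        unfolding eq norm_scaleR using \<open>t \<noteq> \<theta>\<close> by (intro nonzero_mult_div_cancel_left) simp
    qed
  qed
  then have "((\<lambda>t. (cis t - cis \<theta>) /\<^sub>R (t - \<theta>)) \<longlongrightarrow> \<i> * cis \<theta>) (at \<theta>)"
    unfolding tendsto_norm_zero_iff by (rule LIM_zero_cancel)
  then have "((\<lambda>t. cmod ((cis t - cis \<theta>) /\<^sub>R (t - \<theta>))) \<longlongrightarrow> cmod (\<i> * cis \<theta>)) (at \<theta>)"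
    by (rule tendsto_norm)
  moreover have "cmod (\<i> * cis \<theta>) = q \<theta>"
    by (simp add: q_def norm_mult)
  ultimately have "((\<lambda>t. cmod ((cis t - cis \<theta>) /\<^sub>R (t - \<theta>))) \<longlongrightarrow> q \<theta>) (at \<theta>)"
    by (simp only:)
  then have lim: "(q \<longlongrightarrow> q \<theta>) (at \<theta>)"
    by (rule Lim_transform_eventually)
       (simp add: q_def eventually_at_filter)
  have "isCont q t" for t
  proof (cases "t = \<theta>")
    case True with lim show ?thesis by (simp add: isCont_def)
  next
    case False
    have "isCont (\<lambda>t. cmod ((cis t - cis \<theta>) /\<^sub>R (t - \<theta>))) t"
    proof -
      have "isCont cis t"
        using continuous_on_cis[OF continuous_on_id, of UNIV] by (simp add: continuous_on_eq_continuous_at)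
      with False show ?thesis by (intro continuous_intros) auto
    qed
    then show ?thesis
      by (rule continuous_transform_within[where \<delta>="\<bar>t-\<theta>\<bar>"]) (use False in \<open>auto simp: q_def dist_real_def\<close>)
  qed
  then have cont: "continuous_on {0..2*pi} q"
    by (simp add: continuous_at_imp_continuous_on)
  obtain t0 where t0: "t0 \<in> {0..2*pi}" "\<And>t. t \<in> {0..2*pi} \<Longrightarrow> q t0 \<le> q t"
    using continuous_attains_inf[OF _ _ cont] by auto
  have "q t0 > 0"
  proof (cases "t0 = \<theta>")
    case True then show ?thesis by (simp add: q_def)
  next
    case False
    have "cis t0 \<noteq> cis \<theta>"
    proof
      assume "cis t0 = cis \<theta>"
      then have "exp (\<i> * of_real t0) = exp (\<i> * of_real \<theta>)" by (simp add: cis_conv_exp)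
      then obtain n :: int where n: "\<i> * of_real t0 = \<i> * of_real \<theta> + (of_int (2*n) * pi) * \<i>"
        using exp_eq by metis
      then have "\<i> * of_real t0 = \<i> * of_real (\<theta> + of_int (2*n) * pi)" by (simp add: algebra_simps)
      then have "t0 = \<theta> + of_int (2*n) * pi"
        using of_real_eq_iff by fastforce
      then have eq: "t0 - \<theta> = of_int n * (2*pi)" by simp
      then have "n \<noteq> 0" using False by auto
      then have "\<bar>of_int n :: real\<bar> \<ge> 1" by linarith
      then have "\<bar>t0 - \<theta>\<bar> \<ge> 2*pi" unfolding eq abs_mult by simp
      then show False using \<theta> t0(1) by auto
    qed
    then show ?thesis using False by (simp add: q_def)
  qed
  show ?thesis
  proof
    show "q t0 > 0" by fact
    fix t assume t: "0 \<le> t" "t \<le> 2*pi"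
    show "q t0 * \<bar>t - \<theta>\<bar> \<le> cmod (cis t - cis \<theta>)"
    proof (cases "t = \<theta>")
      case False
      have "q t0 * \<bar>t - \<theta>\<bar> \<le> q t * \<bar>t - \<theta>\<bar>"
        using t0(2)[of t] t by (intro mult_right_mono) auto
      also have "q t = inverse \<bar>t - \<theta>\<bar> * cmod (cis t - cis \<theta>)" using False by (simp add: q_def)
      also have "\<dots> * \<bar>t - \<theta>\<bar> = cmod (cis t - cis \<theta>)" using False by simp
      finally show ?thesis .
    qed simp
  qed
qed

text \<open>Averages are taken over Euclidean discs to match the later kernel estimate. The chord
  bound places the part of the circle inside a disc of radius h about \<open>cis \<theta>\<close> in
  the parameter interval of radius h / c.\<close>

lemma AE_Lebesgue_point_circle:
  fixes k :: "complex \<Rightarrow> complex"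
  assumes int: "integrable circle_measure k"
  shows "AE \<zeta> in circle_measure. cmod \<zeta> = 1 \<and> (\<forall>\<epsilon>>0. \<exists>\<eta>>0. \<forall>h. 0 < h \<and> h < \<eta> \<longrightarrow>
           (LINT \<xi>|circle_measure. indicator (cball \<zeta> h) \<xi> * cmod (k \<xi> - k \<zeta>)) \<le> \<epsilon> * h)"
proof -
  have [measurable]: "k \<in> borel_measurable borel"
    using borel_measurable_integrable[OF int] by simp
  \<comment> \<open>The cut-off makes the parametrized function integrable on the whole line; a
    window that overshoots \<open>{0..2*pi}\<close> only enlarges the upper bound.\<close>
  define \<kappa> where "\<kappa> t = indicator {0..2*pi} t *\<^sub>R k (cis t)" for t
  have \<kappa>: "integrable lborel \<kappa>"
    using int unfolding integrable_circle_measure_iff[OF \<open>k \<in> borel_measurable borel\<close>]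
      set_integrable_def \<kappa>_def .
  obtain N where N: "negligible N"
    "\<And>\<theta> \<epsilon>. \<theta> \<notin> N \<Longrightarrow> 0 < \<epsilon> \<Longrightarrow>
       \<exists>d>0. \<forall>h. 0 < h \<and> h < d \<longrightarrow> (LINT t:{\<theta>-h..\<theta>+h}|lborel. cmod (\<kappa> t - \<kappa> \<theta>)) \<le> \<epsilon> * h"
    using two_sided_Lebesgue_points[OF \<kappa>] by blast
  show ?thesis
  proof (rule AE_circle_measureI[OF N(1)], intro conjI allI impI)
    fix \<theta> \<epsilon> :: real assume \<theta>: "0 < \<theta>" "\<theta> < 2*pi" "\<theta> \<notin> N" and \<epsilon>: "0 < \<epsilon>"
    obtain c where c: "c > 0" "\<And>t. 0 \<le> t \<Longrightarrow> t \<le> 2*pi \<Longrightarrow> c * \<bar>t - \<theta>\<bar> \<le> cmod (cis t - cis \<theta>)"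
      using cis_chord_lower_bound[OF \<theta>(1,2)] by blast
    obtain d where d: "d > 0" "\<And>h. 0 < h \<Longrightarrow> h < d \<Longrightarrow>
        (LINT t:{\<theta>-h..\<theta>+h}|lborel. cmod (\<kappa> t - \<kappa> \<theta>)) \<le> (\<epsilon>*c) * h"
      using N(2)[OF \<theta>(3), of "\<epsilon>*c"] \<epsilon> c by auto
    have "(LINT \<xi>|circle_measure. indicator (cball (cis \<theta>) h) \<xi> * cmod (k \<xi> - k (cis \<theta>))) \<le> \<epsilon> * h"
      if h: "0 < h" "h < c*d" for h
    proof -
      note i1 = set_integrable_cmod_diff[OF \<kappa>, unfolded set_integrable_def]
      have "cball (cis \<theta>) h \<in> sets borel" by (intro borel_closed closed_cball)
      then have meas: "(\<lambda>\<xi>. indicator (cball (cis \<theta>) h) \<xi> * cmod (k \<xi> - k (cis \<theta>))) \<in> borel_measurable borel"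
        by measurable
      have nn: "0 \<le> (LINT t:{0..2*pi}|lborel. indicator (cball (cis \<theta>) h) (cis t) * cmod (k (cis t) - k (cis \<theta>)))"
        unfolding set_lebesgue_integral_def by (intro Bochner_Integration.integral_nonneg) (auto simp: indicator_def)
      have "(LINT \<xi>|circle_measure. indicator (cball (cis \<theta>) h) \<xi> * cmod (k \<xi> - k (cis \<theta>)))
          = (1 / (2*pi)) * (LINT t:{0..2*pi}|lborel. indicator (cball (cis \<theta>) h) (cis t) * cmod (k (cis t) - k (cis \<theta>)))"
        using meas by (subst integral_circle_measure) simp_all
      also have "\<dots> \<le> 1 * (LINT t:{0..2*pi}|lborel. indicator (cball (cis \<theta>) h) (cis t) * cmod (k (cis t) - k (cis \<theta>)))"
        using nn pi_ge_two by (intro mult_right_mono) auto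
      also have "\<dots> \<le> (LINT t:{\<theta>-h/c..\<theta>+h/c}|lborel. cmod (\<kappa> t - \<kappa> \<theta>))"
        unfolding set_lebesgue_integral_def mult_1
      proof (rule integral_mono_AE')
        show "integrable lborel (\<lambda>t. indicator {\<theta>-h/c..\<theta>+h/c} t *\<^sub>R cmod (\<kappa> t - \<kappa> \<theta>))" by (rule i1)
        show "AE t in lborel. indicator {0..2*pi} t *\<^sub>R (indicator (cball (cis \<theta>) h) (cis t) * cmod (k (cis t) - k (cis \<theta>)))
            \<le> indicator {\<theta>-h/c..\<theta>+h/c} t *\<^sub>R cmod (\<kappa> t - \<kappa> \<theta>)"
        proof (intro AE_I2)
          fix t
          show "indicator {0..2*pi} t *\<^sub>R (indicator (cball (cis \<theta>) h) (cis t) * cmod (k (cis t) - k (cis \<theta>)))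
            \<le> indicator {\<theta>-h/c..\<theta>+h/c} t *\<^sub>R cmod (\<kappa> t - \<kappa> \<theta>)"
          proof (cases "t \<in> {0..2*pi} \<and> cis t \<in> cball (cis \<theta>) h")
            case True
            then have "c * \<bar>t - \<theta>\<bar> \<le> h" using c(2)[of t] by (auto simp: dist_norm norm_minus_commute)
            then have "\<bar>t - \<theta>\<bar> \<le> h / c" using c(1) by (simp add: field_simps)
            then have "t \<in> {\<theta>-h/c..\<theta>+h/c}" by (auto simp: abs_le_iff)
            with True \<theta> show ?thesis by (simp add: \<kappa>_def)
          qed (auto simp: indicator_def)
        qed
        show "AE t in lborel. 0 \<le> indicator {\<theta>-h/c..\<theta>+h/c} t *\<^sub>R cmod (\<kappa> t - \<kappa> \<theta>)" by simp
      qed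
      also have "\<dots> \<le> (\<epsilon>*c) * (h/c)"
        using d(2)[of "h/c"] h c(1) by (simp add: field_simps)
      finally show ?thesis using c(1) by simp
    qed
    then show "\<exists>\<eta>>0. \<forall>h. 0 < h \<and> h < \<eta> \<longrightarrow>
        (LINT \<xi>|circle_measure. indicator (cball (cis \<theta>) h) \<xi> * cmod (k \<xi> - k (cis \<theta>))) \<le> \<epsilon> * h"
      using c(1) d(1) by (intro exI[of _ "c*d"]) auto
  qed auto
qed

section \<open>Non-tangential limits of Poisson integrals\<close>

definition poisson_kernel :: "complex \<Rightarrow> complex \<Rightarrow> real" where
  "poisson_kernel z \<xi> = (1 - (cmod z)\<^sup>2) / (cmod (\<xi> - z))\<^sup>2"

lemma measurable_poisson_kernel [measurable]: "poisson_kernel z \<in> borel_measurable borel"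
  unfolding poisson_kernel_def by measurable

lemma poisson_kernel_nonneg: "cmod z < 1 \<Longrightarrow> 0 \<le> poisson_kernel z \<xi>"
  unfolding poisson_kernel_def by (simp add: power_le_one)

lemma poisson_kernel_le:
  assumes "cmod z < 1"
  shows "poisson_kernel z \<xi> \<le> 2 * (1 - cmod z) / (cmod (\<xi> - z))\<^sup>2"
proof -
  have "1 - (cmod z)\<^sup>2 = (1 + cmod z) * (1 - cmod z)" by (simp add: power2_eq_square algebra_simps)
  also have "\<dots> \<le> 2 * (1 - cmod z)" using assms by (intro mult_right_mono) auto
  finally show ?thesis unfolding poisson_kernel_def by (intro divide_right_mono) auto
qed

lemma norm_diff_circle_ge: "cmod \<xi> = 1 \<Longrightarrow> 1 - cmod z \<le> cmod (\<xi> - z)"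
  by (metis norm_triangle_ineq2)

lemma poisson_kernel_bound:
  assumes "cmod z < 1" "cmod \<xi> = 1"
  shows "poisson_kernel z \<xi> \<le> 2 / (1 - cmod z)"
proof -
  have "poisson_kernel z \<xi> \<le> 2 * (1 - cmod z) / (cmod (\<xi> - z))\<^sup>2"
    by (rule poisson_kernel_le) fact
  also have "\<dots> \<le> 2 * (1 - cmod z) / (1 - cmod z)\<^sup>2"
    using assms norm_diff_circle_ge[OF assms(2), of z] 
    by (intro divide_left_mono power_mono mult_pos_pos) auto
  also have "\<dots> = 2 / (1 - cmod z)" using assms by (simp add: divide_simps power2_eq_square)
  finally show ?thesis .
qed

text \<open>With cnj \<xi> = 1 / \<xi> on the circle the kernel splits into a Cauchy kernel and a
  term holomorphic in \<xi> near the closed disk. The outer factor \<xi> is the one in d\<xi> = i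
  \<xi> dt.\<close>

lemma poisson_kernel_eq:
  assumes "cmod z < 1" "cmod \<xi> = 1"
  shows "of_real (poisson_kernel z \<xi>) = \<xi> * (1 / (\<xi> - z) + cnj z / (1 - cnj z * \<xi>))"
proof -
  have 1: "\<xi> * cnj \<xi> = 1" using assms(2) by (simp add: complex_norm_square[symmetric])
  have ne: "\<xi> - z \<noteq> 0" using assms by auto
  then have ne': "cnj \<xi> - cnj z \<noteq> 0" by (metis complex_cnj_cancel_iff complex_cnj_diff right_minus_eq)
  have e: "1 - cnj z * \<xi> = \<xi> * (cnj \<xi> - cnj z)" using 1 by (simp add: algebra_simps)
  have ne2: "1 - cnj z * \<xi> \<noteq> 0" using ne' assms(2) unfolding e by auto
  have "\<xi> \<noteq> 0" using assms by auto
  have "of_real (poisson_kernel z \<xi>) = (1 - z * cnj z) / ((\<xi> - z) * (cnj \<xi> - cnj z))"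
    unfolding poisson_kernel_def of_real_divide of_real_diff complex_norm_square by simp
  also have "1 - z * cnj z = \<xi> * (cnj \<xi> - cnj z) + cnj z * (\<xi> - z)" using 1 by (simp add: algebra_simps)
  also have "\<dots> / ((\<xi> - z) * (cnj \<xi> - cnj z)) = \<xi> / (\<xi> - z) + cnj z / (cnj \<xi> - cnj z)"
    using ne ne' by (simp add: field_simps)
  also have "\<dots> = \<xi> * (1 / (\<xi> - z) + cnj z / (1 - cnj z * \<xi>))"
    unfolding e using \<open>\<xi> \<noteq> 0\<close> by (simp add: distrib_left)
  finally show ?thesis .
qed

text \<open>Cauchy's formula evaluates the first summand of the kernel and Cauchy's theorem removes
  the second. In the applications \<open>h\<close> is a constant or a polynomial.\<close>

lemma poisson_integral_entire:
  assumes holo: "h holomorphic_on UNIV" and z: "cmod z < 1"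
  shows "(LINT \<xi>|circle_measure. of_real (poisson_kernel z \<xi>) * h \<xi>) = h z"
proof -
  define H where "H = (\<lambda>u. h u / (u - z) + h u * cnj z / (1 - cnj z * u))"
  have I1: "((\<lambda>u. h u / (u - z)) has_contour_integral (2 * of_real pi * \<i> * h z)) (circlepath 0 1)"
    by (rule Cauchy_integral_circlepath_simple) (use z holo holomorphic_on_subset in auto)
  have I2: "((\<lambda>u. h u * cnj z / (1 - cnj z * u)) has_contour_integral 0) (circlepath 0 1)"
  \<comment> \<open>The pole has modulus 1 / |z|; the radius 2 / (1 + |z|) lies strictly between 1
    and it, and remains meaningful for z = 0.\<close>
  proof (rule Cauchy_theorem_disc_simple[where a=0 and e="2 / (1 + cmod z)"])
    have "1 - cnj z * u \<noteq> 0" if "cmod u < 2 / (1 + cmod z)" for u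
    proof
      assume "1 - cnj z * u = 0"
      then have "cmod (cnj z * u) = 1" by (metis eq_iff_diff_eq_0 norm_one)
      moreover have "cmod z * cmod u \<le> cmod z * (2 / (1 + cmod z))"
        using that by (intro mult_left_mono) auto
      moreover have "cmod z * (2 / (1 + cmod z)) < 1"
        using z by (simp add: divide_less_eq add_pos_nonneg)
      ultimately show False by (simp add: norm_mult)
    qed
    then show "(\<lambda>u. h u * cnj z / (1 - cnj z * u)) holomorphic_on ball 0 (2 / (1 + cmod z))"
      using holo holomorphic_on_subset by (intro holomorphic_intros) auto
    have "1 < 2 / (1 + cmod z)" using z by (simp add: less_divide_eq add_pos_nonneg)
    then show "path_image (circlepath 0 1) \<subseteq> ball 0 (2 / (1 + cmod z))"
      by auto
  qed auto
  have "(H has_contour_integral (2 * of_real pi * \<i> * h z)) (circlepath 0 1)"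
    using has_contour_integral_add[OF I1 I2] unfolding H_def by simp
  then have hi: "((\<lambda>t. H (cis t) * \<i> * cis t) has_integral (2 * of_real pi * \<i> * h z)) {0..2*pi}"
    by (simp add: circlepath_def has_contour_integral_part_circlepath_iff)
  have eq: "H (cis t) * \<i> * cis t = \<i> * (of_real (poisson_kernel z (cis t)) * h (cis t))" for t
    unfolding H_def poisson_kernel_eq[OF z norm_cis] by (simp add: algebra_simps)
  have conth: "continuous_on A h" for A using holo holomorphic_on_imp_continuous_on holomorphic_on_subset by blast
  have [measurable]: "h \<in> borel_measurable borel"
    by (intro borel_measurable_continuous_onI conth)
  have "continuous_on {0..2*pi} (\<lambda>t. of_real (poisson_kernel z (cis t)) * h (cis t))"
    unfolding poisson_kernel_def
    by (intro continuous_intros continuous_on_compose2[OF conth[of UNIV]]) (use z in auto)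
  then have si: "set_integrable lborel {0..2*pi} (\<lambda>t. of_real (poisson_kernel z (cis t)) * h (cis t))"
    by (rule borel_integrable_atLeastAtMost')
  have "\<i> * (LINT t:{0..2*pi}|lborel. of_real (poisson_kernel z (cis t)) * h (cis t))
      = \<i> * integral {0..2*pi} (\<lambda>t. of_real (poisson_kernel z (cis t)) * h (cis t))"
    by (simp add: set_borel_integral_eq_integral(2)[OF si])
  also have "\<dots> = integral {0..2*pi} (\<lambda>t. \<i> * (of_real (poisson_kernel z (cis t)) * h (cis t)))"
    by simp
  also have "\<dots> = 2 * of_real pi * \<i> * h z"
    using hi unfolding eq by (rule integral_unique)
  finally have "(LINT t:{0..2*pi}|lborel. of_real (poisson_kernel z (cis t)) * h (cis t)) = 2 * of_real pi * h z"
    by simp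
  then show ?thesis
    by (subst integral_circle_measure) (auto simp: scaleR_conv_of_real)
qed

lemma integrable_bounded_mult_circle:
  fixes k :: "complex \<Rightarrow> 'a :: {real_normed_algebra, banach, second_countable_topology}"
  assumes "integrable circle_measure k" and [measurable]: "g \<in> borel_measurable borel"
    and "\<And>\<xi>. cmod \<xi> = 1 \<Longrightarrow> norm (g \<xi>) \<le> B"
  shows "integrable circle_measure (\<lambda>\<xi>. g \<xi> * k \<xi>)"
proof (rule Bochner_Integration.integrable_bound)
  show "integrable circle_measure (\<lambda>\<xi>. B * norm (k \<xi>))"
    using assms(1) by simp
  have [measurable]: "k \<in> borel_measurable borel"
    using borel_measurable_integrable[OF assms(1)] by simp
  show "(\<lambda>\<xi>. g \<xi> * k \<xi>) \<in> borel_measurable circle_measure" by measurable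
  show "AE \<xi> in circle_measure. norm (g \<xi> * k \<xi>) \<le> norm (B * norm (k \<xi>))"
    using AE_circle_measure_norm
  proof eventually_elim
    case (elim \<xi>)
    have "norm (g \<xi> * k \<xi>) \<le> norm (g \<xi>) * norm (k \<xi>)" by (rule norm_mult_ineq)
    also have "\<dots> \<le> B * norm (k \<xi>)" using assms(3)[OF elim] by (rule mult_right_mono) simp
    finally show ?case by simp
  qed
qed

lemma integrable_poisson_kernel_mult:
  fixes k :: "complex \<Rightarrow> complex"
  assumes "integrable circle_measure k" "cmod z < 1"
  shows "integrable circle_measure (\<lambda>\<xi>. of_real (poisson_kernel z \<xi>) * k \<xi>)"
  by (rule integrable_bounded_mult_circle[OF assms(1), where B="2 / (1 - cmod z)"])
     (use poisson_kernel_bound[OF assms(2)] poisson_kernel_nonneg[OF assms(2)] in auto)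

text \<open>A sum of multiples of indicators of concentric discs dominates the kernel, so that only
  averages over discs centred at \<open>\<zeta>\<close> enter the estimate of a Poisson integral.\<close>

lemma poisson_kernel_dyadic_bound:
  assumes z: "cmod z < 1" and st: "cmod (z - \<zeta>) < M * (1 - cmod z)"
    and J: "\<eta> \<le> 2 ^ Suc J * (1 - cmod z)" and \<eta>: "0 < \<eta>" and \<xi>: "cmod \<xi> = 1" and M: "M > 1"
  defines "\<delta> \<equiv> 1 - cmod z" and "C \<equiv> 8 * (1 + M)\<^sup>2"
  shows "poisson_kernel z \<xi> \<le> (\<Sum>j\<le>J. C / (4 ^ j * \<delta>) * indicator (cball \<zeta> (2 ^ j * \<delta>)) \<xi>) + C * \<delta> / \<eta>\<^sup>2"
proof -
  have \<delta>: "\<delta> > 0" using z by (simp add: \<delta>_def)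
  have C: "C \<ge> 8" unfolding C_def using M one_le_power[of "1 + M" 2] by simp
  have pk1: "poisson_kernel z \<xi> \<le> 2 / \<delta>" unfolding \<delta>_def by (rule poisson_kernel_bound) fact+
  \<comment> \<open>On the Stolz region |z - \<zeta>| < M \<delta> and \<delta> \<le> |\<xi> - z|,
    so |\<xi> - \<zeta>| \<le> (1 + M) |\<xi> - z|. The 8 in \<open>C\<close> is a 2 from the kernel
    and a 4 from doubling s, which turns the previous dyadic radius into the current one.\<close>
  have pk2: "poisson_kernel z \<xi> \<le> C * \<delta> / (2 * s)\<^sup>2" if s: "0 < s" "s \<le> cmod (\<xi> - \<zeta>)" for s
  proof -
    have "cmod (\<xi> - \<zeta>) \<le> cmod (\<xi> - z) + cmod (z - \<zeta>)" using norm_triangle_ineq[of "\<xi> - z" "z - \<zeta>"] by simp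
    also have "\<dots> \<le> cmod (\<xi> - z) + M * (1 - cmod z)" using st by simp
    also have "M * (1 - cmod z) \<le> M * cmod (\<xi> - z)"
      using norm_diff_circle_ge[OF \<xi>] M by (intro mult_left_mono) auto
    finally have *: "s \<le> (1 + M) * cmod (\<xi> - z)" using s by (simp add: algebra_simps)
    then have "s\<^sup>2 \<le> ((1 + M) * cmod (\<xi> - z))\<^sup>2" using s by (intro power_mono) auto
    moreover have "cmod (\<xi> - z) > 0" using z \<xi> by auto
    ultimately have "2 * \<delta> / (cmod (\<xi> - z))\<^sup>2 \<le> C * \<delta> / (2 * s)\<^sup>2"
      unfolding C_def using s \<delta> by (simp add: divide_le_eq le_divide_eq power_mult_distrib mult_ac)
    with poisson_kernel_le[OF z, of \<xi>] show ?thesis unfolding \<delta>_def by linarith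
  qed
  have nn: "0 \<le> C / (4 ^ j * \<delta>) * indicator (cball \<zeta> (2 ^ j * \<delta>)) \<xi>" for j
    using C \<delta> by simp
  show ?thesis
  proof (cases "cmod (\<xi> - \<zeta>) \<le> 2 ^ J * \<delta>")
    \<comment> \<open>Outside the last disc the choice of \<open>J\<close> gives distance at least
      \<eta> / 2 from \<zeta>; this is the origin of the remainder term.\<close>
    case False
    have "poisson_kernel z \<xi> \<le> C * \<delta> / (2*(\<eta>/2))\<^sup>2"
      using False J \<eta> by (intro pk2) (auto simp: \<delta>_def)
    moreover have "0 \<le> (\<Sum>j\<le>J. C / (4 ^ j * \<delta>) * indicator (cball \<zeta> (2 ^ j * \<delta>)) \<xi>)"
      by (intro sum_nonneg nn)
    ultimately show ?thesis by simp
  next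
    case True
    define j where "j = (LEAST j. cmod (\<xi> - \<zeta>) \<le> 2 ^ j * \<delta>)"
    have j: "cmod (\<xi> - \<zeta>) \<le> 2 ^ j * \<delta>" unfolding j_def by (rule LeastI) fact
    have jJ: "j \<le> J" unfolding j_def by (rule Least_le) fact
    have "poisson_kernel z \<xi> \<le> C / (4 ^ j * \<delta>)"
    proof (cases j)
      case 0
      have "2 / \<delta> \<le> C / \<delta>" using C \<delta> by (intro divide_right_mono) auto
      with pk1 0 show ?thesis by simp
    next
      case (Suc i)
      then have "\<not> cmod (\<xi> - \<zeta>) \<le> 2 ^ i * \<delta>" 
        using not_less_Least[of i "\<lambda>j. cmod (\<xi> - \<zeta>) \<le> 2 ^ j * \<delta>"] j_def by simp
      then have "poisson_kernel z \<xi> \<le> C * \<delta> / (2*(2 ^ i * \<delta>))\<^sup>2"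
        using \<delta> by (intro pk2) auto
      also have "(2*(2 ^ i * \<delta>))\<^sup>2 = 4 ^ j * \<delta> * \<delta>"
        unfolding Suc by (simp add: power2_eq_square power_mult_distrib[symmetric] mult_ac)
      finally show ?thesis using \<delta> by simp
    qed
    also have "\<dots> = C / (4 ^ j * \<delta>) * indicator (cball \<zeta> (2 ^ j * \<delta>)) \<xi>"
      using j by (simp add: indicator_def dist_norm norm_minus_commute)
    also have "\<dots> \<le> (\<Sum>j\<le>J. C / (4 ^ j * \<delta>) * indicator (cball \<zeta> (2 ^ j * \<delta>)) \<xi>)"
      using jJ by (intro member_le_sum nn) auto
    also have "\<dots> \<le> \<dots> + C * \<delta> / \<eta>\<^sup>2" using C \<delta> by simp
    finally show ?thesis .
  qed
qed

text \<open>At a Lebesgue point the integral over the disc of radius 2^j \<delta> is at most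
  \<epsilon> 2^j \<delta>, against a coefficient C / (4^j \<delta>): a geometric series, bounded
  uniformly in z. The rest of the circle contributes a multiple of \<delta>.\<close>

theorem poisson_integral_nontangential_limit:
  fixes k :: "complex \<Rightarrow> complex"
  assumes int: "integrable circle_measure k"
  shows "AE \<zeta> in circle_measure. has_nontangential_limit
           (\<lambda>z. LINT \<xi>|circle_measure. of_real (poisson_kernel z \<xi>) * k \<xi>) \<zeta> (k \<zeta>)"
  using AE_Lebesgue_point_circle[OF int]
proof eventually_elim
  case (elim \<zeta>)
  let ?u = "\<lambda>z. LINT \<xi>|circle_measure. of_real (poisson_kernel z \<xi>) * k \<xi>"
  define w where "w \<xi> = cmod (k \<xi> - k \<zeta>)" for \<xi>
  have dint: "integrable circle_measure (\<lambda>\<xi>. k \<xi> - k \<zeta>)" using int by simp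
  have wint: "integrable circle_measure w" unfolding w_def using dint by (rule integrable_norm)
  have w0: "0 \<le> w \<xi>" for \<xi> by (simp add: w_def)
  have wcint: "integrable circle_measure (\<lambda>\<xi>. indicator (cball \<zeta> h) \<xi> * w \<xi>)" for h
    using integrable_mult_indicator[OF _ wint, of "cball \<zeta> h"] by simp
  have Lp: "\<exists>\<eta>>0. \<forall>h. 0 < h \<and> h < \<eta> \<longrightarrow> (LINT \<xi>|circle_measure. indicator (cball \<zeta> h) \<xi> * w \<xi>) \<le> \<epsilon> * h"
    if "\<epsilon> > 0" for \<epsilon> using elim that unfolding w_def by blast
  show ?case
    unfolding has_nontangential_limit_def
  proof (intro allI impI tendstoI)
    fix M e :: real assume M: "M > 1" and e: "e > 0"
    define C where "C = 8 * (1 + M)\<^sup>2"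
    have C: "C > 0" using M by (simp add: C_def)
    define \<epsilon> where "\<epsilon> = e / (4 * C)"
    have \<epsilon>: "\<epsilon> > 0" using e C by (simp add: \<epsilon>_def)
    obtain \<eta> where \<eta>: "\<eta> > 0" "\<And>h. 0 < h \<Longrightarrow> h < \<eta> \<Longrightarrow> (LINT \<xi>|circle_measure. indicator (cball \<zeta> h) \<xi> * w \<xi>) \<le> \<epsilon> * h"
      using Lp[OF \<epsilon>] by auto
    define W where "W = (LINT \<xi>|circle_measure. w \<xi>)"
    have W0: "W \<ge> 0" unfolding W_def using w0 by (intro Bochner_Integration.integral_nonneg) auto
    \<comment> \<open>The first entry puts at least one dyadic radius below \<eta>, the second makes
      the far part smaller than e / 2. Writing \<open>W + 1\<close> avoids a zero
      denominator.\<close>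
    define d where "d = min \<eta> (e * \<eta>\<^sup>2 / (2 * C * (W + 1)))"
    have d: "d > 0" using \<eta> e C W0 by (simp add: d_def)
    have main: "dist (?u z) (k \<zeta>) < e" if z: "z \<in> stolz_region M \<zeta>" and zd: "dist z \<zeta> < d" for z
    proof -
      have z1: "cmod z < 1" and st: "cmod (z - \<zeta>) < M * (1 - cmod z)"
        using z by (auto simp: stolz_region_def)
      define \<delta> where "\<delta> = 1 - cmod z"
      have \<delta>: "\<delta> > 0" using z1 by (simp add: \<delta>_def)
      have "\<delta> \<le> cmod (\<zeta> - z)" unfolding \<delta>_def using elim by (intro norm_diff_circle_ge) auto
      then have \<delta>d: "\<delta> < d" using zd by (simp add: dist_norm norm_minus_commute)
      have ex: "\<exists>n. \<eta> \<le> 2 ^ n * \<delta>"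
      proof -
        obtain n where "\<eta> / \<delta> < 2 ^ n" using real_arch_pow[of 2 "\<eta>/\<delta>"] by auto
        then show ?thesis using \<delta> by (intro exI[of _ n]) (simp add: field_simps)
      qed
      \<comment> \<open>\<open>J = n - 1\<close> is the last index with 2^J \<delta> < \<eta>, so
        the Lebesgue estimate still applies to it, while the next radius already reaches \<eta>, as
        the kernel bound demands.\<close>
      define n where "n = (LEAST n. \<eta> \<le> 2 ^ n * \<delta>)"
      have n: "\<eta> \<le> 2 ^ n * \<delta>" unfolding n_def using ex by (rule LeastI_ex)
      have "n \<noteq> 0" using n \<delta>d d_def by (intro notI) simp
      then obtain J where J: "n = Suc J" by (cases n) auto
      have small: "2 ^ J * \<delta> < \<eta>" using not_less_Least[of J "\<lambda>n. \<eta> \<le> 2 ^ n * \<delta>"] J n_def by simp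
      have bd: "poisson_kernel z \<xi> \<le> (\<Sum>j\<le>J. C / (4 ^ j * \<delta>) * indicator (cball \<zeta> (2 ^ j * \<delta>)) \<xi>) + C * \<delta> / \<eta>\<^sup>2"
        if "cmod \<xi> = 1" for \<xi>
        unfolding C_def \<delta>_def
        by (rule poisson_kernel_dyadic_bound) (use z1 st n J \<eta> that M \<delta>_def in auto)
      have one: "(LINT \<xi>|circle_measure. of_real (poisson_kernel z \<xi>) * k \<zeta>) = k \<zeta>"
        using poisson_integral_entire[of "\<lambda>_. k \<zeta>" z] z1 by simp
      have ik: "integrable circle_measure (\<lambda>\<xi>. k \<zeta>)" by simp
      have "?u z - k \<zeta> = (LINT \<xi>|circle_measure. of_real (poisson_kernel z \<xi>) * (k \<xi> - k \<zeta>))"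
        unfolding right_diff_distrib
        by (subst Bochner_Integration.integral_diff)
           (use integrable_poisson_kernel_mult[OF int z1] integrable_poisson_kernel_mult[OF ik z1] one in auto)
      then have "cmod (?u z - k \<zeta>) \<le> (LINT \<xi>|circle_measure. cmod (of_real (poisson_kernel z \<xi>) * (k \<xi> - k \<zeta>)))"
        by simp
      also have "\<dots> \<le> (LINT \<xi>|circle_measure. (\<Sum>j\<le>J. C / (4 ^ j * \<delta>) * (indicator (cball \<zeta> (2 ^ j * \<delta>)) \<xi> * w \<xi>)) + C * \<delta> / \<eta>\<^sup>2 * w \<xi>)"
      proof (rule integral_mono_AE)
        show "integrable circle_measure (\<lambda>\<xi>. cmod (of_real (poisson_kernel z \<xi>) * (k \<xi> - k \<zeta>)))"
          by (intro integrable_norm integrable_poisson_kernel_mult dint z1)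
        show "integrable circle_measure (\<lambda>\<xi>. (\<Sum>j\<le>J. C / (4 ^ j * \<delta>) * (indicator (cball \<zeta> (2 ^ j * \<delta>)) \<xi> * w \<xi>)) + C * \<delta> / \<eta>\<^sup>2 * w \<xi>)"
          by (intro Bochner_Integration.integrable_add Bochner_Integration.integrable_sum integrable_mult_right wcint wint)
        show "AE \<xi> in circle_measure. cmod (of_real (poisson_kernel z \<xi>) * (k \<xi> - k \<zeta>))
            \<le> (\<Sum>j\<le>J. C / (4 ^ j * \<delta>) * (indicator (cball \<zeta> (2 ^ j * \<delta>)) \<xi> * w \<xi>)) + C * \<delta> / \<eta>\<^sup>2 * w \<xi>"
          using AE_circle_measure_norm
        proof eventually_elim
          case (elim \<xi>)
          have "cmod (of_real (poisson_kernel z \<xi>) * (k \<xi> - k \<zeta>)) = poisson_kernel z \<xi> * w \<xi>"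
            using poisson_kernel_nonneg[OF z1] by (simp add: norm_mult w_def)
          also have "\<dots> \<le> ((\<Sum>j\<le>J. C / (4 ^ j * \<delta>) * indicator (cball \<zeta> (2 ^ j * \<delta>)) \<xi>) + C * \<delta> / \<eta>\<^sup>2) * w \<xi>"
            using bd[OF elim] w0 by (rule mult_right_mono)
          finally show ?case by (simp add: distrib_right sum_distrib_right mult.assoc)
        qed
      qed
      also have "\<dots> = (\<Sum>j\<le>J. C / (4 ^ j * \<delta>) * (LINT \<xi>|circle_measure. indicator (cball \<zeta> (2 ^ j * \<delta>)) \<xi> * w \<xi>)) + C * \<delta> / \<eta>\<^sup>2 * W"
        unfolding W_def
        by (subst Bochner_Integration.integral_add)
           (auto intro!: Bochner_Integration.integrable_sum integrable_mult_right wcint wint simp: Bochner_Integration.integral_sum wcint)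
      also have "(\<Sum>j\<le>J. C / (4 ^ j * \<delta>) * (LINT \<xi>|circle_measure. indicator (cball \<zeta> (2 ^ j * \<delta>)) \<xi> * w \<xi>))
          \<le> (\<Sum>j\<le>J. C * \<epsilon> * (1/2) ^ j)"
      proof (rule sum_mono)
        fix j assume "j \<in> {..J}"
        then have "2 ^ j * \<delta> \<le> 2 ^ J * \<delta>" using \<delta> by (intro mult_right_mono power_increasing) auto
        then have "(LINT \<xi>|circle_measure. indicator (cball \<zeta> (2 ^ j * \<delta>)) \<xi> * w \<xi>) \<le> \<epsilon> * (2 ^ j * \<delta>)"
          using le_less_trans[OF _ small] \<delta> by (intro \<eta>(2)) auto
        then have "C / (4 ^ j * \<delta>) * (LINT \<xi>|circle_measure. indicator (cball \<zeta> (2 ^ j * \<delta>)) \<xi> * w \<xi>)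
            \<le> C / (4 ^ j * \<delta>) * (\<epsilon> * (2 ^ j * \<delta>))"
          using C \<delta> by (intro mult_left_mono) auto
        also have "\<dots> = C * \<epsilon> * (2 ^ j / 4 ^ j)" using \<delta> by simp
        also have "(2::real) ^ j / 4 ^ j = (1/2) ^ j" by (simp add: power_divide[symmetric])
        finally show "C / (4 ^ j * \<delta>) * (LINT \<xi>|circle_measure. indicator (cball \<zeta> (2 ^ j * \<delta>)) \<xi> * w \<xi>) \<le> C * \<epsilon> * (1/2) ^ j" .
      qed
      also have "(\<Sum>j\<le>J. C * \<epsilon> * (1/2) ^ j) \<le> C * \<epsilon> * 2"
      proof -
        have "(\<Sum>j\<le>J. (1/2::real) ^ j) \<le> (\<Sum>j. (1/2) ^ j)"
          by (rule sum_le_suminf) auto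
        also have "\<dots> = 2" by (simp add: suminf_geometric)
        finally show ?thesis unfolding sum_distrib_left[symmetric] using C \<epsilon> by (intro mult_left_mono) auto
      qed
      also have "C * \<epsilon> * 2 = e / 2" using C by (simp add: \<epsilon>_def)
      also have "C * \<delta> / \<eta>\<^sup>2 * W < e / 2"
      proof -
        have "\<delta> * (2 * C * (W + 1)) < e * \<eta>\<^sup>2"
          using \<delta>d C W0 unfolding d_def by (simp add: less_divide_eq)
        moreover have "\<delta> * (2 * C * W) \<le> \<delta> * (2 * C * (W + 1))"
          using \<delta> C by (intro mult_left_mono) auto
        ultimately have "2 * (C * \<delta> * W) < e * \<eta>\<^sup>2" by (simp add: mult_ac)
        then show ?thesis using \<eta>(1) by (simp add: field_simps)
      qed
      finally show ?thesis by (simp add: dist_norm)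
    qed
    show "\<forall>\<^sub>F z in at \<zeta> within stolz_region M \<zeta>. dist (?u z) (k \<zeta>) < e"
      unfolding eventually_at using d main by blast
  qed
qed

section \<open>The theorem of Fatou for bounded holomorphic functions\<close>

lemma measurable_cnj [measurable]: "cnj \<in> borel_measurable borel"
  by (intro borel_measurable_continuous_onI continuous_on_cnj continuous_on_id)

lemma integrable_circle_bounded:
  fixes g :: "complex \<Rightarrow> 'a :: {banach, second_countable_topology}"
  assumes [measurable]: "g \<in> borel_measurable borel" and "\<And>\<xi>. cmod \<xi> = 1 \<Longrightarrow> norm (g \<xi>) \<le> B"
  shows "integrable circle_measure g"
proof (rule circle.integrable_const_bound)
  show "AE \<xi> in circle_measure. norm (g \<xi>) \<le> B"
    using AE_circle_measure_norm by eventually_elim (rule assms(2))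
qed simp

section \<open>Parseval's identity and square-summable Taylor coefficients\<close>

lemma integral_circle_entire:
  assumes "h holomorphic_on UNIV"
  shows "(LINT \<xi>|circle_measure. h \<xi>) = h 0"
proof -
  have [measurable]: "h \<in> borel_measurable borel"
    by (intro borel_measurable_continuous_onI holomorphic_on_imp_continuous_on assms)
  have "(LINT \<xi>|circle_measure. h \<xi>) = (LINT \<xi>|circle_measure. of_real (poisson_kernel 0 \<xi>) * h \<xi>)"
  proof (rule integral_cong_AE)
    show "AE \<xi> in circle_measure. h \<xi> = of_real (poisson_kernel 0 \<xi>) * h \<xi>"
      using AE_circle_measure_norm by eventually_elim (simp add: poisson_kernel_def)
  qed simp_all
  then show ?thesis using poisson_integral_entire[OF assms, of 0] by simp
qed

lemma integral_circle_monomials: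
  "(LINT \<xi>|circle_measure. \<xi> ^ n * cnj \<xi> ^ m) = (if n = m then 1 else 0)"
proof -
  have ge: "(LINT \<xi>|circle_measure. \<xi> ^ n * cnj \<xi> ^ m) = (if n = m then 1 else 0)" if "m \<le> n" for n m
  proof -
    have "(LINT \<xi>|circle_measure. \<xi> ^ n * cnj \<xi> ^ m) = (LINT \<xi>|circle_measure. \<xi> ^ (n - m))"
    proof (rule integral_cong_AE)
      show "AE \<xi> in circle_measure. \<xi> ^ n * cnj \<xi> ^ m = \<xi> ^ (n - m)"
        using AE_circle_measure_norm
      proof eventually_elim
        case (elim \<xi>)
        have "\<xi> ^ n * cnj \<xi> ^ m = \<xi> ^ (n - m) * (\<xi> * cnj \<xi>) ^ m"
          using that by (simp add: power_mult_distrib mult.assoc[symmetric] power_add[symmetric])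
        also have "\<xi> * cnj \<xi> = 1" using elim by (simp add: complex_norm_square[symmetric])
        finally show ?case by simp
      qed
    qed simp_all
    also have "\<dots> = 0 ^ (n - m)" by (rule integral_circle_entire) (intro holomorphic_intros)
    finally show ?thesis using that by (cases "n = m") auto
  qed
  show ?thesis
  proof (cases "m \<le> n")
    case False
    have "(LINT \<xi>|circle_measure. \<xi> ^ n * cnj \<xi> ^ m) = (LINT \<xi>|circle_measure. cnj (\<xi> ^ m * cnj \<xi> ^ n))"
      by (simp add: mult.commute)
    also have "\<dots> = cnj (LINT \<xi>|circle_measure. \<xi> ^ m * cnj \<xi> ^ n)" by (rule Bochner_Integration.integral_cnj)
    finally show ?thesis using ge[of n m] False by simp
  qed (rule ge)
qed

lemma parseval_polynomial:
  assumes "finite A"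
  shows "(LINT \<xi>|circle_measure. (cmod (\<Sum>n\<in>A. a n * \<xi> ^ n))\<^sup>2) = (\<Sum>n\<in>A. (cmod (a n))\<^sup>2)"
proof -
  have int: "integrable circle_measure (\<lambda>\<xi>. \<xi> ^ n * cnj \<xi> ^ m)" for n m :: nat
    by (rule integrable_circle_bounded[where B=1]) (simp_all add: norm_mult norm_power)
  have "complex_of_real (LINT \<xi>|circle_measure. (cmod (\<Sum>n\<in>A. a n * \<xi> ^ n))\<^sup>2)
      = (LINT \<xi>|circle_measure. complex_of_real ((cmod (\<Sum>n\<in>A. a n * \<xi> ^ n))\<^sup>2))"
    by (rule integral_complex_of_real[symmetric])
  also have "\<dots> = (LINT \<xi>|circle_measure. (\<Sum>n\<in>A. \<Sum>m\<in>A. (a n * cnj (a m)) * (\<xi> ^ n * cnj \<xi> ^ m)))"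
    unfolding complex_norm_square by (simp add: sum_product mult_ac)
  also have "\<dots> = (\<Sum>n\<in>A. \<Sum>m\<in>A. (a n * cnj (a m)) * (LINT \<xi>|circle_measure. \<xi> ^ n * cnj \<xi> ^ m))"
    by (subst Bochner_Integration.integral_sum)
      (auto intro!: Bochner_Integration.integrable_sum integrable_mult_right int sum.cong
        simp: Bochner_Integration.integral_sum int)
  also have "\<dots> = (\<Sum>n\<in>A. a n * cnj (a n))"
    using assms by (simp add: integral_circle_monomials if_distrib if_distribR sum.delta cong: if_cong)
  also have "\<dots> = of_real (\<Sum>n\<in>A. (cmod (a n))\<^sup>2)"
    unfolding of_real_sum complex_norm_square ..
  finally show ?thesis unfolding of_real_eq_iff .
qed

lemma integral_circle_polynomial_norm_le:
  assumes "finite A"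
  shows "(LINT \<xi>|circle_measure. cmod (\<Sum>n\<in>A. a n * \<xi> ^ n)) \<le> sqrt (\<Sum>n\<in>A. (cmod (a n))\<^sup>2)"
proof -
  define f where "f = (\<lambda>\<xi>. cmod (\<Sum>n\<in>A. a n * \<xi> ^ n))"
  define B where "B = (\<Sum>n\<in>A. cmod (a n))"
  have [measurable]: "f \<in> borel_measurable borel"
    unfolding f_def by measurable
  have bd: "f \<xi> \<le> B" "0 \<le> f \<xi>" if "cmod \<xi> = 1" for \<xi>
  proof -
    have "f \<xi> \<le> (\<Sum>n\<in>A. cmod (a n * \<xi> ^ n))" unfolding f_def by (rule norm_sum)
    also have "\<dots> = B" unfolding B_def using that by (simp add: norm_mult norm_power)
    finally show "f \<xi> \<le> B" .
  qed (simp add: f_def)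
  have i1: "integrable circle_measure f"
    by (rule integrable_circle_bounded[where B=B]) (use bd in auto)
  have i2: "integrable circle_measure (\<lambda>\<xi>. (f \<xi>)\<^sup>2)"
    by (rule integrable_circle_bounded[where B="B\<^sup>2"]) (use bd in \<open>auto intro!: power_mono\<close>)
  define c where "c = (LINT \<xi>|circle_measure. f \<xi>)"
  \<comment> \<open>Nonnegative variance: as the total mass is 1, this is the Cauchy-Schwarz
    inequality against the constant 1.\<close>
  have "0 \<le> (LINT \<xi>|circle_measure. (f \<xi> - c)\<^sup>2)"
    by (intro Bochner_Integration.integral_nonneg) auto
  also have "\<dots> = (LINT \<xi>|circle_measure. (f \<xi>)\<^sup>2 - 2 * c * f \<xi> + c\<^sup>2)"
    by (simp add: power2_diff algebra_simps)
  also have "\<dots> = (LINT \<xi>|circle_measure. (f \<xi>)\<^sup>2) - 2 * c * c + c\<^sup>2"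
    using i1 i2 by (simp add: c_def)
  finally have "c\<^sup>2 \<le> (LINT \<xi>|circle_measure. (f \<xi>)\<^sup>2)"
    by (simp add: power2_eq_square)
  also have "\<dots> = (\<Sum>n\<in>A. (cmod (a n))\<^sup>2)"
    unfolding f_def by (rule parseval_polynomial) fact
  finally show ?thesis unfolding c_def f_def by (rule real_le_rsqrt)
qed

text \<open>Parseval's identity is applied to a Taylor polynomial on a circle of radius r < 1, where
  uniform convergence puts it within 1 of f; hence the \<open>B + 1\<close>. The bound is free of r,
  so r can tend to 1 for each fixed \<open>N\<close>.\<close>

lemma bounded_holomorphic_coefficients:
  fixes f :: "complex \<Rightarrow> complex"
  assumes sums: "\<And>z. cmod z < 1 \<Longrightarrow> (\<lambda>n. a n * z ^ n) sums f z"
    and bd: "\<And>z. cmod z < 1 \<Longrightarrow> cmod (f z) \<le> B"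
  shows "summable (\<lambda>n. (cmod (a n))\<^sup>2)"
proof (rule summableI_nonneg_bounded)
  have conv: "conv_radius a \<ge> 1"
  proof (rule conv_radius_geI_ex')
    fix r :: real assume "0 < r" "ereal r < 1"
    then show "summable (\<lambda>n. a n * of_real r ^ n)"
      using sums[of "of_real r"] by (simp add: sums_iff)
  qed
  fix N
  have le: "(\<Sum>n<N. (cmod (a n))\<^sup>2 * (r ^ n)\<^sup>2) \<le> (B + 1)\<^sup>2" if r: "0 < r" "r < 1" for r :: real
  proof -
    have "ereal r < conv_radius a" using r conv by (metis less_ereal.simps(1) one_ereal_def order_less_le_trans)
    from uniform_limitD[OF powser_uniform_limit[OF this, of 0] zero_less_one]
    obtain N0 where N0: "\<And>n x. n \<ge> N0 \<Longrightarrow> cmod x \<le> r \<Longrightarrow> cmod ((\<Sum>i<n. a i * x ^ i) - (\<Sum>i. a i * x ^ i)) < 1"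
      unfolding eventually_sequentially dist_norm diff_zero mem_cball_0 Ball_def by blast
    define N' where "N' = max N N0"
    have bd': "cmod (\<Sum>i<N'. a i * x ^ i) \<le> B + 1" if "cmod x \<le> r" for x
    proof -
      have "(\<Sum>i. a i * x ^ i) = f x" using sums[of x] that r by (simp add: sums_iff)
      then have "cmod ((\<Sum>i<N'. a i * x ^ i) - f x) < 1" using N0[of N' x] that by (simp add: N'_def)
      moreover have "cmod (f x) \<le> B" using bd[of x] that r by simp
      ultimately show ?thesis using norm_triangle_sub[of "\<Sum>i<N'. a i * x ^ i" "f x"] by linarith
    qed
    have "(\<Sum>n<N. (cmod (a n))\<^sup>2 * (r ^ n)\<^sup>2) \<le> (\<Sum>n<N'. (cmod (a n))\<^sup>2 * (r ^ n)\<^sup>2)"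
      by (rule sum_mono2) (auto simp: N'_def)
    also have "\<dots> = (\<Sum>n<N'. (cmod (a n * of_real r ^ n))\<^sup>2)"
      using r by (simp add: norm_mult norm_power power_mult_distrib)
    also have "\<dots> = (LINT \<xi>|circle_measure. (cmod (\<Sum>n<N'. (a n * of_real r ^ n) * \<xi> ^ n))\<^sup>2)"
      by (rule parseval_polynomial[symmetric]) simp
    also have "\<dots> \<le> (LINT \<xi>|circle_measure. (B + 1)\<^sup>2)"
    proof (rule integral_mono_AE)
      have b: "cmod (\<Sum>n<N'. (a n * of_real r ^ n) * \<xi> ^ n) \<le> B + 1" if "cmod \<xi> = 1" for \<xi>
        using bd'[of "of_real r * \<xi>"] that r by (simp add: norm_mult power_mult_distrib mult.assoc)
      then show "integrable circle_measure (\<lambda>\<xi>. (cmod (\<Sum>n<N'. (a n * of_real r ^ n) * \<xi> ^ n))\<^sup>2)"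
        by (intro integrable_circle_bounded[where B="(B+1)\<^sup>2"]) (auto intro!: power_mono)
      show "AE \<xi> in circle_measure. (cmod (\<Sum>n<N'. (a n * of_real r ^ n) * \<xi> ^ n))\<^sup>2 \<le> (B + 1)\<^sup>2"
        using AE_circle_measure_norm by eventually_elim (intro power_mono b, auto)
    qed simp
    finally show ?thesis by simp
  qed
  have "((\<lambda>r::real. \<Sum>n<N. (cmod (a n))\<^sup>2 * (r ^ n)\<^sup>2) \<longlongrightarrow> (\<Sum>n<N. (cmod (a n))\<^sup>2 * (1 ^ n)\<^sup>2)) (at_left 1)"
    by (intro tendsto_intros)
  moreover have "\<forall>\<^sub>F r in at_left 1. (\<Sum>n<N. (cmod (a n))\<^sup>2 * (r ^ n)\<^sup>2) \<le> (B + 1)\<^sup>2"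
    by (rule eventually_at_leftI[of 0]) (auto intro: le)
  ultimately show "(\<Sum>n<N. (cmod (a n))\<^sup>2) \<le> (B + 1)\<^sup>2"
    using tendsto_upperbound[of _ _ "at_left (1::real)"] by fastforce
qed simp

text \<open>Along a sparse sequence of partial sums the increments are absolutely summable in the
  mean, hence almost everywhere; no completeness theorem for \<open>L\<^sup>2\<close> is needed.\<close>

lemma square_summable_poisson_representation:
  fixes f :: "complex \<Rightarrow> complex"
  assumes sums: "\<And>z. cmod z < 1 \<Longrightarrow> (\<lambda>n. a n * z ^ n) sums f z"
    and sq: "summable (\<lambda>n. (cmod (a n))\<^sup>2)"
  obtains \<rho> where "integrable circle_measure \<rho>"
    "\<And>z. cmod z < 1 \<Longrightarrow> f z = (LINT \<xi>|circle_measure. of_real (poisson_kernel z \<xi>) * \<rho> \<xi>)"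
proof -
  have "\<exists>N. \<forall>m\<ge>N. \<forall>n. norm (\<Sum>i\<in>{m..<n}. (cmod (a i))\<^sup>2) < (1/4) ^ k" for k :: nat
    using sq unfolding summable_Cauchy by simp
  then obtain g where g: "\<And>k m n. m \<ge> g k \<Longrightarrow> norm (\<Sum>i\<in>{m..<n}. (cmod (a i))\<^sup>2) < (1/4) ^ k"
    by metis
  \<comment> \<open>Squared coefficient tails from \<open>g k\<close> on are below 4^-k, so the
    block starting at \<open>N (Suc k)\<close> has mean modulus at most 2^-(k+1). \<open>Suc\<close>
    makes the cut points strictly increasing. The block with index 0 carries no such bound and is
    split off in the summability argument.\<close>
  define N where "N k = (\<Sum>i<k. Suc (g (Suc i)))" for k
  have N0: "N 0 = 0" by (simp add: N_def)
  have smN: "strict_mono N" by (rule strict_monoI_Suc) (simp add: N_def)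
  then have leN: "N k \<le> N (Suc k)" for k by (simp add: strict_mono_less_eq)
  have gN: "g (Suc k) \<le> N (Suc k)" for k by (simp add: N_def)
  define F where "F k = (\<lambda>\<xi>. \<Sum>n\<in>{N k..<N (Suc k)}. a n * \<xi> ^ n)" for k
  have holoF: "F k holomorphic_on UNIV" for k unfolding F_def by (intro holomorphic_intros)
  have [measurable]: "F k \<in> borel_measurable borel" for k
    unfolding F_def by measurable
  have Fint: "integrable circle_measure (F k)" for k
  proof (rule integrable_circle_bounded)
    fix \<xi> :: complex assume "cmod \<xi> = 1"
    then show "norm (F k \<xi>) \<le> (\<Sum>n\<in>{N k..<N (Suc k)}. cmod (a n))"
      unfolding F_def by (intro sum_norm_le) (simp add: norm_mult norm_power)
  qed simp
  have F1: "(LINT \<xi>|circle_measure. cmod (F (Suc k) \<xi>)) \<le> (1/2) ^ Suc k" for k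
  proof -
    have "(LINT \<xi>|circle_measure. cmod (F (Suc k) \<xi>)) \<le> sqrt (\<Sum>n\<in>{N (Suc k)..<N (Suc (Suc k))}. (cmod (a n))\<^sup>2)"
      unfolding F_def by (rule integral_circle_polynomial_norm_le) simp
    also have "\<dots> \<le> sqrt ((1/4) ^ Suc k)"
      using g[OF gN, of k "N (Suc (Suc k))"] by (intro real_sqrt_le_mono) simp
    also have "\<dots> = (1/2) ^ Suc k"
      by (rule real_sqrt_unique) (simp_all add: power2_eq_square power_mult_distrib[symmetric])
    finally show ?thesis .
  qed
  have sumF: "summable (\<lambda>k. LINT \<xi>|circle_measure. cmod (F k \<xi>))"
  proof (rule iffD1[OF summable_Suc_iff], rule summable_comparison_test')
    show "summable (\<lambda>k. (1/2::real) ^ Suc k)" by (subst summable_Suc_iff) (simp add: summable_geometric)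
    show "norm (LINT \<xi>|circle_measure. cmod (F (Suc k) \<xi>)) \<le> (1/2) ^ Suc k" for k
      using F1[of k] by (subst real_norm_def, subst abs_of_nonneg) (auto intro: Bochner_Integration.integral_nonneg)
  qed
  have AEsum: "AE \<xi> in circle_measure. summable (\<lambda>k. cmod (F k \<xi>))"
  proof -
    have "(\<integral>\<^sup>+\<xi>. (\<Sum>k. ennreal (cmod (F k \<xi>))) \<partial>circle_measure) = (\<Sum>k. \<integral>\<^sup>+\<xi>. ennreal (cmod (F k \<xi>)) \<partial>circle_measure)"
      by (rule nn_integral_suminf) simp
    also have "\<dots> = (\<Sum>k. ennreal (LINT \<xi>|circle_measure. cmod (F k \<xi>)))"
      by (intro suminf_cong nn_integral_eq_integral integrable_norm Fint) simp
    also have "\<dots> < \<infinity>"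
      using sumF by (subst suminf_ennreal2) (auto intro: Bochner_Integration.integral_nonneg)
    finally have "AE \<xi> in circle_measure. (\<Sum>k. ennreal (cmod (F k \<xi>))) \<noteq> \<infinity>"
      by (intro nn_integral_PInf_AE) auto
    then show ?thesis
      by eventually_elim (rule summable_suminf_not_top, auto)
  qed
  \<comment> \<open>The blocks converge absolutely almost everywhere; on the remaining null set the
    value of the sum is immaterial.\<close>
  define \<rho> where "\<rho> = (\<lambda>\<xi>. \<Sum>k. F k \<xi>)"
  have [measurable]: "\<rho> \<in> borel_measurable borel"
    unfolding \<rho>_def by measurable
  show ?thesis
  proof
    show \<rho>int: "integrable circle_measure \<rho>"
      unfolding \<rho>_def by (rule integrable_suminf[OF Fint AEsum sumF])
    fix z :: complex assume z: "cmod z < 1"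
    let ?K = "\<lambda>\<xi>. complex_of_real (poisson_kernel z \<xi>)"
    have KF: "(LINT \<xi>|circle_measure. ?K \<xi> * F k \<xi>) = F k z" for k
      by (rule poisson_integral_entire[OF holoF z])
    have KFint: "integrable circle_measure (\<lambda>\<xi>. ?K \<xi> * F k \<xi>)" for k
      by (rule integrable_poisson_kernel_mult[OF Fint z])
    \<comment> \<open>For fixed z the kernel is bounded by 2 / (1 - |z|) on the circle, so
      multiplying by it preserves absolute summability in the mean.\<close>
    have "(\<lambda>k. LINT \<xi>|circle_measure. ?K \<xi> * F k \<xi>) sums (LINT \<xi>|circle_measure. (\<Sum>k. ?K \<xi> * F k \<xi>))"
    proof (rule sums_integral[OF KFint])
      show "AE \<xi> in circle_measure. summable (\<lambda>k. norm (?K \<xi> * F k \<xi>))"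
        using AEsum by eventually_elim (simp add: norm_mult summable_mult)
      show "summable (\<lambda>k. LINT \<xi>|circle_measure. norm (?K \<xi> * F k \<xi>))"
      proof (rule summable_comparison_test')
        show "summable (\<lambda>k. 2 / (1 - cmod z) * (LINT \<xi>|circle_measure. cmod (F k \<xi>)))"
          by (rule summable_mult[OF sumF])
        show "norm (LINT \<xi>|circle_measure. norm (?K \<xi> * F k \<xi>)) \<le> 2 / (1 - cmod z) * (LINT \<xi>|circle_measure. cmod (F k \<xi>))" for k
        proof -
          have "(LINT \<xi>|circle_measure. norm (?K \<xi> * F k \<xi>)) \<le> (LINT \<xi>|circle_measure. 2 / (1 - cmod z) * cmod (F k \<xi>))"
          proof (rule integral_mono_AE)
            show "AE \<xi> in circle_measure. norm (?K \<xi> * F k \<xi>) \<le> 2 / (1 - cmod z) * cmod (F k \<xi>)"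
              using AE_circle_measure_norm
            proof eventually_elim
              case (elim \<xi>)
              then show ?case
                using poisson_kernel_bound[OF z elim] poisson_kernel_nonneg[OF z, of \<xi>]
                unfolding norm_mult by (intro mult_right_mono) auto
            qed
          qed (intro integrable_norm KFint integrable_mult_right Fint)+
          then show ?thesis by (simp add: Bochner_Integration.integral_nonneg)
        qed
      qed
    qed
    also have "(LINT \<xi>|circle_measure. (\<Sum>k. ?K \<xi> * F k \<xi>)) = (LINT \<xi>|circle_measure. ?K \<xi> * \<rho> \<xi>)"
    proof (rule integral_cong_AE)
      show "AE \<xi> in circle_measure. (\<Sum>k. ?K \<xi> * F k \<xi>) = ?K \<xi> * \<rho> \<xi>"
        using AEsum
        by eventually_elim (simp add: \<rho>_def suminf_mult[OF summable_norm_cancel])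
    qed simp_all
    finally have "(\<lambda>k. F k z) sums (LINT \<xi>|circle_measure. ?K \<xi> * \<rho> \<xi>)" unfolding KF .
    then have lim1: "(\<lambda>n. \<Sum>k<n. F k z) \<longlonglongrightarrow> (LINT \<xi>|circle_measure. ?K \<xi> * \<rho> \<xi>)"
      by (simp add: sums_def)
    have "(\<Sum>k<n. F k z) = (\<Sum>i<N n. a i * z ^ i)" for n
    proof (induction n)
      case (Suc n)
      have "(\<Sum>i<N (Suc n). a i * z ^ i) = (\<Sum>i<N n. a i * z ^ i) + (\<Sum>i\<in>{N n..<N (Suc n)}. a i * z ^ i)"
        using leN[of n] by (simp add: lessThan_atLeast0 sum.atLeastLessThan_concat)
      with Suc show ?case by (simp add: F_def)
    qed (simp add: N0)
    moreover have "(\<lambda>n. \<Sum>i<N n. a i * z ^ i) \<longlonglongrightarrow> f z"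
      using LIMSEQ_subseq_LIMSEQ[OF _ smN] sums[OF z] unfolding sums_def comp_def by blast
    ultimately have "(\<lambda>n. \<Sum>k<n. F k z) \<longlonglongrightarrow> f z" by simp
    then show "f z = (LINT \<xi>|circle_measure. ?K \<xi> * \<rho> \<xi>)" by (rule LIMSEQ_unique) (rule lim1)
  qed
qed

lemma has_nontangential_limit_cong:
  assumes "\<And>z. cmod z < 1 \<Longrightarrow> f z = g z"
  shows "has_nontangential_limit f \<zeta> l \<longleftrightarrow> has_nontangential_limit g \<zeta> l"
  unfolding has_nontangential_limit_def
  by (intro all_cong imp_cong refl Lim_cong_within) (auto simp: stolz_region_def assms)

text \<open>Square-summable coefficients make a bounded function a Poisson integral. The limit is
  delivered as a Borel function because \<open>boundary_value\<close> is a description without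
  evident measurability.\<close>

theorem Fatou_H_infinity:
  assumes "f \<in> H_infinity"
  obtains \<rho> where "\<rho> \<in> borel_measurable borel"
    "AE \<zeta> in circle_measure. has_nontangential_limit f \<zeta> (\<rho> \<zeta>)"
proof -
  have holo: "f holomorphic_on ball 0 1" and "bounded (f ` ball 0 1)"
    using assms by (auto simp: H_infinity_def Hol_disk_def)
  then obtain B where B: "\<And>z. cmod z < 1 \<Longrightarrow> cmod (f z) \<le> B"
    unfolding bounded_iff by (metis imageI mem_ball_0)
  define a where "a n = (deriv ^^ n) f 0 / fact n" for n
  have sums: "(\<lambda>n. a n * z ^ n) sums f z" if "cmod z < 1" for z
    using holomorphic_power_series[OF holo, of z] that by (simp add: a_def)
  obtain \<rho> where \<rho>: "integrable circle_measure \<rho>"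
    "\<And>z. cmod z < 1 \<Longrightarrow> f z = (LINT \<xi>|circle_measure. of_real (poisson_kernel z \<xi>) * \<rho> \<xi>)"
    using square_summable_poisson_representation[OF sums bounded_holomorphic_coefficients[OF sums B]] by metis
  show ?thesis
  proof
    show "\<rho> \<in> borel_measurable borel" using borel_measurable_integrable[OF \<rho>(1)] by simp
    show "AE \<zeta> in circle_measure. has_nontangential_limit f \<zeta> (\<rho> \<zeta>)"
      using poisson_integral_nontangential_limit[OF \<rho>(1)]
      by eventually_elim (subst has_nontangential_limit_cong[OF \<rho>(2)])
  qed
qed

section \<open>Outer functions and the Smirnov class\<close>

text \<open>As M > 1, radial approach stays inside the Stolz region. Hence the filters defining
  non-tangential limits are nontrivial, which is what makes limits, and with them
  \<open>boundary_value\<close>, unique.\<close>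

lemma radial_filterlim_stolz:
  assumes "cmod \<zeta> = 1" "M > 1"
  shows "filterlim (\<lambda>n. of_real (1 - inverse (real (Suc (Suc n)))) * \<zeta>) (at \<zeta> within stolz_region M \<zeta>) sequentially"
  unfolding filterlim_at
proof
  have "(\<lambda>n. inverse (real (Suc (Suc n)))) \<longlonglongrightarrow> 0"
    by (rule LIMSEQ_Suc[OF LIMSEQ_inverse_real_of_nat])
  then have "(\<lambda>n. of_real (1 - inverse (real (Suc (Suc n)))) * \<zeta>) \<longlonglongrightarrow> of_real (1 - 0) * \<zeta>"
    by (intro tendsto_intros)
  then show "(\<lambda>n. of_real (1 - inverse (real (Suc (Suc n)))) * \<zeta>) \<longlonglongrightarrow> \<zeta>" by simp
  show "\<forall>\<^sub>F n in sequentially. of_real (1 - inverse (real (Suc (Suc n)))) * \<zeta> \<in> stolz_region M \<zeta> \<and>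
      of_real (1 - inverse (real (Suc (Suc n)))) * \<zeta> \<noteq> \<zeta>"
  proof (intro always_eventually allI)
    fix n
    define e where "e = inverse (real (Suc (Suc n)))"
    have e: "0 < e" "e < 1" by (simp_all add: e_def inverse_less_1_iff)
    have 1: "cmod (of_real (1 - e) * \<zeta>) = 1 - e"
      unfolding norm_mult norm_of_real using e assms by simp
    have "of_real (1 - e) * \<zeta> - \<zeta> = - (of_real e * \<zeta>)" by (simp add: algebra_simps)
    then have 2: "cmod (of_real (1 - e) * \<zeta> - \<zeta>) = e"
      using e assms by (simp add: norm_mult)
    have "1 * e < M * e" using e assms by (intro mult_strict_right_mono) auto
    with 1 2 e show "of_real (1 - inverse (real (Suc (Suc n)))) * \<zeta> \<in> stolz_region M \<zeta> \<and>
      of_real (1 - inverse (real (Suc (Suc n)))) * \<zeta> \<noteq> \<zeta>"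
      unfolding e_def[symmetric] stolz_region_def by auto
  qed
qed

lemma at_within_stolz_neq_bot:
  assumes "cmod \<zeta> = 1" "M > 1"
  shows "at \<zeta> within stolz_region M \<zeta> \<noteq> bot"
proof
  assume "at \<zeta> within stolz_region M \<zeta> = bot"
  then have "\<forall>\<^sub>F n in sequentially. False"
    using radial_filterlim_stolz[OF assms, unfolded filterlim_iff, rule_format, of "\<lambda>_. False"] by simp
  then show False by simp
qed

lemma has_nontangential_limit_unique:
  assumes "cmod \<zeta> = 1" "has_nontangential_limit f \<zeta> l" "has_nontangential_limit f \<zeta> l'"
  shows "l = l'"
proof (rule tendsto_unique[OF at_within_stolz_neq_bot[OF assms(1), of 2]])
  show "(f \<longlongrightarrow> l) (at \<zeta> within stolz_region 2 \<zeta>)" "(f \<longlongrightarrow> l') (at \<zeta> within stolz_region 2 \<zeta>)"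
    using assms(2,3) by (simp_all add: has_nontangential_limit_def)
qed simp

lemma boundary_value_eqI:
  assumes "cmod \<zeta> = 1" "has_nontangential_limit f \<zeta> l"
  shows "boundary_value f \<zeta> = l"
  unfolding boundary_value_def
  using assms has_nontangential_limit_unique by (intro the_equality) auto

lemma has_nontangential_limit_add:
  "has_nontangential_limit f \<zeta> l \<Longrightarrow> has_nontangential_limit g \<zeta> m \<Longrightarrow>
    has_nontangential_limit (\<lambda>z. f z + g z) \<zeta> (l + m)"
  unfolding has_nontangential_limit_def by (blast intro: tendsto_add)

lemma has_nontangential_limit_mult:
  "has_nontangential_limit f \<zeta> l \<Longrightarrow> has_nontangential_limit g \<zeta> m \<Longrightarrow>
    has_nontangential_limit (\<lambda>z. f z * g z) \<zeta> (l * m)"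
  unfolding has_nontangential_limit_def by (blast intro: tendsto_mult)

lemma has_nontangential_limit_divide:
  "has_nontangential_limit f \<zeta> l \<Longrightarrow> has_nontangential_limit g \<zeta> m \<Longrightarrow> m \<noteq> 0 \<Longrightarrow>
    has_nontangential_limit (\<lambda>z. f z / g z) \<zeta> (l / m)"
  unfolding has_nontangential_limit_def by (blast intro: tendsto_divide)

lemma has_nontangential_limit_const: "has_nontangential_limit (\<lambda>z. c) \<zeta> c"
  unfolding has_nontangential_limit_def by simp

section \<open>Herglotz integrals and outer functions of prescribed boundary modulus\<close>

definition herglotz :: "(complex \<Rightarrow> real) \<Rightarrow> complex \<Rightarrow> complex" where
  "herglotz k z = (LINT \<zeta>|circle_measure. (\<zeta> + z) / (\<zeta> - z) * of_real (k \<zeta>))"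

lemma norm_herglotz_kernel_le:
  assumes "cmod z < 1" "cmod \<xi> = 1"
  shows "cmod ((\<xi> + z) / (\<xi> - z)) \<le> 2 / (1 - cmod z)"
  unfolding norm_divide
proof (rule frac_le)
  show "cmod (\<xi> + z) \<le> 2" using norm_triangle_ineq[of \<xi> z] assms by simp
  show "1 - cmod z \<le> cmod (\<xi> - z)" by (rule norm_diff_circle_ge) fact
qed (use assms in auto)

lemma integrable_herglotz_kernel_mult:
  assumes "integrable circle_measure k" "cmod z < 1"
  shows "integrable circle_measure (\<lambda>\<zeta>. (\<zeta> + z) / (\<zeta> - z) * of_real (k \<zeta>))"
  by (rule integrable_bounded_mult_circle[where B="2 / (1 - cmod z)"])
     (use assms norm_herglotz_kernel_le in auto)

lemma Re_herglotz_kernel: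
  assumes "cmod \<xi> = 1"
  shows "Re ((\<xi> + z) / (\<xi> - z)) = poisson_kernel z \<xi>"
proof -
  have "(Re \<xi>)\<^sup>2 + (Im \<xi>)\<^sup>2 = 1" using assms by (simp add: cmod_def)
  then show ?thesis
    unfolding poisson_kernel_def Re_divide cmod_power2
    by (simp add: algebra_simps power2_eq_square)
qed

lemma herglotz_add:
  assumes "integrable circle_measure k" "integrable circle_measure l" "cmod z < 1"
  shows "herglotz (\<lambda>\<zeta>. k \<zeta> + l \<zeta>) z = herglotz k z + herglotz l z"
  unfolding herglotz_def of_real_add distrib_left
  by (intro Bochner_Integration.integral_add integrable_herglotz_kernel_mult assms)

lemma herglotz_cmult: "herglotz (\<lambda>\<zeta>. c * k \<zeta>) z = of_real c * herglotz k z"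
proof -
  have "herglotz (\<lambda>\<zeta>. c * k \<zeta>) z = (LINT \<zeta>|circle_measure. of_real c * ((\<zeta> + z) / (\<zeta> - z) * of_real (k \<zeta>)))"
    unfolding herglotz_def by (simp add: mult_ac)
  then show ?thesis unfolding herglotz_def by (simp only: integral_mult_right_zero)
qed

lemma Re_herglotz:
  assumes "integrable circle_measure k" "cmod z < 1"
  shows "Re (herglotz k z) = (LINT \<zeta>|circle_measure. poisson_kernel z \<zeta> * k \<zeta>)"
proof -
  have "Re (herglotz k z) = (LINT \<zeta>|circle_measure. Re ((\<zeta> + z) / (\<zeta> - z) * of_real (k \<zeta>)))"
    unfolding herglotz_def by (rule integral_Re[OF integrable_herglotz_kernel_mult[OF assms], symmetric])
  also have "\<dots> = (LINT \<zeta>|circle_measure. poisson_kernel z \<zeta> * k \<zeta>)"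
  proof (rule integral_cong_AE)
    have [measurable]: "k \<in> borel_measurable borel"
      using borel_measurable_integrable[OF assms(1)] by simp
    show "(\<lambda>\<zeta>. Re ((\<zeta> + z) / (\<zeta> - z) * of_real (k \<zeta>))) \<in> borel_measurable circle_measure"
      by measurable
    show "(\<lambda>\<zeta>. poisson_kernel z \<zeta> * k \<zeta>) \<in> borel_measurable circle_measure"
      by measurable
    show "AE \<zeta> in circle_measure. Re ((\<zeta> + z) / (\<zeta> - z) * of_real (k \<zeta>)) = poisson_kernel z \<zeta> * k \<zeta>"
      using AE_circle_measure_norm
    proof eventually_elim
      case (elim \<zeta>)
      have "Re (w * of_real r) = Re w * r" for w r by simp
      then show ?case using Re_herglotz_kernel[OF elim] by (simp only:)
    qed
  qed
  finally show ?thesis .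
qed

lemma Re_herglotz_nontangential_limit:
  assumes "integrable circle_measure k"
  shows "AE \<zeta> in circle_measure. cmod \<zeta> = 1 \<and> has_nontangential_limit (\<lambda>z. of_real (Re (herglotz k z))) \<zeta> (of_real (k \<zeta>))"
proof -
  have "integrable circle_measure (\<lambda>\<zeta>. complex_of_real (k \<zeta>))" using assms by simp
  from poisson_integral_nontangential_limit[OF this] AE_circle_measure_norm show ?thesis
  proof eventually_elim
    case (elim \<zeta>)
    have "of_real (Re (herglotz k z)) = (LINT \<xi>|circle_measure. of_real (poisson_kernel z \<xi>) * complex_of_real (k \<xi>))"
      if "cmod z < 1" for z
      unfolding Re_herglotz[OF assms that] of_real_mult[symmetric]
      by (rule integral_complex_of_real[symmetric])
    then show ?case using elim by (subst has_nontangential_limit_cong) auto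
  qed
qed

text \<open>|h| is the exponential of a Poisson integral and tends to exp k; the argument of h is a
  conjugate function and is not controlled this way. So only the modulus of a limit is identified,
  and the existence of the limit is left to Fatou's theorem.\<close>

lemma AE_norm_outer_boundary_value:
  assumes k: "integrable circle_measure k" and c: "cmod c = 1"
    and h: "\<And>z. cmod z < 1 \<Longrightarrow> h z = c * exp (herglotz k z)"
  shows "AE \<zeta> in circle_measure. \<forall>l. has_nontangential_limit h \<zeta> l \<longrightarrow> cmod l = exp (k \<zeta>)"
  using Re_herglotz_nontangential_limit[OF k]
proof eventually_elim
  case (elim \<zeta>)
  show ?case
  proof (intro allI impI)
    fix l assume "has_nontangential_limit h \<zeta> l"
    then have "((\<lambda>z. cmod (h z)) \<longlongrightarrow> cmod l) (at \<zeta> within stolz_region 2 \<zeta>)"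
      unfolding has_nontangential_limit_def by (intro tendsto_norm) auto
    moreover have "((\<lambda>z. cmod (h z)) \<longlongrightarrow> exp (k \<zeta>)) (at \<zeta> within stolz_region 2 \<zeta>)"
    proof (rule Lim_transform_eventually)
      have "((\<lambda>z. complex_of_real (Re (herglotz k z))) \<longlongrightarrow> of_real (k \<zeta>)) (at \<zeta> within stolz_region 2 \<zeta>)"
        using elim unfolding has_nontangential_limit_def by auto
      then have "((\<lambda>z. Re (herglotz k z)) \<longlongrightarrow> k \<zeta>) (at \<zeta> within stolz_region 2 \<zeta>)"
        by (simp only: tendsto_of_real_iff)
      then show "((\<lambda>z. exp (Re (herglotz k z))) \<longlongrightarrow> exp (k \<zeta>)) (at \<zeta> within stolz_region 2 \<zeta>)"
        by (rule tendsto_exp)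
      show "\<forall>\<^sub>F z in at \<zeta> within stolz_region 2 \<zeta>. exp (Re (herglotz k z)) = cmod (h z)"
        unfolding eventually_at_filter
        by (intro always_eventually) (auto simp: stolz_region_def h c norm_mult)
    qed
    ultimately show "cmod l = exp (k \<zeta>)"
      using tendsto_unique at_within_stolz_neq_bot[of \<zeta> 2] elim by auto
  qed
qed

text \<open>The kernel equals 2 / (1 - z/\<xi>) - 1, and its geometric series can be integrated term
  by term; this gives a power series on the disk.\<close>

lemma holomorphic_herglotz:
  assumes k: "integrable circle_measure k"
  shows "herglotz k holomorphic_on ball 0 1"
proof -
  have [measurable]: "k \<in> borel_measurable borel"
    using borel_measurable_integrable[OF k] by simp
  have kc: "integrable circle_measure (\<lambda>\<xi>. complex_of_real (k \<xi>))" using k by simp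
  define a where "a n = (LINT \<xi>|circle_measure. inverse \<xi> ^ n * of_real (k \<xi>))" for n
  define J where "J w = (LINT \<xi>|circle_measure. (\<Sum>n. (w / \<xi>) ^ n * of_real (k \<xi>)))" for w
  have "(\<lambda>n. a n * (w - 0) ^ n) sums J w" if w: "w \<in> ball 0 1" for w
  proof -
    have nm: "AE \<xi> in circle_measure. \<forall>n. norm ((w / \<xi>) ^ n * complex_of_real (k \<xi>)) = cmod w ^ n * \<bar>k \<xi>\<bar>"
      using AE_circle_measure_norm by eventually_elim (simp add: norm_mult norm_power norm_divide)
    have "(\<lambda>n. LINT \<xi>|circle_measure. (w / \<xi>) ^ n * complex_of_real (k \<xi>)) sums J w"
      unfolding J_def
    proof (rule sums_integral)
      show "integrable circle_measure (\<lambda>\<xi>. (w / \<xi>) ^ n * complex_of_real (k \<xi>))" for n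
        by (rule integrable_bounded_mult_circle[OF kc, where B="cmod w ^ n"])
           (simp_all add: norm_power norm_divide)
      show "AE \<xi> in circle_measure. summable (\<lambda>n. norm ((w / \<xi>) ^ n * complex_of_real (k \<xi>)))"
        using nm
      proof eventually_elim
        case (elim \<xi>)
        have "summable (\<lambda>n. cmod w ^ n * \<bar>k \<xi>\<bar>)"
          using w by (intro summable_mult2 summable_geometric) simp
        with elim show ?case by simp
      qed
      have "(LINT \<xi>|circle_measure. norm ((w / \<xi>) ^ n * complex_of_real (k \<xi>))) = cmod w ^ n * (LINT \<xi>|circle_measure. \<bar>k \<xi>\<bar>)" for n
      proof -
        have "(LINT \<xi>|circle_measure. norm ((w / \<xi>) ^ n * complex_of_real (k \<xi>))) = (LINT \<xi>|circle_measure. cmod w ^ n * \<bar>k \<xi>\<bar>)"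
        proof (rule integral_cong_AE)
          show "AE \<xi> in circle_measure. norm ((w / \<xi>) ^ n * complex_of_real (k \<xi>)) = cmod w ^ n * \<bar>k \<xi>\<bar>"
            using nm by eventually_elim blast
        qed simp_all
        then show ?thesis by simp
      qed
      then show "summable (\<lambda>n. LINT \<xi>|circle_measure. norm ((w / \<xi>) ^ n * complex_of_real (k \<xi>)))"
        using w by (simp only:) (intro summable_mult2 summable_geometric, simp)
    qed
    moreover have "(LINT \<xi>|circle_measure. (w / \<xi>) ^ n * complex_of_real (k \<xi>)) = a n * (w - 0) ^ n" for n
    proof -
      have "(LINT \<xi>|circle_measure. (w / \<xi>) ^ n * complex_of_real (k \<xi>)) = (LINT \<xi>|circle_measure. w ^ n * (inverse \<xi> ^ n * complex_of_real (k \<xi>)))"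
        by (simp add: divide_inverse power_mult_distrib mult.assoc)
      then show ?thesis unfolding a_def by simp
    qed
    ultimately show ?thesis by simp
  qed
  then have J: "J holomorphic_on ball 0 1" by (rule power_series_holomorphic)
  have "2 * J z - (LINT \<xi>|circle_measure. of_real (k \<xi>)) = herglotz k z" if z: "z \<in> ball 0 1" for z
  proof -
    have eq: "(\<Sum>n. (z / \<xi>) ^ n * complex_of_real (k \<xi>)) = of_real (k \<xi>) * (1/2) + (\<xi> + z) / (\<xi> - z) * of_real (k \<xi>) * (1/2)"
      if "cmod \<xi> = 1" for \<xi>
    proof -
      have n: "cmod (z / \<xi>) < 1" using z that by (simp add: norm_divide)
      have ne: "\<xi> \<noteq> 0" "\<xi> \<noteq> z" using z that by auto
      have "(\<Sum>n. (z / \<xi>) ^ n * complex_of_real (k \<xi>)) = 1 / (1 - z / \<xi>) * of_real (k \<xi>)"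
        using n by (subst suminf_mult2[symmetric]) (simp_all add: summable_geometric suminf_geometric)
      also have "1 / (1 - z / \<xi>) = 1/2 + (\<xi> + z) / (\<xi> - z) * (1/2)" using ne by (simp add: field_simps)
      also have "(1/2 + w * (1/2)) * r = r * (1/2) + w * r * (1/2)" for w r :: complex
        by (simp add: algebra_simps)
      finally show ?thesis .
    qed
    have i1: "integrable circle_measure (\<lambda>\<xi>. complex_of_real (k \<xi>) * (1/2))"
      by (rule integrable_mult_left) (rule kc)
    have i2: "integrable circle_measure (\<lambda>\<xi>. (\<xi> + z) / (\<xi> - z) * complex_of_real (k \<xi>) * (1/2))"
      by (rule integrable_mult_left) (rule integrable_herglotz_kernel_mult, use k z in auto)
    have "J z = (LINT \<xi>|circle_measure. of_real (k \<xi>) * (1/2) + (\<xi> + z) / (\<xi> - z) * of_real (k \<xi>) * (1/2))"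
      unfolding J_def
    proof (rule integral_cong_AE)
      show "AE \<xi> in circle_measure. (\<Sum>n. (z / \<xi>) ^ n * complex_of_real (k \<xi>)) = of_real (k \<xi>) * (1/2) + (\<xi> + z) / (\<xi> - z) * of_real (k \<xi>) * (1/2)"
        using AE_circle_measure_norm by eventually_elim (rule eq)
    qed measurable
    also have "\<dots> = (LINT \<xi>|circle_measure. of_real (k \<xi>)) * (1/2) + herglotz k z * (1/2)"
      unfolding herglotz_def
      by (simp only: Bochner_Integration.integral_add[OF i1 i2] integral_mult_left_zero)
    finally show ?thesis by simp
  qed
  moreover have "(\<lambda>z. 2 * J z - (LINT \<xi>|circle_measure. of_real (k \<xi>))) holomorphic_on ball 0 1"
    by (intro holomorphic_intros J)
  ultimately show ?thesis by (rule holomorphic_transform[rotated])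
qed

definition outer_exp :: "(complex \<Rightarrow> real) \<Rightarrow> complex \<Rightarrow> complex" where
  "outer_exp k z = (if cmod z < 1 then exp (herglotz k z) else 0)"

lemma outer_exp_Hol_disk: "integrable circle_measure k \<Longrightarrow> outer_exp k \<in> Hol_disk"
proof -
  assume "integrable circle_measure k"
  then have "(\<lambda>z. exp (herglotz k z)) holomorphic_on ball 0 1"
    by (intro holomorphic_intros holomorphic_herglotz)
  then have "outer_exp k holomorphic_on ball 0 1"
    by (rule holomorphic_transform) (simp add: outer_exp_def)
  then show ?thesis by (auto simp: Hol_disk_def outer_exp_def)
qed

lemma outer_function_outer_exp: "integrable circle_measure k \<Longrightarrow> outer_function (outer_exp k)"
  unfolding outer_function_def outer_exp_def herglotz_def
  by (intro exI[of _ 1] exI[of _ k]) simp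

lemma outer_exp_H_infinity:
  assumes k: "integrable circle_measure k" and "\<And>\<zeta>. k \<zeta> \<le> 0"
  shows "outer_exp k \<in> H_infinity"
proof -
  have "cmod (outer_exp k z) \<le> 1" for z
  proof (cases "cmod z < 1")
    case True
    have "0 \<le> (LINT \<zeta>|circle_measure. - (poisson_kernel z \<zeta> * k \<zeta>))"
      by (intro Bochner_Integration.integral_nonneg)
         (simp add: mult_nonneg_nonpos poisson_kernel_nonneg[OF True] assms)
    then have "Re (herglotz k z) \<le> 0" by (simp add: Re_herglotz[OF k True])
    then show ?thesis by (simp add: outer_exp_def)
  qed (simp add: outer_exp_def)
  then show ?thesis
    using outer_exp_Hol_disk[OF k] by (auto simp: H_infinity_def bounded_iff)
qed

section \<open>Closure of the bounded and Smirnov classes under the algebra operations\<close>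

lemma Hol_disk_mult: "f \<in> Hol_disk \<Longrightarrow> g \<in> Hol_disk \<Longrightarrow> (\<lambda>z. f z * g z) \<in> Hol_disk"
  by (auto simp: Hol_disk_def intro!: holomorphic_intros)

lemma Hol_disk_add: "f \<in> Hol_disk \<Longrightarrow> g \<in> Hol_disk \<Longrightarrow> (\<lambda>z. f z + g z) \<in> Hol_disk"
  by (auto simp: Hol_disk_def intro!: holomorphic_intros)

lemma Hol_disk_cmult: "f \<in> Hol_disk \<Longrightarrow> (\<lambda>z. c * f z) \<in> Hol_disk"
  by (auto simp: Hol_disk_def intro!: holomorphic_intros)

lemma bounded_image_mult:
  fixes f g :: "'a \<Rightarrow> complex"
  assumes "bounded (f ` S)" "bounded (g ` S)"
  shows "bounded ((\<lambda>z. f z * g z) ` S)"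
proof -
  obtain a b where ab: "\<And>z. z \<in> S \<Longrightarrow> cmod (f z) \<le> a" "\<And>z. z \<in> S \<Longrightarrow> cmod (g z) \<le> b"
    using assms unfolding bounded_iff by auto
  have "cmod (f z * g z) \<le> a * b" if "z \<in> S" for z
    unfolding norm_mult using ab[OF that] order_trans[OF norm_ge_zero ab(1)[OF that]]
    by (intro mult_mono) auto
  then show ?thesis unfolding bounded_iff by auto
qed

lemma H_infinity_mult: "f \<in> H_infinity \<Longrightarrow> g \<in> H_infinity \<Longrightarrow> (\<lambda>z. f z * g z) \<in> H_infinity"
  by (auto simp: H_infinity_def Hol_disk_mult intro: bounded_image_mult)

lemma H_infinity_add: "f \<in> H_infinity \<Longrightarrow> g \<in> H_infinity \<Longrightarrow> (\<lambda>z. f z + g z) \<in> H_infinity"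
  by (auto simp: H_infinity_def Hol_disk_add intro: bounded_plus_comp)

lemma H_infinity_cmult:
  assumes "f \<in> H_infinity"
  shows "(\<lambda>z. c * f z) \<in> H_infinity"
proof -
  have "bounded ((\<lambda>z::complex. c) ` ball 0 1)" by (auto simp: bounded_iff)
  with assms show ?thesis
    by (auto simp: H_infinity_def Hol_disk_cmult intro: bounded_image_mult)
qed

lemma outer_function_mult:
  assumes "outer_function g" "outer_function h"
  shows "outer_function (\<lambda>z. g z * h z)"
proof -
  obtain c k where 1: "cmod c = 1" "integrable circle_measure k"
    "\<And>z. z \<in> ball 0 1 \<Longrightarrow> g z = c * exp (herglotz k z)"
    using assms(1) unfolding outer_function_def herglotz_def by blast
  obtain d l where 2: "cmod d = 1" "integrable circle_measure l"
    "\<And>z. z \<in> ball 0 1 \<Longrightarrow> h z = d * exp (herglotz l z)"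
    using assms(2) unfolding outer_function_def herglotz_def by blast
  have "g z * h z = (c * d) * exp (herglotz (\<lambda>\<zeta>. k \<zeta> + l \<zeta>) z)" if "z \<in> ball 0 1" for z
    using that by (simp add: 1(3) 2(3) herglotz_add[OF 1(2) 2(2)] exp_add)
  then show ?thesis
    unfolding outer_function_def herglotz_def
    using 1 2 by (intro exI[of _ "c * d"] exI[of _ "\<lambda>\<zeta>. k \<zeta> + l \<zeta>"]) (simp add: norm_mult)
qed

lemma outer_function_nonzero: "outer_function h \<Longrightarrow> cmod z < 1 \<Longrightarrow> h z \<noteq> 0"
  unfolding outer_function_def by fastforce

lemma SmirnovE:
  assumes "f \<in> Smirnov"
  obtains g h where "f \<in> Hol_disk" "g \<in> H_infinity" "h \<in> H_infinity" "outer_function h"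
    "\<And>z. cmod z < 1 \<Longrightarrow> f z = g z / h z"
  using assms unfolding Smirnov_def by auto

lemma SmirnovI:
  assumes "f \<in> Hol_disk" "g \<in> H_infinity" "h \<in> H_infinity" "outer_function h"
    "\<And>z. cmod z < 1 \<Longrightarrow> f z = g z / h z"
  shows "f \<in> Smirnov"
  using assms unfolding Smirnov_def by auto

lemma Smirnov_Hol_disk: "f \<in> Smirnov \<Longrightarrow> f \<in> Hol_disk"
  by (simp add: Smirnov_def)

lemma Smirnov_mult:
  assumes "f1 \<in> Smirnov" "f2 \<in> Smirnov"
  shows "(\<lambda>z. f1 z * f2 z) \<in> Smirnov"
proof -
  obtain g1 h1 where 1: "f1 \<in> Hol_disk" "g1 \<in> H_infinity" "h1 \<in> H_infinity" "outer_function h1"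
    "\<And>z. cmod z < 1 \<Longrightarrow> f1 z = g1 z / h1 z" using SmirnovE[OF assms(1)] by blast
  obtain g2 h2 where 2: "f2 \<in> Hol_disk" "g2 \<in> H_infinity" "h2 \<in> H_infinity" "outer_function h2"
    "\<And>z. cmod z < 1 \<Longrightarrow> f2 z = g2 z / h2 z" using SmirnovE[OF assms(2)] by blast
  show ?thesis
    by (rule SmirnovI[OF Hol_disk_mult H_infinity_mult H_infinity_mult outer_function_mult])
       (use 1 2 in auto)
qed

lemma Smirnov_add:
  assumes "f1 \<in> Smirnov" "f2 \<in> Smirnov"
  shows "(\<lambda>z. f1 z + f2 z) \<in> Smirnov"
proof -
  obtain g1 h1 where 1: "f1 \<in> Hol_disk" "g1 \<in> H_infinity" "h1 \<in> H_infinity" "outer_function h1"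
    "\<And>z. cmod z < 1 \<Longrightarrow> f1 z = g1 z / h1 z" using SmirnovE[OF assms(1)] by blast
  obtain g2 h2 where 2: "f2 \<in> Hol_disk" "g2 \<in> H_infinity" "h2 \<in> H_infinity" "outer_function h2"
    "\<And>z. cmod z < 1 \<Longrightarrow> f2 z = g2 z / h2 z" using SmirnovE[OF assms(2)] by blast
  show ?thesis
  proof (rule SmirnovI[OF Hol_disk_add H_infinity_add H_infinity_mult outer_function_mult])
    show "(\<lambda>z. g1 z * h2 z) \<in> H_infinity" "(\<lambda>z. g2 z * h1 z) \<in> H_infinity"
      using 1 2 by (auto intro: H_infinity_mult)
    fix z :: complex assume z: "cmod z < 1"
    then show "f1 z + f2 z = (g1 z * h2 z + g2 z * h1 z) / (h1 z * h2 z)"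
      using outer_function_nonzero[OF 1(4) z] outer_function_nonzero[OF 2(4) z]
      by (simp add: 1(5) 2(5) field_simps)
  qed (use 1 2 in auto)
qed

lemma Smirnov_cmult:
  assumes "f \<in> Smirnov"
  shows "(\<lambda>z. c * f z) \<in> Smirnov"
proof -
  obtain g h where 1: "f \<in> Hol_disk" "g \<in> H_infinity" "h \<in> H_infinity" "outer_function h"
    "\<And>z. cmod z < 1 \<Longrightarrow> f z = g z / h z" using SmirnovE[OF assms] by blast
  show ?thesis
    by (rule SmirnovI[OF Hol_disk_cmult[OF 1(1)] H_infinity_cmult[OF 1(2), of c] 1(3,4)]) (simp add: 1(5))
qed

lemma outer_exp_zero: "cmod z < 1 \<Longrightarrow> outer_exp (\<lambda>\<zeta>. 0) z = 1"
  by (simp add: outer_exp_def herglotz_def)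

lemma H_infinity_subset_Smirnov: "f \<in> H_infinity \<Longrightarrow> f \<in> Smirnov"
  by (rule SmirnovI[of f f "outer_exp (\<lambda>\<zeta>. 0)"])
     (auto simp: outer_exp_zero outer_function_outer_exp intro!: outer_exp_H_infinity, simp add: H_infinity_def)

lemma outer_exp_cmult:
  assumes "cmod z < 1"
  shows "outer_exp (\<lambda>\<zeta>. c * k \<zeta>) z = exp (of_real c * herglotz k z)"
  using assms by (simp add: outer_exp_def herglotz_cmult)

text \<open>For a nonnegative exponent the function is the reciprocal of a bounded outer function.
  The moduli prescribed later are everywhere at least 1 or everywhere at most 1, so the two signs of
  \<open>k\<close> cover them.\<close>

lemma outer_exp_Smirnov:
  assumes k: "integrable circle_measure k" and k0: "\<And>\<zeta>. 0 \<le> k \<zeta>"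
  shows "outer_exp k \<in> Smirnov"
proof (rule SmirnovI)
  show "outer_exp k \<in> Hol_disk" using k by (rule outer_exp_Hol_disk)
  show "outer_exp (\<lambda>\<zeta>. 0) \<in> H_infinity" by (rule outer_exp_H_infinity) auto
  show "outer_exp (\<lambda>\<zeta>. (-1) * k \<zeta>) \<in> H_infinity" by (rule outer_exp_H_infinity) (use k k0 in auto)
  show "outer_function (outer_exp (\<lambda>\<zeta>. (-1) * k \<zeta>))" by (rule outer_function_outer_exp) (use k in auto)
  fix z :: complex assume z: "cmod z < 1"
  then show "outer_exp k z = outer_exp (\<lambda>\<zeta>. 0) z / outer_exp (\<lambda>\<zeta>. (-1) * k \<zeta>) z"
    by (simp only: outer_exp_zero outer_exp_cmult) (simp add: outer_exp_def exp_minus divide_inverse)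
qed

text \<open>Fatou's theorem gives limits of numerator and denominator, and the limit of the outer
  denominator has modulus exp k > 0, so the quotient of the limits makes sense almost
  everywhere.\<close>

theorem Smirnov_boundary_value:
  assumes "f \<in> Smirnov"
  obtains b where "b \<in> borel_measurable borel"
    "AE \<zeta> in circle_measure. has_nontangential_limit f \<zeta> (b \<zeta>) \<and> boundary_value f \<zeta> = b \<zeta>"
proof -
  obtain g h where 1: "f \<in> Hol_disk" "g \<in> H_infinity" "h \<in> H_infinity" "outer_function h"
    "\<And>z. cmod z < 1 \<Longrightarrow> f z = g z / h z" using SmirnovE[OF assms] by blast
  obtain c k where ck: "cmod c = 1" "integrable circle_measure k"
    "\<And>z. cmod z < 1 \<Longrightarrow> h z = c * exp (herglotz k z)"
    using 1(4) unfolding outer_function_def herglotz_def by auto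
  obtain bg where bg: "bg \<in> borel_measurable borel"
    "AE \<zeta> in circle_measure. has_nontangential_limit g \<zeta> (bg \<zeta>)" using Fatou_H_infinity[OF 1(2)] by blast
  obtain bh where bh: "bh \<in> borel_measurable borel"
    "AE \<zeta> in circle_measure. has_nontangential_limit h \<zeta> (bh \<zeta>)" using Fatou_H_infinity[OF 1(3)] by blast
  have modh: "AE \<zeta> in circle_measure. \<forall>l. has_nontangential_limit h \<zeta> l \<longrightarrow> cmod l = exp (k \<zeta>)"
    by (rule AE_norm_outer_boundary_value[OF ck(2,1)]) (rule ck(3))
  show ?thesis
  proof
    show "(\<lambda>\<zeta>. bg \<zeta> / bh \<zeta>) \<in> borel_measurable borel" using bg(1) bh(1) by measurable
    show "AE \<zeta> in circle_measure. has_nontangential_limit f \<zeta> (bg \<zeta> / bh \<zeta>) \<and> boundary_value f \<zeta> = bg \<zeta> / bh \<zeta>"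
      using modh bg(2) bh(2) AE_circle_measure_norm
    proof eventually_elim
      case (elim \<zeta>)
      then have "cmod (bh \<zeta>) = exp (k \<zeta>)" by blast
      then have "bh \<zeta> \<noteq> 0" by auto
      with elim have "has_nontangential_limit f \<zeta> (bg \<zeta> / bh \<zeta>)"
        by (subst has_nontangential_limit_cong[OF 1(5)]) (auto intro: has_nontangential_limit_divide)
      with elim show ?case using boundary_value_eqI by auto
    qed
  qed
qed

lemma AE_Smirnov_nontangential_limit:
  assumes "f \<in> Smirnov"
  shows "AE \<zeta> in circle_measure. has_nontangential_limit f \<zeta> (boundary_value f \<zeta>)"
proof -
  obtain b where "AE \<zeta> in circle_measure. has_nontangential_limit f \<zeta> (b \<zeta>) \<and> boundary_value f \<zeta> = b \<zeta>"
    using Smirnov_boundary_value[OF assms] by blast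
  then show ?thesis by eventually_elim auto
qed

lemma AE_boundary_value_mult:
  assumes "f \<in> Smirnov" "g \<in> Smirnov"
  shows "AE \<zeta> in circle_measure. boundary_value (\<lambda>z. f z * g z) \<zeta> = boundary_value f \<zeta> * boundary_value g \<zeta>"
  using AE_Smirnov_nontangential_limit[OF assms(1)] AE_Smirnov_nontangential_limit[OF assms(2)] AE_circle_measure_norm
  by eventually_elim (intro boundary_value_eqI has_nontangential_limit_mult)

lemma AE_boundary_value_add:
  assumes "f \<in> Smirnov" "g \<in> Smirnov"
  shows "AE \<zeta> in circle_measure. boundary_value (\<lambda>z. f z + g z) \<zeta> = boundary_value f \<zeta> + boundary_value g \<zeta>"
  using AE_Smirnov_nontangential_limit[OF assms(1)] AE_Smirnov_nontangential_limit[OF assms(2)] AE_circle_measure_norm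
  by eventually_elim (intro boundary_value_eqI has_nontangential_limit_add)

lemma AE_boundary_value_cmult:
  assumes "f \<in> Smirnov"
  shows "AE \<zeta> in circle_measure. boundary_value (\<lambda>z. c * f z) \<zeta> = c * boundary_value f \<zeta>"
  using AE_Smirnov_nontangential_limit[OF assms] AE_circle_measure_norm
  by eventually_elim (intro boundary_value_eqI has_nontangential_limit_mult has_nontangential_limit_const)

lemma AE_norm_boundary_value_outer_exp:
  assumes k: "integrable circle_measure k" and "outer_exp k \<in> Smirnov"
  shows "AE \<zeta> in circle_measure. cmod (boundary_value (outer_exp k) \<zeta>) = exp (k \<zeta>)"
proof -
  have "AE \<zeta> in circle_measure. \<forall>l. has_nontangential_limit (outer_exp k) \<zeta> l \<longrightarrow> cmod l = exp (k \<zeta>)"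
    by (rule AE_norm_outer_boundary_value[OF k, of 1]) (simp_all add: outer_exp_def)
  with AE_Smirnov_nontangential_limit[OF assms(2)] show ?thesis
    by eventually_elim blast
qed

section \<open>Exponential integrability classes\<close>

definition log_plus :: "real \<Rightarrow> real" where
  "log_plus x = ln (max 1 x)"

lemma measurable_log_plus [measurable]: "log_plus \<in> borel_measurable borel"
  unfolding log_plus_def by measurable

lemma log_plus_nonneg [simp]: "0 \<le> log_plus x"
  by (simp add: log_plus_def)

lemma log_plus_mono: "x \<le> y \<Longrightarrow> log_plus x \<le> log_plus y"
  by (simp add: log_plus_def)

lemma log_plus_exp [simp]: "0 \<le> x \<Longrightarrow> log_plus (exp x) = x"
  by (simp add: log_plus_def max_def)

lemma log_plus_le_1: "x \<le> 1 \<Longrightarrow> log_plus x = 0"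
  by (simp add: log_plus_def)

lemma log_plus_mult_le:
  assumes "0 \<le> x" "0 \<le> y"
  shows "log_plus (x * y) \<le> log_plus x + log_plus y"
proof -
  have "max 1 (x * y) \<le> max 1 x * max 1 y"
  proof (rule max.boundedI)
    show "1 \<le> max 1 x * max 1 y" using mult_mono[of 1 "max 1 x" 1 "max 1 y"] by simp
    show "x * y \<le> max 1 x * max 1 y" using assms by (intro mult_mono) auto
  qed
  then have "log_plus (x * y) \<le> ln (max 1 x * max 1 y)"
    unfolding log_plus_def by (intro ln_mono) auto
  also have "\<dots> = log_plus x + log_plus y"
    unfolding log_plus_def by (rule ln_mult_pos) auto
  finally show ?thesis .
qed

text \<open>A normal form that involves no choice of extension. Where the modulus is at most 1,
  \<open>log_plus\<close> vanishes and \<open>0 powr \<beta> = 0\<close> makes the integrand 1,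
  which is harmless for a finite measure.\<close>

definition exp_class :: "real \<Rightarrow> real \<Rightarrow> (complex \<Rightarrow> complex) set" where
  "exp_class d \<beta> = {f \<in> Smirnov.
     (\<integral>\<^sup>+ \<zeta>. ennreal (exp (d * log_plus (cmod (boundary_value f \<zeta>)) powr \<beta>)) \<partial>circle_measure) < \<infinity>}"

lemma nn_integral_finite_dominated:
  assumes [measurable]: "v \<in> borel_measurable circle_measure"
    and "\<And>x. u x \<le> C + v x" "\<And>x. 0 \<le> v x" "0 \<le> (C::real)"
    and "(\<integral>\<^sup>+ x. ennreal (v x) \<partial>circle_measure) < \<infinity>"
  shows "(\<integral>\<^sup>+ x. ennreal (u x) \<partial>circle_measure) < \<infinity>"
proof -
  have "(\<integral>\<^sup>+ x. ennreal (u x) \<partial>circle_measure) \<le> (\<integral>\<^sup>+ x. ennreal C + ennreal (v x) \<partial>circle_measure)"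
    using assms by (intro nn_integral_mono) (simp flip: ennreal_plus add: ennreal_leI)
  also have "\<dots> = (\<integral>\<^sup>+ x. ennreal C \<partial>circle_measure) + (\<integral>\<^sup>+ x. ennreal (v x) \<partial>circle_measure)"
    by (rule nn_integral_add) auto
  also have "\<dots> < \<infinity>"
    using assms(5) by (simp add: emeasure_circle_measure_UNIV)
  finally show ?thesis .
qed

text \<open>The two integrands agree above a threshold and are both bounded below it; as the total
  mass is finite, each integral controls the other up to a constant.\<close>

lemma Hardy_Orlicz_eq_exp_class:
  assumes ext: "exp_power_extension d \<beta> \<phi>" and d: "0 < d" and \<beta>: "0 < \<beta>"
  shows "Hardy_Orlicz (comp_log \<phi>) = exp_class d \<beta>"
proof -
  have sc: "mono \<phi>" "\<And>t. 0 \<le> \<phi> t"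
    using ext by (auto simp: exp_power_extension_def strongly_convex_def)
  have [measurable]: "\<phi> \<in> borel_measurable borel" by (rule borel_measurable_mono[OF sc(1)])
  have [measurable]: "comp_log \<phi> \<in> borel_measurable borel"
    unfolding comp_log_def[abs_def] by measurable
  obtain T0 where T0: "\<And>t. t \<ge> T0 \<Longrightarrow> \<phi> t = exp (d * t powr \<beta>)"
    using ext by (auto simp: exp_power_extension_def eventually_at_top_linorder)
  \<comment> \<open>The maximum with 1 ensures that a modulus whose logarithm is at least
    \<open>T\<close> exceeds 1, where \<open>log_plus\<close> and \<open>ln\<close> agree.\<close>
  define T where "T = max T0 1"
  have T: "T > 0" "\<And>t. t \<ge> T \<Longrightarrow> \<phi> t = exp (d * t powr \<beta>)" using T0 by (auto simp: T_def)
  let ?E = "\<lambda>x. exp (d * log_plus x powr \<beta>)"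
  have big: "log_plus x = ln x" if "x > 0" "ln x \<ge> T" for x
  proof -
    have "0 < ln x" using that T(1) by linarith
    then have "1 < x" using that(1) by (rule ln_gt_zero_imp_gt_one)
    then show ?thesis by (simp add: log_plus_def max_def)
  qed
  have 1: "comp_log \<phi> x \<le> \<phi> T + ?E x" for x
  proof (cases "x > 0 \<and> ln x \<ge> T")
    case True
    then show ?thesis using big[of x] T(2)[of "ln x"] sc(2)[of T] by (simp add: comp_log_def)
  next
    case False
    then have "comp_log \<phi> x \<le> \<phi> T"
      using sc monoD[OF sc(1), of "ln x" T] by (auto simp: comp_log_def)
    then show ?thesis using exp_ge_zero[of "d * log_plus x powr \<beta>"] by linarith
  qed
  have c0: "0 \<le> comp_log \<phi> x" for x using sc by (simp add: comp_log_def)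
  have 2: "?E x \<le> exp (d * T powr \<beta>) + comp_log \<phi> x" for x
  proof (cases "log_plus x \<ge> T")
    case True
    then have "x > 1" using T(1) by (cases "x > 1") (auto simp: log_plus_def)
    then have "x > 0" "log_plus x = ln x" by (auto simp: log_plus_def)
    then have "?E x = comp_log \<phi> x" using True T(2)[of "ln x"] by (simp add: comp_log_def)
    then show ?thesis by simp
  next
    case False
    then have "log_plus x powr \<beta> \<le> T powr \<beta>" using \<beta> by (intro powr_mono2) auto
    then have "?E x \<le> exp (d * T powr \<beta>)" using d by simp
    then show ?thesis using c0[of x] by linarith
  qed
  have "(\<integral>\<^sup>+ \<zeta>. ennreal (comp_log \<phi> (cmod (boundary_value f \<zeta>))) \<partial>circle_measure) < \<infinity> \<longleftrightarrow>
      (\<integral>\<^sup>+ \<zeta>. ennreal (?E (cmod (boundary_value f \<zeta>))) \<partial>circle_measure) < \<infinity>"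
    if f: "f \<in> Smirnov" for f
  proof -
    obtain b where b: "b \<in> borel_measurable borel"
      "AE \<zeta> in circle_measure. has_nontangential_limit f \<zeta> (b \<zeta>) \<and> boundary_value f \<zeta> = b \<zeta>"
      using Smirnov_boundary_value[OF f] by blast
    have [measurable]: "b \<in> borel_measurable circle_measure" using b(1) by simp
    have cong: "(\<integral>\<^sup>+ \<zeta>. ennreal (F (cmod (boundary_value f \<zeta>))) \<partial>circle_measure) =
        (\<integral>\<^sup>+ \<zeta>. ennreal (F (cmod (b \<zeta>))) \<partial>circle_measure)" for F
      by (intro nn_integral_cong_AE) (use b(2) in eventually_elim, simp)
    show ?thesis
      unfolding cong[of "comp_log \<phi>"] cong[of ?E]
    proof
      assume "(\<integral>\<^sup>+ \<zeta>. ennreal (comp_log \<phi> (cmod (b \<zeta>))) \<partial>circle_measure) < \<infinity>"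
      then show "(\<integral>\<^sup>+ \<zeta>. ennreal (?E (cmod (b \<zeta>))) \<partial>circle_measure) < \<infinity>"
        by (rule nn_integral_finite_dominated[rotated -1, where C="exp (d * T powr \<beta>)"])
           (use 2 c0 in auto)
    next
      assume "(\<integral>\<^sup>+ \<zeta>. ennreal (?E (cmod (b \<zeta>))) \<partial>circle_measure) < \<infinity>"
      then show "(\<integral>\<^sup>+ \<zeta>. ennreal (comp_log \<phi> (cmod (b \<zeta>))) \<partial>circle_measure) < \<infinity>"
        by (rule nn_integral_finite_dominated[rotated -1, where C="\<phi> T"])
           (use 1 sc in auto)
    qed
  qed
  then show ?thesis unfolding Hardy_Orlicz_def exp_class_def by blast
qed

lemma exp_class_Smirnov: "f \<in> exp_class d \<beta> \<Longrightarrow> f \<in> Smirnov"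
  by (simp add: exp_class_def)

text \<open>Domination by an integrable \<open>G\<close> requires no measurability of
  \<open>boundary_value f\<close>; the dominating functions are built from the Borel representatives
  that \<open>exp_classE\<close> provides.\<close>

lemma exp_classI:
  assumes "f \<in> Smirnov" "integrable circle_measure G"
    and "AE \<zeta> in circle_measure. exp (d * log_plus (cmod (boundary_value f \<zeta>)) powr \<beta>) \<le> G \<zeta>"
  shows "f \<in> exp_class d \<beta>"
proof -
  have "(\<integral>\<^sup>+ \<zeta>. ennreal (exp (d * log_plus (cmod (boundary_value f \<zeta>)) powr \<beta>)) \<partial>circle_measure)
      \<le> (\<integral>\<^sup>+ \<zeta>. ennreal (norm (G \<zeta>)) \<partial>circle_measure)"
  proof (rule nn_integral_mono_AE)
    show "AE \<zeta> in circle_measure. ennreal (exp (d * log_plus (cmod (boundary_value f \<zeta>)) powr \<beta>)) \<le> ennreal (norm (G \<zeta>))"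
      using assms(3) by eventually_elim (auto intro!: ennreal_leI)
  qed
  also have "\<dots> < \<infinity>" using assms(2) by (simp add: integrable_iff_bounded)
  finally show ?thesis using assms(1) by (simp add: exp_class_def)
qed

lemma exp_classE:
  assumes "f \<in> exp_class d \<beta>"
  obtains b where "b \<in> borel_measurable borel"
    "AE \<zeta> in circle_measure. boundary_value f \<zeta> = b \<zeta>"
    "integrable circle_measure (\<lambda>\<zeta>. exp (d * log_plus (cmod (b \<zeta>)) powr \<beta>))"
proof -
  have f: "f \<in> Smirnov" using assms by (rule exp_class_Smirnov)
  obtain b where b: "b \<in> borel_measurable borel"
    "AE \<zeta> in circle_measure. has_nontangential_limit f \<zeta> (b \<zeta>) \<and> boundary_value f \<zeta> = b \<zeta>"
    using Smirnov_boundary_value[OF f] by blast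
  have [measurable]: "b \<in> borel_measurable circle_measure" using b(1) by simp
  have "(\<integral>\<^sup>+ \<zeta>. ennreal (exp (d * log_plus (cmod (boundary_value f \<zeta>)) powr \<beta>)) \<partial>circle_measure) =
        (\<integral>\<^sup>+ \<zeta>. ennreal (exp (d * log_plus (cmod (b \<zeta>)) powr \<beta>)) \<partial>circle_measure)"
    by (intro nn_integral_cong_AE) (use b(2) in eventually_elim, simp)
  then have "(\<integral>\<^sup>+ \<zeta>. ennreal (exp (d * log_plus (cmod (b \<zeta>)) powr \<beta>)) \<partial>circle_measure) < \<infinity>"
    using assms by (simp add: exp_class_def)
  then have "integrable circle_measure (\<lambda>\<zeta>. exp (d * log_plus (cmod (b \<zeta>)) powr \<beta>))"
    by (intro integrableI_bounded) auto
  then show ?thesis using b by (intro that[of b]) auto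
qed

lemma exp_class_antimono:
  assumes "d' \<le> d"
  shows "exp_class d \<beta> \<subseteq> exp_class d' \<beta>"
proof
  fix f assume f: "f \<in> exp_class d \<beta>"
  obtain b where b: "b \<in> borel_measurable borel"
    "AE \<zeta> in circle_measure. boundary_value f \<zeta> = b \<zeta>"
    "integrable circle_measure (\<lambda>\<zeta>. exp (d * log_plus (cmod (b \<zeta>)) powr \<beta>))"
    using exp_classE[OF f] by blast
  show "f \<in> exp_class d' \<beta>"
  proof (rule exp_classI[OF exp_class_Smirnov[OF f] b(3)])
    show "AE \<zeta> in circle_measure. exp (d' * log_plus (cmod (boundary_value f \<zeta>)) powr \<beta>)
        \<le> exp (d * log_plus (cmod (b \<zeta>)) powr \<beta>)"
      using b(2) by eventually_elim (simp add: assms mult_right_mono)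
  qed
qed

section \<open>Stability of the exponential classes and the loss in the constant d\<close>

lemma powr_add_le_max:
  fixes a b \<gamma> :: real
  assumes "0 \<le> a" "0 \<le> b" "0 < \<gamma>"
  shows "(a + b) powr \<gamma> \<le> 2 powr \<gamma> * max (a powr \<gamma>) (b powr \<gamma>)"
proof -
  have "(a + b) powr \<gamma> \<le> (2 * max a b) powr \<gamma>" using assms by (intro powr_mono2) auto
  also have "\<dots> = 2 powr \<gamma> * max a b powr \<gamma>" by (rule powr_mult)
  also have "max a b powr \<gamma> \<le> max (a powr \<gamma>) (b powr \<gamma>)" by (simp add: max_def)
  finally show ?thesis by simp
qed

text \<open>Bounding a + b by twice the larger summand works for \<gamma> on either side of 1 and
  costs the factor 2^\<gamma> in d. The exponential of a maximum is then estimated by a sum, which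
  keeps integrability.\<close>

lemma exp_scaled_powr_add_le:
  fixes a b d x \<gamma> :: real
  assumes "0 \<le> a" "0 \<le> b" "0 < \<gamma>" "0 < d" "0 \<le> x" "x \<le> a + b"
  shows "exp (d / 2 powr \<gamma> * x powr \<gamma>) \<le> exp (d * a powr \<gamma>) + exp (d * b powr \<gamma>)"
proof -
  have "x powr \<gamma> \<le> (a + b) powr \<gamma>" using assms by (intro powr_mono2) auto
  also have "\<dots> \<le> 2 powr \<gamma> * max (a powr \<gamma>) (b powr \<gamma>)" using assms by (intro powr_add_le_max) auto
  finally have "d / 2 powr \<gamma> * x powr \<gamma> \<le> d / 2 powr \<gamma> * (2 powr \<gamma> * max (a powr \<gamma>) (b powr \<gamma>))"
    using assms by (intro mult_left_mono) auto
  also have "\<dots> = max (d * a powr \<gamma>) (d * b powr \<gamma>)" using assms by (simp add: max_mult_distrib_left)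
  finally have "exp (d / 2 powr \<gamma> * x powr \<gamma>) \<le> exp (max (d * a powr \<gamma>) (d * b powr \<gamma>))" by simp
  also have "\<dots> \<le> exp (d * a powr \<gamma>) + exp (d * b powr \<gamma>)" by (simp add: max_def)
  finally show ?thesis .
qed

lemma exp_class_mult:
  assumes f: "f \<in> exp_class d \<gamma>" and g: "g \<in> exp_class d \<gamma>" and "0 < d" "0 < \<gamma>"
  shows "(\<lambda>z. f z * g z) \<in> exp_class (d / 2 powr \<gamma>) \<gamma>"
proof -
  obtain b where b: "AE \<zeta> in circle_measure. boundary_value f \<zeta> = b \<zeta>"
    "integrable circle_measure (\<lambda>\<zeta>. exp (d * log_plus (cmod (b \<zeta>)) powr \<gamma>))"
    using exp_classE[OF f] by blast
  obtain c where c: "AE \<zeta> in circle_measure. boundary_value g \<zeta> = c \<zeta>"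
    "integrable circle_measure (\<lambda>\<zeta>. exp (d * log_plus (cmod (c \<zeta>)) powr \<gamma>))"
    using exp_classE[OF g] by blast
  note S = exp_class_Smirnov[OF f] exp_class_Smirnov[OF g]
  show ?thesis
  proof (rule exp_classI[OF Smirnov_mult[OF S] Bochner_Integration.integrable_add[OF b(2) c(2)]])
    show "AE \<zeta> in circle_measure. exp (d / 2 powr \<gamma> * log_plus (cmod (boundary_value (\<lambda>z. f z * g z) \<zeta>)) powr \<gamma>)
        \<le> exp (d * log_plus (cmod (b \<zeta>)) powr \<gamma>) + exp (d * log_plus (cmod (c \<zeta>)) powr \<gamma>)"
      using AE_boundary_value_mult[OF S] b(1) c(1)
    proof eventually_elim
      case (elim \<zeta>)
      show ?case
        unfolding elim norm_mult using assms
        by (intro exp_scaled_powr_add_le log_plus_mult_le) auto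
    qed
  qed
qed

lemma exp_class_add:
  assumes f: "f \<in> exp_class d \<gamma>" and g: "g \<in> exp_class d \<gamma>" and d: "0 < d" and \<gamma>: "0 < \<gamma>"
  shows "(\<lambda>z. f z + g z) \<in> exp_class (d / 2 powr \<gamma>) \<gamma>"
proof -
  obtain b where b: "AE \<zeta> in circle_measure. boundary_value f \<zeta> = b \<zeta>"
    "integrable circle_measure (\<lambda>\<zeta>. exp (d * log_plus (cmod (b \<zeta>)) powr \<gamma>))"
    using exp_classE[OF f] by blast
  obtain c where c: "AE \<zeta> in circle_measure. boundary_value g \<zeta> = c \<zeta>"
    "integrable circle_measure (\<lambda>\<zeta>. exp (d * log_plus (cmod (c \<zeta>)) powr \<gamma>))"
    using exp_classE[OF g] by blast
  note S = exp_class_Smirnov[OF f] exp_class_Smirnov[OF g]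
  let ?L = "exp (d * log_plus 2 powr \<gamma>)"
  have "integrable circle_measure (\<lambda>\<zeta>. ?L + (exp (d * log_plus (cmod (b \<zeta>)) powr \<gamma>) + exp (d * log_plus (cmod (c \<zeta>)) powr \<gamma>)))"
    using b(2) c(2) by (intro Bochner_Integration.integrable_add) auto
  then show ?thesis
  proof (rule exp_classI[OF Smirnov_add[OF S]])
    show "AE \<zeta> in circle_measure. exp (d / 2 powr \<gamma> * log_plus (cmod (boundary_value (\<lambda>z. f z + g z) \<zeta>)) powr \<gamma>)
        \<le> ?L + (exp (d * log_plus (cmod (b \<zeta>)) powr \<gamma>) + exp (d * log_plus (cmod (c \<zeta>)) powr \<gamma>))"
      using AE_boundary_value_add[OF S] b(1) c(1)
    proof eventually_elim
      case (elim \<zeta>)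
      let ?m = "max (cmod (b \<zeta>)) (cmod (c \<zeta>))"
      have "cmod (b \<zeta> + c \<zeta>) \<le> 2 * ?m" using norm_triangle_ineq[of "b \<zeta>" "c \<zeta>"] by linarith
      then have "log_plus (cmod (b \<zeta> + c \<zeta>)) \<le> log_plus (2 * ?m)" by (rule log_plus_mono)
      also have "\<dots> \<le> log_plus 2 + log_plus ?m" by (rule log_plus_mult_le) (auto simp: le_max_iff_disj)
      finally have "exp (d / 2 powr \<gamma> * log_plus (cmod (b \<zeta> + c \<zeta>)) powr \<gamma>) \<le> ?L + exp (d * log_plus ?m powr \<gamma>)"
        using d \<gamma> by (intro exp_scaled_powr_add_le) auto
      also have "exp (d * log_plus ?m powr \<gamma>) \<le> exp (d * log_plus (cmod (b \<zeta>)) powr \<gamma>) + exp (d * log_plus (cmod (c \<zeta>)) powr \<gamma>)"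
        by (simp add: max_def)
      finally show ?case unfolding elim by simp
    qed
  qed
qed

lemma exp_class_cmult:
  assumes f: "f \<in> exp_class d \<gamma>" and d: "0 < d" and \<gamma>: "0 < \<gamma>"
  shows "(\<lambda>z. c * f z) \<in> exp_class (d / 2 powr \<gamma>) \<gamma>"
proof -
  obtain b where b: "AE \<zeta> in circle_measure. boundary_value f \<zeta> = b \<zeta>"
    "integrable circle_measure (\<lambda>\<zeta>. exp (d * log_plus (cmod (b \<zeta>)) powr \<gamma>))"
    using exp_classE[OF f] by blast
  note S = exp_class_Smirnov[OF f]
  let ?L = "exp (d * log_plus (cmod c) powr \<gamma>)"
  have "integrable circle_measure (\<lambda>\<zeta>. ?L + exp (d * log_plus (cmod (b \<zeta>)) powr \<gamma>))"
    using b(2) by (intro Bochner_Integration.integrable_add) auto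
  then show ?thesis
  proof (rule exp_classI[OF Smirnov_cmult[OF S]])
    show "AE \<zeta> in circle_measure. exp (d / 2 powr \<gamma> * log_plus (cmod (boundary_value (\<lambda>z. c * f z) \<zeta>)) powr \<gamma>)
        \<le> ?L + exp (d * log_plus (cmod (b \<zeta>)) powr \<gamma>)"
      using AE_boundary_value_cmult[OF S, of c] b(1)
    proof eventually_elim
      case (elim \<zeta>)
      show ?case unfolding elim norm_mult using d \<gamma>
        by (intro exp_scaled_powr_add_le log_plus_mult_le) auto
    qed
  qed
qed

lemma zero_Smirnov: "(\<lambda>z. 0) \<in> Smirnov"
proof (rule H_infinity_subset_Smirnov)
  show "(\<lambda>z. 0) \<in> H_infinity" by (auto simp: H_infinity_def Hol_disk_def bounded_iff)
qed

lemma exp_class_bounded: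
  assumes "f \<in> Smirnov" "AE \<zeta> in circle_measure. cmod (boundary_value f \<zeta>) \<le> 1"
  shows "f \<in> exp_class d \<beta>"
proof (rule exp_classI[OF assms(1)])
  show "integrable circle_measure (\<lambda>\<zeta>. 1::real)" by simp
  show "AE \<zeta> in circle_measure. exp (d * log_plus (cmod (boundary_value f \<zeta>)) powr \<beta>) \<le> 1"
    using assms(2) by eventually_elim (simp add: log_plus_le_1)
qed

lemma zero_exp_class: "(\<lambda>z. 0) \<in> exp_class d \<beta>"
proof (rule exp_class_bounded[OF zero_Smirnov])
  show "AE \<zeta> in circle_measure. cmod (boundary_value (\<lambda>z. 0) \<zeta>) \<le> 1"
    using AE_circle_measure_norm
    by eventually_elim (simp add: boundary_value_eqI[OF _ has_nontangential_limit_const])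
qed

text \<open>Sums, products and scalar multiples shrink d, so the induction invariant is the
  existence of some d > 0; two different constants are first lowered to their minimum.\<close>

lemma Alg_subset_exp_class:
  assumes \<gamma>: "0 < \<gamma>"
  shows "Alg (exp_class 1 \<gamma>) \<subseteq> (\<Union>d\<in>{0<..}. exp_class d \<gamma>)"
proof
  fix f assume "f \<in> Alg (exp_class 1 \<gamma>)"
  then show "f \<in> (\<Union>d\<in>{0<..}. exp_class d \<gamma>)"
  proof induction
    case (gen f)
    then show ?case by (intro UN_I[of 1]) auto
  next
    case zero
    show ?case by (intro UN_I[of 1] zero_exp_class) auto
  next
    case (add f g)
    then obtain d e where "d > 0" "e > 0" "f \<in> exp_class d \<gamma>" "g \<in> exp_class e \<gamma>" by auto
    then have "f \<in> exp_class (min d e) \<gamma>" "g \<in> exp_class (min d e) \<gamma>" "min d e > 0"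
      using exp_class_antimono[of "min d e" d \<gamma>] exp_class_antimono[of "min d e" e \<gamma>] by auto
    then show ?case
      using \<gamma> by (intro UN_I[of "min d e / 2 powr \<gamma>"] exp_class_add) auto
  next
    case (scale f c)
    then obtain d where "d > 0" "f \<in> exp_class d \<gamma>" by auto
    then show ?case
      using \<gamma> by (intro UN_I[of "d / 2 powr \<gamma>"] exp_class_cmult) auto
  next
    case (mult f g)
    then obtain d e where "d > 0" "e > 0" "f \<in> exp_class d \<gamma>" "g \<in> exp_class e \<gamma>" by auto
    then have "f \<in> exp_class (min d e) \<gamma>" "g \<in> exp_class (min d e) \<gamma>" "min d e > 0"
      using exp_class_antimono[of "min d e" d \<gamma>] exp_class_antimono[of "min d e" e \<gamma>] by auto
    then show ?case
      using \<gamma> by (intro UN_I[of "min d e / 2 powr \<gamma>"] exp_class_mult) auto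
  qed
qed

lemma le_const_plus_exp_powr:
  fixes d \<gamma> :: real
  assumes "0 < d" "0 < \<gamma>"
  obtains C :: real where "0 \<le> C" "\<And>t. 0 \<le> t \<Longrightarrow> t \<le> C + exp (d * t powr \<gamma>)"
proof -
  have "\<forall>\<^sub>F t in at_top. t \<le> exp (d * t powr \<gamma>)"
    using assms by real_asymp
  then obtain T where T: "\<And>t. t \<ge> T \<Longrightarrow> t \<le> exp (d * t powr \<gamma>)"
    by (auto simp: eventually_at_top_linorder)
  show ?thesis
  proof
    show "0 \<le> max T 0" by simp
    fix t :: real assume "0 \<le> t"
    have "0 < exp (d * t powr \<gamma>)" by simp
    then show "t \<le> max T 0 + exp (d * t powr \<gamma>)" using T[of t] by (cases "t \<ge> T") linarith+
  qed
qed

text \<open>An outer function needs an integrable exponent. As exp (d t^\<gamma>) eventually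
  dominates t, membership in an exponential class supplies it.\<close>

lemma integrable_of_exp_powr:
  fixes k :: "complex \<Rightarrow> real" and d \<gamma> :: real
  assumes [measurable]: "k \<in> borel_measurable borel" and "\<And>\<zeta>. 0 \<le> k \<zeta>" "0 < d" "0 < \<gamma>"
    and "integrable circle_measure (\<lambda>\<zeta>. exp (d * k \<zeta> powr \<gamma>))"
  shows "integrable circle_measure k"
proof -
  obtain C where C: "0 \<le> C" "\<And>t. 0 \<le> t \<Longrightarrow> t \<le> C + exp (d * t powr \<gamma>)"
    using le_const_plus_exp_powr[OF assms(3,4)] by blast
  show ?thesis
  proof (rule Bochner_Integration.integrable_bound)
    show "integrable circle_measure (\<lambda>\<zeta>. C + exp (d * k \<zeta> powr \<gamma>))" using assms(5) by simp
    show "AE \<zeta> in circle_measure. norm (k \<zeta>) \<le> norm (C + exp (d * k \<zeta> powr \<gamma>))"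
      using C assms(2) by (intro AE_I2) (auto simp: abs_of_nonneg)
  qed simp
qed

lemma Alg_mult_power:
  assumes "p \<in> Alg X" "r \<in> X"
  shows "(\<lambda>z. p z * r z ^ n) \<in> Alg X"
proof (induction n)
  case (Suc n)
  from Alg.mult[OF Suc Alg.gen[OF assms(2)]] show ?case by (simp add: mult_ac)
qed (simp add: assms)

lemma exp_class_subset_Alg:
  assumes \<gamma>: "0 < \<gamma>" and d: "0 < d"
  shows "exp_class d \<gamma> \<subseteq> Alg (exp_class 1 \<gamma>)"
proof
  fix f assume f: "f \<in> exp_class d \<gamma>"
  obtain b where [measurable]: "b \<in> borel_measurable borel"
    and b: "AE \<zeta> in circle_measure. boundary_value f \<zeta> = b \<zeta>"
    and bint: "integrable circle_measure (\<lambda>\<zeta>. exp (d * log_plus (cmod (b \<zeta>)) powr \<gamma>))"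
    using exp_classE[OF f] by blast
  define k where "k \<zeta> = log_plus (cmod (b \<zeta>))" for \<zeta>
  have [measurable]: "k \<in> borel_measurable borel" unfolding k_def by measurable
  have k0: "0 \<le> k \<zeta>" for \<zeta> by (simp add: k_def)
  have k: "integrable circle_measure k"
    by (rule integrable_of_exp_powr[OF _ k0 d \<gamma>]) (use bint in \<open>simp_all add: k_def\<close>)
  \<comment> \<open>With n^\<gamma> \<ge> 1/d the exponent k / n satisfies (k / n)^\<gamma> \<le> d
    k^\<gamma>, so the nth root of the outer function lies in the class with constant 1.\<close>
  obtain n :: nat where n: "(1 / d) powr (1 / \<gamma>) < n" using reals_Archimedean2 by blast
  moreover have "0 < (1 / d) powr (1 / \<gamma>)" using d by simp
  ultimately have n0: "0 < n" by linarith
  have "((1 / d) powr (1 / \<gamma>)) powr \<gamma> \<le> real n powr \<gamma>" using n \<gamma> by (intro powr_mono2) auto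
  then have nd: "1 / d \<le> real n powr \<gamma>" using \<gamma> d by (simp add: powr_powr)
  define q where "q = outer_exp (\<lambda>\<zeta>. (-1) * k \<zeta>)"
  define r where "r = outer_exp (\<lambda>\<zeta>. (1 / n) * k \<zeta>)"
  have qS: "q \<in> Smirnov" unfolding q_def
    by (intro H_infinity_subset_Smirnov outer_exp_H_infinity) (use k k0 in auto)
  have rS: "r \<in> Smirnov" unfolding r_def
    by (intro outer_exp_Smirnov) (use k k0 in auto)
  have q1: "AE \<zeta> in circle_measure. cmod (boundary_value q \<zeta>) = exp ((-1) * k \<zeta>)"
    unfolding q_def by (rule AE_norm_boundary_value_outer_exp) (use k qS q_def in auto)
  have r1: "AE \<zeta> in circle_measure. cmod (boundary_value r \<zeta>) = exp ((1 / n) * k \<zeta>)"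
    unfolding r_def by (rule AE_norm_boundary_value_outer_exp) (use k rS r_def in auto)
  note fS = exp_class_Smirnov[OF f]
  have p: "(\<lambda>z. f z * q z) \<in> exp_class 1 \<gamma>"
  proof (rule exp_class_bounded[OF Smirnov_mult[OF fS qS]])
    show "AE \<zeta> in circle_measure. cmod (boundary_value (\<lambda>z. f z * q z) \<zeta>) \<le> 1"
      using AE_boundary_value_mult[OF fS qS] q1 b
    proof eventually_elim
      case (elim \<zeta>)
      have "exp (k \<zeta>) = max 1 (cmod (b \<zeta>))" by (simp add: k_def log_plus_def)
      then have "cmod (b \<zeta>) \<le> exp (k \<zeta>)" by simp
      then show ?case unfolding elim norm_mult by (simp add: exp_minus field_simps)
    qed
  qed
  have r: "r \<in> exp_class 1 \<gamma>"
  proof (rule exp_classI[OF rS bint])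
    show "AE \<zeta> in circle_measure. exp (1 * log_plus (cmod (boundary_value r \<zeta>)) powr \<gamma>)
        \<le> exp (d * log_plus (cmod (b \<zeta>)) powr \<gamma>)"
      using r1
    proof eventually_elim
      case (elim \<zeta>)
      have "((1 / n) * k \<zeta>) powr \<gamma> = k \<zeta> powr \<gamma> / real n powr \<gamma>"
        using k0 by (simp add: powr_divide)
      also have "\<dots> \<le> d * k \<zeta> powr \<gamma>"
      proof -
        have "1 / real n powr \<gamma> \<le> d" using nd d n0 by (simp add: field_simps)
        from mult_right_mono[OF this, of "k \<zeta> powr \<gamma>"] show ?thesis by simp
      qed
      finally show ?case unfolding elim using k0 by (simp add: k_def)
    qed
  qed
  \<comment> \<open>The identity must hold on all of \<open>complex\<close>: inside the disk
    \<open>q\<close> cancels the nth power of \<open>r\<close>, outside it both sides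
    vanish.\<close>
  have "f = (\<lambda>z. (f z * q z) * r z ^ n)"
  proof
    fix z
    show "f z = (f z * q z) * r z ^ n"
    proof (cases "cmod z < 1")
      case True
      have "r z ^ n = exp (of_nat n * (of_real (1 / n) * herglotz k z))"
        unfolding r_def outer_exp_cmult[OF True] by (rule exp_of_nat_mult[symmetric])
      also have "of_nat n * (of_real (1 / n) * herglotz k z) = herglotz k z" using n0 by simp
      finally have "q z * r z ^ n = 1"
        unfolding q_def outer_exp_cmult[OF True] by (simp add: exp_minus)
      then show ?thesis by (simp add: mult.assoc)
    next
      case False
      then show ?thesis using Smirnov_Hol_disk[OF fS] by (simp add: Hol_disk_def)
    qed
  qed
  also have "\<dots> \<in> Alg (exp_class 1 \<gamma>)"
    by (rule Alg_mult_power[OF Alg.gen[OF p] r])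
  finally show "f \<in> Alg (exp_class 1 \<gamma>)" .
qed

section \<open>Multipliers\<close>

text \<open>In the application a and b are the positive parts of log |f| and log |g|. The additive
  losses in the two cases turn into the factors exp C and exp L, and \<open>K\<close> covers
  both.\<close>

lemma exp_powr_add_le:
  fixes \<alpha> d :: real
  assumes \<alpha>: "0 < \<alpha>" "\<alpha> < 1" and d: "0 < d"
  obtains K where "0 \<le> K" "\<And>a b. 0 \<le> a \<Longrightarrow> 0 \<le> b \<Longrightarrow>
    exp ((a + b) powr \<alpha>) \<le> K * (exp (a powr \<alpha>) + exp (d * b powr (\<alpha> / (1 - \<alpha>))))"
proof -
  define \<gamma> where "\<gamma> = \<alpha> / (1 - \<alpha>)"
  have \<gamma>: "0 < \<gamma>" "\<alpha> < \<gamma>" using \<alpha> by (simp_all add: \<gamma>_def field_simps)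
  \<comment> \<open>Chosen so that C^\<gamma> = 4 / d: if b > C a^(1-\<alpha>), raising to the power
    \<gamma> gives 2 a^\<alpha> \<le> (d/2) b^\<gamma>, half of the available exponent.\<close>
  define C where "C = (4 / d) powr (1 / \<gamma>)"
  have C: "C > 0" using d by (simp add: C_def)
  have C\<gamma>: "C powr \<gamma> = 4 / d" using \<gamma> d by (simp add: C_def powr_powr)
  have "\<forall>\<^sub>F b in at_top. 2 * b powr \<alpha> \<le> d / 2 * b powr \<gamma>"
    using \<alpha> \<gamma> d by real_asymp
  then obtain T where T: "\<And>b. b \<ge> T \<Longrightarrow> 2 * b powr \<alpha> \<le> d / 2 * b powr \<gamma>"
    by (auto simp: eventually_at_top_linorder)
  \<comment> \<open>The other half pays for b: since \<alpha> < \<gamma>, 2 b^\<alpha> \<le> (d/2)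
    b^\<gamma> once b \<ge> T, and \<open>L\<close> covers the smaller b.\<close>
  define L where "L = 2 * \<bar>T\<bar> powr \<alpha>"
  have L: "2 * b powr \<alpha> \<le> L + d / 2 * b powr \<gamma>" if "0 \<le> b" for b
  proof (cases "b \<ge> T")
    case True
    have "0 \<le> L" by (simp add: L_def)
    with T[OF True] show ?thesis by linarith
  next
    case False
    then have "b powr \<alpha> \<le> \<bar>T\<bar> powr \<alpha>" using that \<alpha> by (intro powr_mono2) auto
    moreover have "0 \<le> d / 2 * b powr \<gamma>" using d by simp
    ultimately show ?thesis unfolding L_def by linarith
  qed
  define K where "K = exp C + exp L"
  show ?thesis
  proof
    show "0 \<le> K" by (simp add: K_def add_nonneg_nonneg)
    fix a b :: real assume a: "0 \<le> a" and b: "0 \<le> b"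
    have "exp ((a + b) powr \<alpha>) \<le> exp C * exp (a powr \<alpha>) \<or> exp ((a + b) powr \<alpha>) \<le> exp L * exp (d * b powr \<gamma>)"
    proof (cases "b \<le> C * a powr (1 - \<alpha>)")
      case True
      have "(a + b) powr \<alpha> \<le> a powr \<alpha> + C"
      \<comment> \<open>For a = 0 the case hypothesis forces b = 0. Otherwise 1 + b/a \<ge> 1 allows
        its exponent \<alpha> to be raised to 1, and the increment b a^(\<alpha>-1) is at most
        C.\<close>
      proof (cases "a = 0")
        case False
        then have a: "a > 0" using a by simp
        have "(a + b) powr \<alpha> = a powr \<alpha> * (1 + b / a) powr \<alpha>"
          using a by (simp add: powr_mult[symmetric] distrib_left)
        also have "(1 + b / a) powr \<alpha> \<le> (1 + b / a) powr 1"
          using a b \<alpha> by (intro powr_mono) auto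
        also have "\<dots> = 1 + b / a" using a b by (simp add: add_nonneg_nonneg)
        also have "a powr \<alpha> * (1 + b / a) = a powr \<alpha> + b * (a powr \<alpha> / a)" by (simp add: algebra_simps)
        also have "b * (a powr \<alpha> / a) \<le> C * a powr (1 - \<alpha>) * (a powr \<alpha> / a)"
          using True a by (intro mult_right_mono) auto
        also have "C * a powr (1 - \<alpha>) * (a powr \<alpha> / a) = C * (a powr (1 - \<alpha>) * a powr \<alpha> / a)" by simp
        also have "a powr (1 - \<alpha>) * a powr \<alpha> = a" using a by (simp add: powr_add[symmetric])
        finally show ?thesis using a by simp
      qed (use True b C in auto)
      then have "exp ((a + b) powr \<alpha>) \<le> exp (C + a powr \<alpha>)" by simp
      then show ?thesis by (simp add: exp_add)
    next
      case False
      then have "a powr (1 - \<alpha>) \<le> b / C" using C by (simp add: field_simps)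
      then have "(a powr (1 - \<alpha>)) powr \<gamma> \<le> (b / C) powr \<gamma>" using \<gamma> by (intro powr_mono2) auto
      moreover have "(1 - \<alpha>) * \<gamma> = \<alpha>" using \<alpha> by (simp add: \<gamma>_def)
      ultimately have "a powr \<alpha> \<le> b powr \<gamma> / (4 / d)" using C b by (simp add: powr_powr powr_divide C\<gamma>)
      then have a\<alpha>: "2 * a powr \<alpha> \<le> d / 2 * b powr \<gamma>" by (simp add: mult.commute)
      have "(a + b) powr \<alpha> \<le> 2 powr \<alpha> * max (a powr \<alpha>) (b powr \<alpha>)"
        using a b \<alpha> by (intro powr_add_le_max) auto
      also have "\<dots> \<le> 2 powr 1 * (a powr \<alpha> + b powr \<alpha>)"
        using \<alpha> by (intro mult_mono powr_mono) (auto simp: le_max_iff_disj)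
      also have "\<dots> \<le> L + d * b powr \<gamma>" using a\<alpha> L[OF b] by (simp add: algebra_simps)
      finally have "exp ((a + b) powr \<alpha>) \<le> exp (L + d * b powr \<gamma>)" by simp
      then show ?thesis by (simp add: exp_add)
    qed
    moreover have "exp C * exp (a powr \<alpha>) \<le> K * (exp (a powr \<alpha>) + exp (d * b powr \<gamma>))"
      unfolding K_def by (intro mult_mono) auto
    moreover have "exp L * exp (d * b powr \<gamma>) \<le> K * (exp (a powr \<alpha>) + exp (d * b powr \<gamma>))"
      unfolding K_def by (intro mult_mono) auto
    ultimately show "exp ((a + b) powr \<alpha>) \<le> K * (exp (a powr \<alpha>) + exp (d * b powr (\<alpha> / (1 - \<alpha>))))"
      unfolding \<gamma>_def[symmetric] by linarith
  qed
qed

lemma exp_class_subset_Mult: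
  assumes \<alpha>: "0 < \<alpha>" "\<alpha> < 1" and d: "0 < d"
  shows "exp_class d (\<alpha> / (1 - \<alpha>)) \<subseteq> Mult (exp_class 1 \<alpha>)"
proof
  fix g assume g: "g \<in> exp_class d (\<alpha> / (1 - \<alpha>))"
  obtain K where K: "0 \<le> K" "\<And>a b. 0 \<le> a \<Longrightarrow> 0 \<le> b \<Longrightarrow>
    exp ((a + b) powr \<alpha>) \<le> K * (exp (a powr \<alpha>) + exp (d * b powr (\<alpha> / (1 - \<alpha>))))"
    using exp_powr_add_le[OF \<alpha> d] by blast
  obtain c where c: "AE \<zeta> in circle_measure. boundary_value g \<zeta> = c \<zeta>"
    "integrable circle_measure (\<lambda>\<zeta>. exp (d * log_plus (cmod (c \<zeta>)) powr (\<alpha> / (1 - \<alpha>))))"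
    using exp_classE[OF g] by blast
  have "(\<lambda>z. g z * f z) \<in> exp_class 1 \<alpha>" if f: "f \<in> exp_class 1 \<alpha>" for f
  proof -
    obtain b where b: "AE \<zeta> in circle_measure. boundary_value f \<zeta> = b \<zeta>"
      "integrable circle_measure (\<lambda>\<zeta>. exp (1 * log_plus (cmod (b \<zeta>)) powr \<alpha>))"
      using exp_classE[OF f] by blast
    note S = exp_class_Smirnov[OF g] exp_class_Smirnov[OF f]
    show ?thesis
    proof (rule exp_classI[OF Smirnov_mult[OF S]])
      show "integrable circle_measure (\<lambda>\<zeta>. K * (exp (1 * log_plus (cmod (b \<zeta>)) powr \<alpha>) +
          exp (d * log_plus (cmod (c \<zeta>)) powr (\<alpha> / (1 - \<alpha>)))))"
        by (intro integrable_mult_right Bochner_Integration.integrable_add b(2) c(2))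
      show "AE \<zeta> in circle_measure. exp (1 * log_plus (cmod (boundary_value (\<lambda>z. g z * f z) \<zeta>)) powr \<alpha>)
          \<le> K * (exp (1 * log_plus (cmod (b \<zeta>)) powr \<alpha>) +
          exp (d * log_plus (cmod (c \<zeta>)) powr (\<alpha> / (1 - \<alpha>))))"
        using AE_boundary_value_mult[OF S] b(1) c(1)
      proof eventually_elim
        case (elim \<zeta>)
        let ?a = "log_plus (cmod (b \<zeta>))" and ?b = "log_plus (cmod (c \<zeta>))"
        have "log_plus (cmod (c \<zeta> * b \<zeta>)) \<le> ?a + ?b"
          using log_plus_mult_le[of "cmod (c \<zeta>)" "cmod (b \<zeta>)"] by (simp add: norm_mult)
        then have "log_plus (cmod (c \<zeta> * b \<zeta>)) powr \<alpha> \<le> (?a + ?b) powr \<alpha>"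
          using \<alpha> by (intro powr_mono2) auto
        then have "exp (1 * log_plus (cmod (c \<zeta> * b \<zeta>)) powr \<alpha>) \<le> exp ((?a + ?b) powr \<alpha>)" by simp
        also have "\<dots> \<le> K * (exp (?a powr \<alpha>) + exp (d * ?b powr (\<alpha> / (1 - \<alpha>))))"
          by (intro K(2)) auto
        finally show ?case unfolding elim by simp
      qed
    qed
  qed
  then show "g \<in> Mult (exp_class 1 \<alpha>)"
    using Smirnov_Hol_disk[OF exp_class_Smirnov[OF g]] by (simp add: Mult_def)
qed

section \<open>Necessary decay of the boundary modulus of a multiplier\<close>

lemma integrable_circle_discrete:
  fixes N :: "complex \<Rightarrow> nat" and F :: "nat \<Rightarrow> real"
  assumes N: "N \<in> measurable borel (count_space UNIV)" and F: "\<And>n. 0 \<le> F n"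
    and sum: "summable (\<lambda>n. F n * measure circle_measure {\<zeta>. N \<zeta> = n})"
  shows "integrable circle_measure (\<lambda>\<zeta>. F (N \<zeta>))"
proof (rule integrableI_bounded)
  have [measurable]: "N \<in> measurable circle_measure (count_space UNIV)" using N by simp
  show "(\<lambda>\<zeta>. F (N \<zeta>)) \<in> borel_measurable circle_measure" by measurable
  have E[measurable]: "{\<zeta>. N \<zeta> = n} \<in> sets circle_measure" for n
    using measurable_sets[OF N, of "{n}"] by (simp add: vimage_def)
  have "(\<integral>\<^sup>+ \<zeta>. ennreal (norm (F (N \<zeta>))) \<partial>circle_measure)
      = (\<integral>\<^sup>+ \<zeta>. (\<Sum>n. ennreal (F n) * indicator {\<zeta>. N \<zeta> = n} \<zeta>) \<partial>circle_measure)"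
  proof (rule nn_integral_cong)
    fix \<zeta>
    have "(\<Sum>n. ennreal (F n) * indicator {\<zeta>. N \<zeta> = n} \<zeta>) = (\<Sum>n\<in>{N \<zeta>}. ennreal (F n) * indicator {\<zeta>. N \<zeta> = n} \<zeta>)"
      by (rule suminf_finite) auto
    then show "ennreal (norm (F (N \<zeta>))) = (\<Sum>n. ennreal (F n) * indicator {\<zeta>. N \<zeta> = n} \<zeta>)"
      using F by simp
  qed
  also have "\<dots> = (\<Sum>n. \<integral>\<^sup>+ \<zeta>. ennreal (F n) * indicator {\<zeta>. N \<zeta> = n} \<zeta> \<partial>circle_measure)"
    by (rule nn_integral_suminf) measurable
  also have "\<dots> = (\<Sum>n. ennreal (F n * measure circle_measure {\<zeta>. N \<zeta> = n}))"
    by (intro suminf_cong) (simp add: nn_integral_cmult_indicator circle.emeasure_eq_measure ennreal_mult F)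
  also have "\<dots> < \<infinity>"
    using sum F by (subst suminf_ennreal2) auto
  finally show "(\<integral>\<^sup>+ \<zeta>. ennreal (norm (F (N \<zeta>))) \<partial>circle_measure) < \<infinity>" .
qed

text \<open>Tangent-line bound for the concave function \<open>t \<mapsto> t powr \<alpha>\<close>.\<close>

lemma powr_add_ge:
  fixes A t \<alpha> :: real
  assumes \<alpha>: "0 < \<alpha>" "\<alpha> < 1" and "0 \<le> A" "0 < t"
  shows "A powr \<alpha> + \<alpha> * t * (A + t) powr (\<alpha> - 1) \<le> (A + t) powr \<alpha>"
proof -
  define s where "s = A + t"
  have s: "s > 0" using assms by (simp add: s_def)
  \<comment> \<open>Weighted arithmetic-geometric mean inequality with weights \<alpha> and 1 -
    \<alpha>; multiplied by s^\<alpha> it becomes the tangent at the right endpoint s = A +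
    t.\<close>
  have "(A / s) powr \<alpha> \<le> \<alpha> * (A / s) + (1 - \<alpha>)"
  proof (cases "A = 0")
    case False
    then show ?thesis
      using Youngs_inequality_0[of \<alpha> "1 - \<alpha>" "A / s" 1] assms s by simp
  qed (use \<alpha> in auto)
  then have "s powr \<alpha> * (A / s) powr \<alpha> \<le> s powr \<alpha> * (\<alpha> * (A / s) + (1 - \<alpha>))"
    by (intro mult_left_mono) auto
  also have "s powr \<alpha> * (A / s) powr \<alpha> = A powr \<alpha>"
    using s by (simp add: powr_mult[symmetric])
  also have "\<alpha> * (A / s) + (1 - \<alpha>) = 1 - \<alpha> * t / s"
    using s by (simp add: s_def field_simps)
  also have "s powr \<alpha> * (1 - \<alpha> * t / s) = s powr \<alpha> - \<alpha> * t * (s powr \<alpha> / s)"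
    by (simp add: algebra_simps)
  also have "s powr \<alpha> / s = s powr (\<alpha> - 1)" using s by (simp add: powr_diff)
  finally show ?thesis unfolding s_def by simp
qed

text \<open>This is the constant 1 on the disk, extended by zero. As a test function it places every
  multiplier in the class itself, hence in the Smirnov class, where boundary values are
  available.\<close>

lemma one_in_exp_class: "outer_exp (\<lambda>\<zeta>. 0) \<in> exp_class d \<beta>"
proof (rule exp_class_bounded)
  show S: "outer_exp (\<lambda>\<zeta>. 0) \<in> Smirnov" by (rule outer_exp_Smirnov) auto
  show "AE \<zeta> in circle_measure. cmod (boundary_value (outer_exp (\<lambda>\<zeta>. 0)) \<zeta>) \<le> 1"
    using AE_norm_boundary_value_outer_exp[OF _ S, simplified] by eventually_elim simp
qed

text \<open>The test function is the outer function of modulus \<open>exp (A n)\<close> on the level set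
  \<open>n \<le> log_plus \<bar>g\<bar> < n + 1\<close>. There \<open>exp (A n powr \<alpha>)\<close> is as large as summability permits, and
  \<open>A n \<le> n powr (\<beta>' / \<alpha>)\<close> makes the gain \<open>(A n + n) powr \<alpha> - A n powr \<alpha>\<close> at least a positive
  power of \<open>n\<close>, because \<open>\<beta>' < \<alpha> / (1 - \<alpha>)\<close>.\<close>

lemma Mult_subset_exp_class:
  assumes \<alpha>: "0 < \<alpha>" "\<alpha> < 1" and \<beta>: "0 < \<beta>" "\<beta> < \<alpha> / (1 - \<alpha>)"
  shows "Mult (exp_class 1 \<alpha>) \<subseteq> exp_class 1 \<beta>"
proof
  fix g assume g: "g \<in> Mult (exp_class 1 \<alpha>)"
  then have gH: "g \<in> Hol_disk" and gM: "\<And>f. f \<in> exp_class 1 \<alpha> \<Longrightarrow> (\<lambda>z. g z * f z) \<in> exp_class 1 \<alpha>"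
    by (auto simp: Mult_def)
  have "(\<lambda>z. g z * outer_exp (\<lambda>\<zeta>. 0) z) = g"
  proof
    fix z
    show "g z * outer_exp (\<lambda>\<zeta>. 0) z = g z"
      using gH by (cases "cmod z < 1") (auto simp: outer_exp_zero Hol_disk_def)
  qed
  with gM[OF one_in_exp_class] have "g \<in> exp_class 1 \<alpha>" by simp
  then obtain b where [measurable]: "b \<in> borel_measurable borel"
    and b: "AE \<zeta> in circle_measure. boundary_value g \<zeta> = b \<zeta>" and gS: "g \<in> Smirnov"
    using exp_classE exp_class_Smirnov by metis
  define B where "B \<zeta> = log_plus (cmod (b \<zeta>))" for \<zeta>
  define N where "N \<zeta> = nat \<lfloor>B \<zeta>\<rfloor>" for \<zeta>
  have B0: "0 \<le> B \<zeta>" for \<zeta> by (simp add: B_def)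
  have [measurable]: "B \<in> borel_measurable borel" unfolding B_def by measurable
  have Nm[measurable]: "N \<in> measurable borel (count_space UNIV)" unfolding N_def by measurable
  have NB: "real (N \<zeta>) \<le> B \<zeta>" "B \<zeta> < real (N \<zeta>) + 1" for \<zeta>
    using B0[of \<zeta>] unfolding N_def by linarith+
  define s where "s n = measure circle_measure {\<zeta>. N \<zeta> = n}" for n
  have s0: "0 \<le> s n" for n by (simp add: s_def)
  have E[measurable]: "{\<zeta>. N \<zeta> = n} \<in> sets circle_measure" for n
    using measurable_sets[OF Nm, of "{n}"] by (simp add: vimage_def)
  have sum_s: "summable s"
  proof -
    have "(\<lambda>n. measure circle_measure {\<zeta>. N \<zeta> = n}) sums measure circle_measure (\<Union>n. {\<zeta>. N \<zeta> = n})"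
      by (rule circle.finite_measure_UNION) (auto simp: disjoint_family_on_def)
    then show ?thesis by (simp add: s_def[abs_def] sums_iff)
  qed
  \<comment> \<open>\<beta> < \<beta>' drives the final summation; \<beta>' < \<alpha> / (1 -
    \<alpha>) makes the gain a positive power of n.\<close>
  obtain \<beta>' where \<beta>': "\<beta> < \<beta>'" "\<beta>' < \<alpha> / (1 - \<alpha>)" using dense[OF \<beta>(2)] by blast
  \<comment> \<open>A weight \<open>v n\<close> on the nth level set gives it weighted measure 1 /
    (n+1)^2, which is summable. If \<open>s n = 0\<close>, division by zero yields
    \<open>v n = 0\<close> and then \<open>x n = 0\<close>.\<close>
  define v where "v n = 1 / ((real n + 1)\<^sup>2 * s n)" for n
  define x where "x n = min (real n powr \<beta>') (ln (max 1 (v n)))" for n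
  have x0: "0 \<le> x n" for n by (simp add: x_def)
  define A where "A n = x n powr (1 / \<alpha>)" for n
  have A0: "0 \<le> A n" for n by (simp add: A_def)
  have A\<alpha>: "A n powr \<alpha> = x n" for n using \<alpha> x0[of n] by (simp add: A_def powr_powr)
  have am: "(\<lambda>\<zeta>. A (N \<zeta>)) \<in> borel_measurable borel" by measurable
  have aint: "integrable circle_measure (\<lambda>\<zeta>. exp (1 * A (N \<zeta>) powr \<alpha>))"
  proof (rule integrable_circle_discrete[OF Nm, where F="\<lambda>n. exp (1 * A n powr \<alpha>)"])
    show "summable (\<lambda>n. exp (1 * A n powr \<alpha>) * measure circle_measure {\<zeta>. N \<zeta> = n})"
    proof (rule summable_comparison_test')
      have "summable (\<lambda>n. 1 / (real n + 1)\<^sup>2)"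
        using summable_Suc_iff[of "\<lambda>n. inverse (real n ^ 2)"] inverse_power_summable[of 2, where 'a=real]
        by (simp add: inverse_eq_divide add.commute)
      then show "summable (\<lambda>n. s n + 1 / (real n + 1)\<^sup>2)" by (intro summable_add sum_s)
      fix n :: nat
      have "x n \<le> ln (max 1 (v n))" unfolding x_def by (rule min.cobounded2)
      then have "exp (x n) \<le> exp (ln (max 1 (v n)))" by (simp only: exp_le_cancel_iff)
      also have "\<dots> = max 1 (v n)" by simp
      finally have "exp (x n) * s n \<le> max 1 (v n) * s n" using s0 by (intro mult_right_mono)
      also have "\<dots> \<le> s n + 1 / (real n + 1)\<^sup>2"
        using s0[of n] by (cases "s n = 0") (auto simp: max_def v_def)
      finally show "norm (exp (1 * A n powr \<alpha>) * measure circle_measure {\<zeta>. N \<zeta> = n}) \<le> s n + 1 / (real n + 1)\<^sup>2"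
        by (simp add: A\<alpha> s_def)
    qed
  qed simp
  have ai: "integrable circle_measure (\<lambda>\<zeta>. A (N \<zeta>))"
    by (rule integrable_of_exp_powr[OF am _ _ \<alpha>(1) aint]) (use A0 in auto)
  define u where "u = outer_exp (\<lambda>\<zeta>. A (N \<zeta>))"
  have uS: "u \<in> Smirnov" unfolding u_def by (rule outer_exp_Smirnov[OF ai]) (rule A0)
  have u1: "AE \<zeta> in circle_measure. cmod (boundary_value u \<zeta>) = exp (A (N \<zeta>))"
    unfolding u_def by (rule AE_norm_boundary_value_outer_exp[OF ai]) (use uS u_def in simp)
  have "u \<in> exp_class 1 \<alpha>"
  proof (rule exp_classI[OF uS aint])
    show "AE \<zeta> in circle_measure. exp (1 * log_plus (cmod (boundary_value u \<zeta>)) powr \<alpha>) \<le> exp (1 * A (N \<zeta>) powr \<alpha>)"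
      using u1 by eventually_elim (simp add: A0)
  qed
  from gM[OF this] obtain c where [measurable]: "c \<in> borel_measurable borel"
    and c: "AE \<zeta> in circle_measure. boundary_value (\<lambda>z. g z * u z) \<zeta> = c \<zeta>"
    and cint: "integrable circle_measure (\<lambda>\<zeta>. exp (1 * log_plus (cmod (c \<zeta>)) powr \<alpha>))"
    using exp_classE by blast
  define I where "I = (LINT \<zeta>|circle_measure. exp (1 * log_plus (cmod (c \<zeta>)) powr \<alpha>))"
  have I0: "0 \<le> I" unfolding I_def by (intro Bochner_Integration.integral_nonneg) simp
  \<comment> \<open>Chebyshev's inequality on a level set, where the product has modulus exp (B + A
    n) with B \<ge> n. For n \<ge> 1 the modulus of g exceeds 1 there, so \<open>log_plus\<close> is
    its true logarithm.\<close>
  have level: "exp ((A n + n) powr \<alpha>) * s n \<le> I" if n: "1 \<le> n" for n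
  proof -
    have "exp ((A n + n) powr \<alpha>) * s n = (LINT \<zeta>|circle_measure. exp ((A n + n) powr \<alpha>) * indicator {\<zeta>. N \<zeta> = n} \<zeta>)"
      by (simp add: s_def)
    also have "\<dots> \<le> I"
      unfolding I_def
    proof (rule integral_mono_AE)
      show "integrable circle_measure (\<lambda>\<zeta>. exp ((A n + n) powr \<alpha>) * indicator {\<zeta>. N \<zeta> = n} \<zeta>)"
        by (intro integrable_mult_right integrable_real_indicator E) (simp add: circle.emeasure_eq_measure)
      show "integrable circle_measure (\<lambda>\<zeta>. exp (1 * log_plus (cmod (c \<zeta>)) powr \<alpha>))" by (rule cint)
      show "AE \<zeta> in circle_measure. exp ((A n + n) powr \<alpha>) * indicator {\<zeta>. N \<zeta> = n} \<zeta> \<le> exp (1 * log_plus (cmod (c \<zeta>)) powr \<alpha>)"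
        using AE_boundary_value_mult[OF gS uS] b c u1
      proof eventually_elim
        case (elim \<zeta>)
        show ?case
        proof (cases "N \<zeta> = n")
          case True
          have "1 \<le> B \<zeta>" using NB(1)[of \<zeta>] True n by linarith
          then have "1 < exp (B \<zeta>)" by simp
          moreover have "max 1 (cmod (b \<zeta>)) = exp (B \<zeta>)" by (simp add: B_def log_plus_def)
          ultimately have bB: "cmod (b \<zeta>) = exp (B \<zeta>)" by (simp add: max_def split: if_splits)
          have "cmod (c \<zeta>) = cmod (b \<zeta>) * exp (A n)"
            using elim True by (metis norm_mult)
          then have "cmod (c \<zeta>) = exp (B \<zeta> + A n)" by (simp add: bB exp_add)
          then have "log_plus (cmod (c \<zeta>)) = B \<zeta> + A n" using B0[of \<zeta>] A0[of n] by simp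
          moreover have "(A n + n) powr \<alpha> \<le> (B \<zeta> + A n) powr \<alpha>"
            using NB(1)[of \<zeta>] A0[of n] True \<alpha> by (intro powr_mono2) auto
          ultimately show ?thesis using True by simp
        qed simp
      qed
    qed
    finally show ?thesis .
  qed
  \<comment> \<open>Both \<open>A n\<close> and n are at most n^m, which bounds the slope in the
    tangent estimate from below; \<epsilon> is the exponent of the gain. It is positive for m = 1
    because \<alpha> > 0, and for m = \<beta>'/\<alpha> because \<beta>' < \<alpha> / (1 -
    \<alpha>).\<close>
  define m where "m = max 1 (\<beta>' / \<alpha>)"
  define \<epsilon> where "\<epsilon> = 1 - m * (1 - \<alpha>)"
  have \<epsilon>: "\<epsilon> > 0"
    unfolding \<epsilon>_def m_def max_def using \<alpha> \<beta>' by (simp add: field_simps)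
  define \<kappa> where "\<kappa> = \<alpha> * 2 powr (\<alpha> - 1)"
  have \<kappa>: "\<kappa> > 0" using \<alpha> by (simp add: \<kappa>_def)
  have gain: "x n + \<kappa> * real n powr \<epsilon> \<le> (A n + n) powr \<alpha>" if n: "1 \<le> n" for n
  proof -
    have n1: "1 \<le> real n" using n by simp
    have "A n \<le> (real n powr \<beta>') powr (1 / \<alpha>)"
      unfolding A_def using x0[of n] \<alpha> by (intro powr_mono2) (auto simp: x_def)
    also have "\<dots> = real n powr (\<beta>' / \<alpha>)" by (simp add: powr_powr)
    also have "\<dots> \<le> real n powr m" using n1 by (intro powr_mono) (auto simp: m_def)
    finally have 1: "A n \<le> real n powr m" .
    have "real n powr 1 \<le> real n powr m" using n1 by (intro powr_mono) (auto simp: m_def)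
    with 1 have "A n + n \<le> 2 * real n powr m" using n1 by simp
    then have "(2 * real n powr m) powr (\<alpha> - 1) \<le> (A n + n) powr (\<alpha> - 1)"
      using A0[of n] n1 \<alpha> by (intro powr_mono2') auto
    then have "\<alpha> * n * (2 * real n powr m) powr (\<alpha> - 1) \<le> \<alpha> * n * (A n + n) powr (\<alpha> - 1)"
      using \<alpha> by (intro mult_left_mono) auto
    moreover have "\<alpha> * n * (2 * real n powr m) powr (\<alpha> - 1) = \<kappa> * real n powr \<epsilon>"
    proof -
      have "real n powr \<epsilon> = real n powr (1 + m * (\<alpha> - 1))" by (simp add: \<epsilon>_def algebra_simps)
      also have "\<dots> = real n * real n powr (m * (\<alpha> - 1))" using n1 by (subst powr_add) simp
      finally show ?thesis using n1 by (simp add: \<kappa>_def powr_mult powr_powr)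
    qed
    ultimately show ?thesis
      using powr_add_ge[OF \<alpha> A0[of n], of "real n"] n1 A\<alpha>[of n] by simp
  qed
  have "\<forall>\<^sub>F n in sequentially. I * (real n + 1)\<^sup>2 < exp (\<kappa> * real n powr \<epsilon>)"
    using \<epsilon> \<kappa> by real_asymp
  then have small: "\<forall>\<^sub>F n in sequentially. s n \<le> I * exp (- (real n powr \<beta>'))"
    using eventually_ge_at_top[of 1]
  proof eventually_elim
    case (elim n)
    show ?case
    proof (cases "s n = 0")
      case False
      then have sn: "s n > 0" using s0[of n] by simp
      have "exp (x n + \<kappa> * real n powr \<epsilon>) * s n \<le> exp ((A n + n) powr \<alpha>) * s n"
        using gain[of n] elim sn by (intro mult_right_mono) auto
      also have "\<dots> \<le> I" using level elim by simp
      finally have le: "exp (x n) * exp (\<kappa> * real n powr \<epsilon>) * s n \<le> I" by (simp add: exp_add)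
      \<comment> \<open>The cap is attained: otherwise exp (x n) * s n would be at least 1 /
        (n+1)^2, and the gain would push the level estimate above \<open>I\<close>. With x n =
        n^\<beta>' the level estimate bounds \<open>s n\<close>.\<close>
      have "x n = real n powr \<beta>'"
      proof (rule ccontr)
        assume "x n \<noteq> real n powr \<beta>'"
        then have "x n = ln (max 1 (v n))" by (auto simp: x_def min_def)
        then have "exp (x n) \<ge> v n" by simp
        then have "v n * exp (\<kappa> * real n powr \<epsilon>) * s n \<le> I"
          using le sn by (meson exp_ge_zero less_imp_le mult_right_mono order_trans)
        moreover have "v n * exp (\<kappa> * real n powr \<epsilon>) * s n = exp (\<kappa> * real n powr \<epsilon>) / (real n + 1)\<^sup>2"
          using sn by (simp add: v_def)
        ultimately have "exp (\<kappa> * real n powr \<epsilon>) \<le> I * (real n + 1)\<^sup>2"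
          by (simp add: divide_le_eq)
        then show False using elim by simp
      qed
      moreover have "exp (x n) * 1 * s n \<le> exp (x n) * exp (\<kappa> * real n powr \<epsilon>) * s n"
        using sn \<kappa> by (intro mult_right_mono mult_left_mono) auto
      from order_trans[OF this le] have "exp (x n) * s n \<le> I" by simp
      ultimately have "exp (real n powr \<beta>') * s n \<le> I" by simp
      then show ?thesis by (simp add: exp_minus field_simps)
    qed (use I0 in simp)
  qed
  \<comment> \<open>The added 1 accounts for B < N + 1 on each level set; exp ((n+1)^\<beta> -
    n^\<beta>') is summable since \<beta> < \<beta>'.\<close>
  have "integrable circle_measure (\<lambda>\<zeta>. exp ((real (N \<zeta>) + 1) powr \<beta>))"
  proof (rule integrable_circle_discrete[OF Nm, where F="\<lambda>n. exp ((real n + 1) powr \<beta>)"])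
    show "summable (\<lambda>n. exp ((real n + 1) powr \<beta>) * measure circle_measure {\<zeta>. N \<zeta> = n})"
    proof (rule summable_comparison_test_ev)
      show "summable (\<lambda>n. I * inverse (real n ^ 2))"
        by (intro summable_mult inverse_power_summable) simp
      have "\<forall>\<^sub>F n in sequentially. exp ((real n + 1) powr \<beta>) * exp (- (real n powr \<beta>')) \<le> inverse (real n ^ 2)"
        using \<beta> \<beta>' by real_asymp
      then show "\<forall>\<^sub>F n in sequentially. norm (exp ((real n + 1) powr \<beta>) * measure circle_measure {\<zeta>. N \<zeta> = n}) \<le> I * inverse (real n ^ 2)"
        using small
      proof eventually_elim
        case (elim n)
        have "exp ((real n + 1) powr \<beta>) * s n \<le> exp ((real n + 1) powr \<beta>) * (I * exp (- (real n powr \<beta>')))"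
          using elim by (intro mult_left_mono) auto
        also have "\<dots> = I * (exp ((real n + 1) powr \<beta>) * exp (- (real n powr \<beta>')))" by simp
        also have "\<dots> \<le> I * inverse (real n ^ 2)" using elim I0 by (intro mult_left_mono) auto
        finally show ?case using s0[of n] by (simp add: s_def)
      qed
    qed
  qed simp
  then show "g \<in> exp_class 1 \<beta>"
  proof (rule exp_classI[OF gS])
    show "AE \<zeta> in circle_measure. exp (1 * log_plus (cmod (boundary_value g \<zeta>)) powr \<beta>) \<le> exp ((real (N \<zeta>) + 1) powr \<beta>)"
      using b
    proof eventually_elim
      case (elim \<zeta>)
      have "B \<zeta> powr \<beta> \<le> (real (N \<zeta>) + 1) powr \<beta>"
        using NB(2)[of \<zeta>] B0[of \<zeta>] \<beta> by (intro powr_mono2) auto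
      then show ?case unfolding elim B_def by simp
    qed
  qed
qed

theorem corollary3p7:
  fixes \<alpha> :: real
    and \<phi> :: "real \<Rightarrow> real \<Rightarrow> real"
    and \<phi>d :: "real \<Rightarrow> real \<Rightarrow> real \<Rightarrow> real"
  assumes "0 < \<alpha>" and "\<alpha> < 1"
    and "\<And>\<beta>. 0 < \<beta> \<Longrightarrow> exp_power_extension 1 \<beta> (\<phi> \<beta>)"
    and "\<And>d \<beta>. 0 < d \<Longrightarrow> 0 < \<beta> \<Longrightarrow> exp_power_extension d \<beta> (\<phi>d d \<beta>)"
  shows "Alg (Hardy_Orlicz (comp_log (\<phi> (\<alpha> / (1 - \<alpha>))))) =
           (\<Union>d\<in>{0<..}. Hardy_Orlicz (comp_log (\<phi>d d (\<alpha> / (1 - \<alpha>))))) \<and>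
         (\<Union>d\<in>{0<..}. Hardy_Orlicz (comp_log (\<phi>d d (\<alpha> / (1 - \<alpha>))))) \<subseteq>
           Mult (Hardy_Orlicz (comp_log (\<phi> \<alpha>))) \<and>
         Mult (Hardy_Orlicz (comp_log (\<phi> \<alpha>))) \<subseteq>
           (\<Inter>\<beta>\<in>{0<..<\<alpha> / (1 - \<alpha>)}. Hardy_Orlicz (comp_log (\<phi> \<beta>)))"
proof -
  have \<gamma>: "0 < \<alpha> / (1 - \<alpha>)" using assms(1,2) by simp
  \<comment> \<open>Every admissible extension gives the same \<open>exp_class\<close>, so the
    arbitrary families disappear before the three claims are treated.\<close>
  have 1: "Hardy_Orlicz (comp_log (\<phi> \<beta>)) = exp_class 1 \<beta>" if "0 < \<beta>" for \<beta>
    by (rule Hardy_Orlicz_eq_exp_class[OF assms(3)[OF that] zero_less_one that])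
  have 2: "(\<Union>d\<in>{0<..}. Hardy_Orlicz (comp_log (\<phi>d d (\<alpha> / (1 - \<alpha>))))) = (\<Union>d\<in>{0<..}. exp_class d (\<alpha> / (1 - \<alpha>)))"
    by (intro SUP_cong refl Hardy_Orlicz_eq_exp_class assms(4) \<gamma>) auto
  have 3: "(\<Inter>\<beta>\<in>{0<..<\<alpha> / (1 - \<alpha>)}. Hardy_Orlicz (comp_log (\<phi> \<beta>))) = (\<Inter>\<beta>\<in>{0<..<\<alpha> / (1 - \<alpha>)}. exp_class 1 \<beta>)"
    by (intro INF_cong refl 1) auto
  show ?thesis
    unfolding 1[OF \<gamma>] 1[OF assms(1)] 2 3
  proof (intro conjI)
    show "Alg (exp_class 1 (\<alpha> / (1 - \<alpha>))) = (\<Union>d\<in>{0<..}. exp_class d (\<alpha> / (1 - \<alpha>)))"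
      using Alg_subset_exp_class[OF \<gamma>] exp_class_subset_Alg[OF \<gamma>] by auto
    show "(\<Union>d\<in>{0<..}. exp_class d (\<alpha> / (1 - \<alpha>))) \<subseteq> Mult (exp_class 1 \<alpha>)"
      using exp_class_subset_Mult[OF assms(1,2)] by auto
    show "Mult (exp_class 1 \<alpha>) \<subseteq> (\<Inter>\<beta>\<in>{0<..<\<alpha> / (1 - \<alpha>)}. exp_class 1 \<beta>)"
      by (intro INT_greatest Mult_subset_exp_class[OF assms(1,2)]) auto
  qed
qed

end
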